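(* Let $N\ge2$, let $\Omega\subset\mathbb{R}^N$ be a domain with compact $C^2$ boundary, $a\in\partial\Omega$, $q_c=2N-1$, and let $g:\mathbb{R}\to\mathbb{R}$ be continuous with $$\liminf_{r\to\infty}\frac{g(r)}{r^{q_c}}>0\quad\text{and}\quad\limsup_{r\to-\infty}\frac{g(r)}{|r|^{q_c}}<0.$$ Let $u\in C^1(\overline\Omega\setminus\{a\})$ be a solution of $-\operatorname{div}(|Du|^{N-2}Du)+g(u)=0$ in $\Omega$ which coincides on $\partial\Omega\setminus\{a\}$ with some $\phi\in C^1(\partial\Omega)$. Then $u$ extends to $\overline\Omega$ as a continuous function.
   Context: Solutions are understood in the weak sense. *)

theory Defs
  imports "HOL-Analysis.Analysis"
begin

definition C1_on :: "('a::euclidean_space \<Rightarrow> real) \<Rightarrow> 'a set \<Rightarrow> bool" where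
  "C1_on f S \<longleftrightarrow> (\<exists>f'. (\<forall>x\<in>S. (f has_derivative (\<lambda>h. f' x \<bullet> h)) (at x))
                         \<and> continuous_on S f')"

definition C2_on :: "('a::euclidean_space \<Rightarrow> real) \<Rightarrow> 'a set \<Rightarrow> bool" where
  "C2_on f S \<longleftrightarrow> (\<exists>f'. (\<forall>x\<in>S. (f has_derivative (\<lambda>h. f' x \<bullet> h)) (at x))
                         \<and> (\<forall>i\<in>Basis. C1_on (\<lambda>x. f' x \<bullet> i) S))"

definition compact_C2_boundary :: "('a::euclidean_space) set \<Rightarrow> bool" where
  "compact_C2_boundary \<Omega> \<longleftrightarrow> compact (frontier \<Omega>) \<and>
     (\<forall>p\<in>frontier \<Omega>. \<exists>r>0. \<exists>\<rho> D\<rho>.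
        (\<forall>x\<in>ball p r. (\<rho> has_derivative (\<lambda>h. D\<rho> x \<bullet> h)) (at x) \<and> D\<rho> x \<noteq> 0)
        \<and> C2_on \<rho> (ball p r)
        \<and> \<Omega> \<inter> ball p r = {x\<in>ball p r. \<rho> x < 0})"

definition test_fun :: "('a::euclidean_space) set \<Rightarrow> ('a \<Rightarrow> real) \<Rightarrow> ('a \<Rightarrow> 'a) \<Rightarrow> bool" where
  "test_fun \<Omega> \<zeta> D\<zeta> \<longleftrightarrow> (\<forall>x. (\<zeta> has_derivative (\<lambda>h. D\<zeta> x \<bullet> h)) (at x))
     \<and> continuous_on UNIV D\<zeta>
     \<and> (\<exists>K. compact K \<and> K \<subseteq> \<Omega> \<and> (\<forall>x. x \<notin> K \<longrightarrow> \<zeta> x = 0))"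

text \<open>Weak solution of  -div(|Du|^(N-2) Du) + g(u) = 0  in \<Omega>, where Du is the gradient
  of u in \<Omega>, N = CARD('n).\<close>
definition weak_solution ::
  "(real^'n) set \<Rightarrow> (real \<Rightarrow> real) \<Rightarrow> (real^'n \<Rightarrow> real) \<Rightarrow> (real^'n \<Rightarrow> real^'n) \<Rightarrow> bool" where
  "weak_solution \<Omega> g u Du \<longleftrightarrow>
     (\<forall>\<zeta> D\<zeta>. test_fun \<Omega> \<zeta> D\<zeta> \<longrightarrow>
        (LINT x:\<Omega>|lborel. norm (Du x) ^ (CARD('n) - 2) * (Du x \<bullet> D\<zeta> x) + g (u x) * \<zeta> x) = 0)"

end

theory Submission
  imports Defs
begin

text \<open>
  The proof is a comparison argument with explicit barriers. The inversion at \<open>a\<close>, followed by a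
  translation, maps the complement of a ball touching \<open>\<Omega>\<close> at \<open>a\<close> from outside to a half-space
  \<open>e \<bullet> z > 0\<close> and \<open>a\<close> to infinity. The \<open>N\<close>-Laplacian is conformally invariant, so the equation
  becomes \<open>- \<Delta>\<^sub>N v + W g(v) = 0\<close> with \<open>W z\<close> comparable to \<open>|z|\<close> to the power \<open>- 2 N\<close>; the
  exponent \<open>2 N - 1\<close> is the one for which this is invariant under the scaling \<open>\<lambda> v(z / \<lambda>)\<close>.

  For large \<open>M\<close> one gets first \<open>v - M \<le> C |z|\<close> (Keller-Osserman), then \<open>v - M \<le> C (e \<bullet> z)\<close>. If \<open>K\<close>
  is the least constant with \<open>v - M \<le> K (e \<bullet> z)\<close> and \<open>K > 0\<close>, the absorption in balls tangent to
  the boundary lowers \<open>K\<close> by an amount that, by scaling invariance, does not depend on the size of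
  the ball; hence \<open>K = 0\<close> and \<open>u\<close> is bounded above near \<open>a\<close>. Then the upper limit of \<open>v\<close> at
  infinity is compared with the boundary value: any excess would again be reduced by a fixed factor.
  The same applies to \<open>- u\<close>.
\<close>

subsection \<open>Divergence and comparison\<close>

text \<open>The bound of Keller and Osserman leaves linear growth, and \<open>e \<bullet> z\<close>
  is N-harmonic, positive in the half-space and zero on its boundary, so only the absorption can
  exclude a multiple of it. Where \<open>v\<close> has size K \<rho> in a ball of radius \<rho>, the
  absorption has size \<rho>^(-2N) \<rho>^(2N-1) = 1/\<rho> for fixed K, exactly like the
  N-Laplacian of a profile rescaled to that ball. This is why one correction serves all scales.

  Since \<open>g\<close> is only continuous, without monotonicity, barriers are never inserted into
  \<open>g\<close>: the divergence of a barrier is compared with \<open>g\<close> at the value of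
  the solution, at points where the solution exceeds the barrier. For boundedness such values lie
  where \<open>g\<close> is large. For the limit \<open>g\<close> may have any sign, and the weight
  decides: for a fixed excess S at distance T the barrier contributes a term of size T^(-N), while
  the reaction is at least a constant times -T^(-2N).

  The function \<open>v\<close> lives on the open set \<open>U\<close> only. Its boundary values
  enter as compactness in \<open>U\<close> of the superlevel sets cut off at large radii.\<close>

lemma compact_support_integrable:
  fixes f :: "'a::euclidean_space \<Rightarrow> real"
  assumes "continuous_on UNIV f" "compact K" "\<And>x. x \<notin> K \<Longrightarrow> f x = 0"
  shows "integrable lborel f"
proof -
  have "integrable lborel (\<lambda>x. indicator K x *\<^sub>R f x)"
    by (rule borel_integrable_compact[OF assms(2) continuous_on_subset[OF assms(1) subset_UNIV]])
  moreover have "(\<lambda>x. indicator K x *\<^sub>R f x) = f"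
  proof
    show "indicator K x *\<^sub>R f x = f x" for x using assms(3)[of x] by (cases "x \<in> K") auto
  qed
  ultimately show ?thesis by simp
qed

text \<open>By translation invariance every difference quotient \<open>q n\<close> has integral
  zero; dominated convergence carries this over to the derivative.\<close>

lemma integral_directional_derivative_zero:
  fixes f :: "'a::euclidean_space \<Rightarrow> real"
  assumes der: "\<And>x. (f has_derivative f' x) (at x)"
    and cont: "continuous_on UNIV (\<lambda>x. f' x b)"
    and K: "compact K" and supp: "\<And>x. x \<notin> K \<Longrightarrow> f x = 0"
  shows "integral\<^sup>L lborel (\<lambda>x. f' x b) = 0"
proof -
  have fc: "continuous_on UNIV f"
    by (meson UNIV_I continuous_at_imp_continuous_on der has_derivative_continuous)
  have f'0: "f' x b = 0" if "x \<notin> K" for x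
  proof -
    have "(f has_derivative (\<lambda>_. 0)) (at x)"
    proof (rule has_derivative_transform_within_open)
      show "((\<lambda>_. 0) has_derivative (\<lambda>_. 0)) (at x)" by simp
      show "open (- K)" using K compact_imp_closed by blast
    qed (use that supp in auto)
    then show ?thesis using der[of x] has_derivative_unique by metis
  qed
  have "bounded ((\<lambda>x. f' x b) ` K)"
    by (rule compact_imp_bounded[OF compact_continuous_image[OF continuous_on_subset[OF cont subset_UNIV] K]])
  then obtain C0 where C0: "\<And>x. x \<in> K \<Longrightarrow> norm (f' x b) \<le> C0" by (auto simp: bounded_iff)
  define C where "C = max C0 0"
  have C: "\<bar>f' x b\<bar> \<le> C" for x
    using C0[of x] f'0[of x] by (cases "x \<in> K") (auto simp: C_def)
  define t where "t n = 1 / (real n + 1)" for n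
  have t: "0 < t n" "t n \<le> 1" for n by (auto simp: t_def)
  have t0: "t \<longlonglongrightarrow> 0"
    unfolding t_def using LIMSEQ_inverse_real_of_nat by (simp add: inverse_eq_divide add.commute)
  define q where "q n x = (f (x + t n *\<^sub>R b) - f x) / t n" for n x
  \<comment> \<open>Contains the supports of all \<open>q n\<close>, because
    \<open>t n \<le> 1\<close>; its indicator times \<open>C\<close> is the common majorant.\<close>
  define K' where "K' = (\<lambda>(x, \<tau>). x - \<tau> *\<^sub>R b) ` (K \<times> {0..1})"
  have K': "compact K'" unfolding K'_def
    by (intro compact_continuous_image compact_Times K compact_Icc)
       (auto simp: case_prod_unfold intro!: continuous_intros)
  have q0: "q n x = 0" if "x \<notin> K'" for n x
  proof -
    have "x \<notin> K" using that unfolding K'_def by (force intro: image_eqI[where x="(x,0)"])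
    moreover have "x + t n *\<^sub>R b \<notin> K"
    proof
      assume "x + t n *\<^sub>R b \<in> K"
      then have "(\<lambda>(x, \<tau>). x - \<tau> *\<^sub>R b) (x + t n *\<^sub>R b, t n) \<in> K'"
        unfolding K'_def using t[of n] by (intro imageI) auto
      then show False using that by simp
    qed
    ultimately show ?thesis using supp by (simp add: q_def)
  qed
  have dir: "((\<lambda>\<tau>. f (x + \<tau> *\<^sub>R b)) has_real_derivative f' (x + \<tau> *\<^sub>R b) b) (at \<tau>)" for x \<tau>
  proof -
    have "((\<lambda>\<tau>. x + \<tau> *\<^sub>R b) has_derivative (\<lambda>h. h *\<^sub>R b)) (at \<tau>)"
      by (auto intro!: derivative_eq_intros)
    from has_derivative_compose[OF this der]
    have "((\<lambda>\<tau>. f (x + \<tau> *\<^sub>R b)) has_derivative (\<lambda>h. f' (x + \<tau> *\<^sub>R b) (h *\<^sub>R b))) (at \<tau>)" .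
    moreover have "(\<lambda>h. f' (x + \<tau> *\<^sub>R b) (h *\<^sub>R b)) = (*) (f' (x + \<tau> *\<^sub>R b) b)"
      by (simp add: fun_eq_iff linear_cmul[OF has_derivative_linear[OF der]])
    ultimately show ?thesis by (simp add: has_field_derivative_def)
  qed
  have qC: "\<bar>q n x\<bar> \<le> C" for n x
  proof -
    obtain z where "f (x + t n *\<^sub>R b) - f (x + 0 *\<^sub>R b) = (t n - 0) * f' (x + z *\<^sub>R b) b"
      using MVT2[of 0 "t n" "\<lambda>\<tau>. f (x + \<tau> *\<^sub>R b)" "\<lambda>\<tau>. f' (x + \<tau> *\<^sub>R b) b"] t[of n] dir[of x] by blast
    then have "q n x = f' (x + z *\<^sub>R b) b" using t[of n] by (simp add: q_def)
    then show ?thesis using C by simp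
  qed
  have qlim: "(\<lambda>n. q n x) \<longlonglongrightarrow> f' x b" for x
  proof -
    have "((\<lambda>\<tau>. f (x + \<tau> *\<^sub>R b)) has_real_derivative f' x b) (at 0)"
      using dir[of x 0] by simp
    then have "((\<lambda>h. (f (x + h *\<^sub>R b) - f x) / h) \<longlongrightarrow> f' x b) (at 0)"
      by (simp add: DERIV_def)
    moreover have "filterlim t (at 0) sequentially"
      using t0 t(1) by (auto simp: filterlim_at less_imp_neq[THEN not_sym])
    ultimately show ?thesis unfolding q_def by (rule filterlim_compose)
  qed
  have int_f: "integrable lborel f" by (rule compact_support_integrable[OF fc K supp])
  have q_zero: "integral\<^sup>L lborel (q n) = 0" for n
  proof -
    have sh: "integrable lborel (\<lambda>x. f (x + t n *\<^sub>R b))"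
      "integral\<^sup>L lborel (\<lambda>x. f (x + t n *\<^sub>R b)) = integral\<^sup>L lborel f"
    proof -
      have "integrable (distr lborel borel ((+) (t n *\<^sub>R b))) f"
        "integral\<^sup>L (distr lborel borel ((+) (t n *\<^sub>R b))) f = integral\<^sup>L lborel f"
        using int_f by (simp_all add: lborel_distr_plus)
      then show "integrable lborel (\<lambda>x. f (x + t n *\<^sub>R b))"
        "integral\<^sup>L lborel (\<lambda>x. f (x + t n *\<^sub>R b)) = integral\<^sup>L lborel f"
        using int_f by (auto simp: integrable_distr_eq integral_distr add.commute)
    qed
    then show ?thesis unfolding q_def using int_f by simp
  qed
  have "(\<lambda>n. integral\<^sup>L lborel (q n)) \<longlonglongrightarrow> integral\<^sup>L lborel (\<lambda>x. f' x b)"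
  proof (rule integral_dominated_convergence[where w="\<lambda>x. C * indicator K' x"])
    show "(\<lambda>x. f' x b) \<in> borel_measurable lborel"
      using cont by (simp add: borel_measurable_continuous_onI)
    have "continuous_on UNIV (q n)" for n unfolding q_def
      using t(1)[of n] by (intro continuous_intros continuous_on_compose2[OF fc]) auto
    then show "q n \<in> borel_measurable lborel" for n
      by (simp add: borel_measurable_continuous_onI)
    show "integrable lborel (\<lambda>x. C * indicator K' x)"
      using emeasure_compact_finite[OF K'] K'
      by (simp add: integrable_indicator_iff compact_imp_closed borel_closed)
    show "AE x in lborel. norm (q n x) \<le> C * indicator K' x" for n
      using qC q0 by (auto simp: indicator_def)
    show "AE x in lborel. (\<lambda>n. q n x) \<longlonglongrightarrow> f' x b" using qlim by simp
  qed
  then show ?thesis by (simp add: q_zero LIMSEQ_const_iff)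
qed

text \<open>Cauchy-Schwarz reduces the expression to (|p|^(n+1) - |q|^(n+1)) (|p| - |q|), a product
  of two factors of equal sign. With n = N - 2 this is the monotonicity of the principal part of the
  equation.\<close>

lemma norm_power_monotone:
  fixes p q :: "'a::real_inner"
  shows "(norm p ^ n *\<^sub>R p - norm q ^ n *\<^sub>R q) \<bullet> (p - q) \<ge> 0"
proof -
  have "(norm p ^ n *\<^sub>R p - norm q ^ n *\<^sub>R q) \<bullet> (p - q)
     = norm p ^ n * (norm p)\<^sup>2 + norm q ^ n * (norm q)\<^sup>2 - (norm p ^ n + norm q ^ n) * (p \<bullet> q)"
    by (simp add: inner_diff_left inner_diff_right inner_commute dot_square_norm algebra_simps
        flip: power2_norm_eq_inner)
  also have "\<dots> \<ge> norm p ^ n * (norm p)\<^sup>2 + norm q ^ n * (norm q)\<^sup>2 - (norm p ^ n + norm q ^ n) * (norm p * norm q)"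
    using norm_cauchy_schwarz[of p q] by (simp add: mult_left_mono)
  also have "norm p ^ n * (norm p)\<^sup>2 + norm q ^ n * (norm q)\<^sup>2 - (norm p ^ n + norm q ^ n) * (norm p * norm q)
     = (norm p ^ Suc n - norm q ^ Suc n) * (norm p - norm q)"
    by (simp add: algebra_simps power2_eq_square)
  also have "\<dots> \<ge> 0"
  proof (cases "norm p \<le> norm q")
    case True
    then have "norm p ^ Suc n \<le> norm q ^ Suc n" by (intro power_mono) auto
    with True show ?thesis by (intro mult_nonpos_nonpos) auto
  next
    case False
    then have "norm p ^ Suc n \<ge> norm q ^ Suc n" by (intro power_mono) auto
    with False show ?thesis by (intro mult_nonneg_nonneg) auto
  qed
  finally show ?thesis by linarith
qed

text \<open>Test functions are required to be C^1. Squaring removes the corner of the positive part,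
  and the gradient remains a nonnegative multiple of the gradient of \<open>w\<close>, which is what
  the monotonicity argument uses.\<close>

lemma pos_part_square_has_derivative:
  assumes "(w has_derivative (\<lambda>h. d \<bullet> h)) (at x)"
  shows "((\<lambda>x. (max (w x) 0)\<^sup>2 :: real) has_derivative (\<lambda>h. ((2 * max (w x) 0) *\<^sub>R d) \<bullet> h)) (at x)"
proof -
  have "((\<lambda>t. (max t 0)\<^sup>2) has_real_derivative 2 * max t 0) (at t)" for t :: real
  proof (cases "t = 0")
    case True
    have "((\<lambda>h::real. (max h 0)\<^sup>2 / h) \<longlongrightarrow> 0) (at 0)"
    proof (rule tendsto_sandwich[of "\<lambda>h. - \<bar>h\<bar>" _ _ "\<lambda>h. \<bar>h\<bar>"])
      have "\<bar>(max h 0)\<^sup>2 / h\<bar> \<le> \<bar>h\<bar>" for h :: real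
        by (auto simp: max_def power2_eq_square)
      then show "\<forall>\<^sub>F h::real in at 0. - \<bar>h\<bar> \<le> (max h 0)\<^sup>2 / h"
        "\<forall>\<^sub>F h::real in at 0. (max h 0)\<^sup>2 / h \<le> \<bar>h\<bar>"
        by (intro always_eventually allI; smt (verit))+
      show "((\<lambda>h::real. - \<bar>h\<bar>) \<longlongrightarrow> 0) (at 0)" "((\<lambda>h::real. \<bar>h\<bar>) \<longlongrightarrow> 0) (at 0)"
        by (auto intro!: tendsto_eq_intros)
    qed
    then show ?thesis using True by (simp add: DERIV_def)
  next
    case False
    then consider "t > 0" | "t < 0" by linarith
    then show ?thesis
    proof cases
      case 1
      have "((\<lambda>t. t\<^sup>2) has_real_derivative 2 * max t 0) (at t)"
        using 1 by (auto intro!: derivative_eq_intros)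
      then show ?thesis
        by (rule has_field_derivative_transform_within_open[where S="{0<..}"]) (use 1 in auto)
    next
      case 2
      have "((\<lambda>t. 0) has_real_derivative 2 * max t 0) (at t)"
        using 2 by auto
      then show ?thesis
        by (rule has_field_derivative_transform_within_open[where S="{..<0}"]) (use 2 in auto)
    qed
  qed
  from has_derivative_compose[OF assms this[unfolded has_field_derivative_def]]
  show ?thesis by (simp add: algebra_simps)
qed

section \<open>Extension by zero and the weak comparison principle\<close>

lemma continuous_nonneg_integral_zero:
  fixes f :: "'a::euclidean_space \<Rightarrow> real"
  assumes c: "continuous_on UNIV f" and i: "integrable lborel f"
    and n: "\<And>x. f x \<ge> 0" and z: "integral\<^sup>L lborel f = 0"
  shows "f x = 0"
proof (rule ccontr)
  assume "f x \<noteq> 0"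
  have "AE x in lborel. f x = 0"
    using z integral_nonneg_eq_0_iff_AE[OF i] n by simp
  then obtain Z where "Z \<in> null_sets lborel" "{x. f x \<noteq> 0} \<subseteq> Z"
    by (auto simp: eventually_ae_filter)
  then have "negligible {x. f x \<noteq> 0}"
    using null_sets_completionI negligible_iff_null_sets negligible_subset by metis
  moreover have "open {x. f x \<noteq> 0}"
    using c by (intro open_Collect_neq) auto
  ultimately show False using open_not_negligible \<open>f x \<noteq> 0\<close> by blast
qed

lemma continuous_on_UNIV_if_supported:
  fixes f :: "'a::topological_space \<Rightarrow> 'b::real_normed_vector"
  assumes O: "open S" and K: "closed K" "K \<subseteq> S"
    and c: "continuous_on S f" and z: "\<And>x. x \<notin> K \<Longrightarrow> f x = 0"
  shows "continuous_on UNIV f"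
proof -
  have "continuous_on (- K) f"
    using z by (simp cong: continuous_on_cong_simp)
  then have "continuous_on (S \<union> - K) f"
    using O K c by (intro continuous_on_open_Un) auto
  moreover have "S \<union> - K = UNIV" using K by auto
  ultimately show ?thesis by simp
qed

text \<open>The equation is tested with the squared positive part of
  \<open>u - \<Psi> - \<epsilon>\<close>, and the vanishing integral of a divergence is subtracted.
  The remaining integrand is nonnegative: one term by monotonicity, one by \<open>ineq\<close>; the
  latter is positive at \<open>x0\<close> if \<open>u x0\<close> exceeds \<open>\<Psi> x0\<close>.
  The sets \<open>S\<close> and \<open>A\<close> are kept apart so that a barrier may become
  infinite on the boundary of \<open>S\<close>: the barrier is smooth in \<open>S\<close>, while
  continuity up to the edge is asked only on the compact \<open>A\<close>, which catches all points
  of \<open>S\<close> where \<open>u\<close> is larger.\<close>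

lemma comparison_weak_solution:
  fixes \<Omega> :: "(real^'n) set" and P :: "real^'n \<Rightarrow> real^'n"
  assumes "open \<Omega>" and sol: "weak_solution \<Omega> g u Du"
    and u_diff: "\<And>x. x \<in> \<Omega> \<Longrightarrow> (u has_derivative (\<lambda>h. Du x \<bullet> h)) (at x)"
    and Du: "continuous_on \<Omega> Du" and g: "continuous_on UNIV g"
    and S: "open S" "S \<subseteq> \<Omega>" and A: "compact A" "A \<subseteq> \<Omega>"
    and sub: "\<And>x. x \<in> S \<Longrightarrow> \<Psi> x < u x \<Longrightarrow> x \<in> A"
    and bd: "\<And>x. x \<in> A \<Longrightarrow> x \<notin> S \<Longrightarrow> u x \<le> \<Psi> x"
    and \<Psi>c: "continuous_on A \<Psi>"
    and \<Psi>d: "\<And>x. x \<in> S \<Longrightarrow> (\<Psi> has_derivative (\<lambda>h. P x \<bullet> h)) (at x)"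
    and Pc: "continuous_on S P"
    and Fd: "\<And>x. x \<in> S \<Longrightarrow>
      ((\<lambda>x. norm (P x) ^ (CARD('n) - 2) *\<^sub>R P x) has_derivative F' x) (at x)"
    and F'c: "\<And>b. b \<in> Basis \<Longrightarrow> continuous_on S (\<lambda>x. F' x b)"
    and ineq: "\<And>x. x \<in> S \<Longrightarrow> \<Psi> x < u x \<Longrightarrow> (\<Sum>b\<in>Basis. F' x b \<bullet> b) < g (u x)"
    and "x0 \<in> S"
  shows "u x0 \<le> \<Psi> x0"
proof (rule ccontr)
  assume "\<not> u x0 \<le> \<Psi> x0"
  define \<epsilon> where "\<epsilon> = (u x0 - \<Psi> x0) / 2"
  have \<epsilon>: "\<epsilon> > 0" "u x0 - \<Psi> x0 - \<epsilon> > 0"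
    using \<open>\<not> u x0 \<le> \<Psi> x0\<close> by (auto simp: \<epsilon>_def field_simps)
  have uc: "continuous_on \<Omega> u"
    by (intro continuous_at_imp_continuous_on ballI has_derivative_continuous[OF u_diff])
  have \<Psi>cS: "continuous_on S \<Psi>"
    by (intro continuous_at_imp_continuous_on ballI has_derivative_continuous[OF \<Psi>d])
  \<comment> \<open>The margin \<open>\<epsilon>\<close> and \<open>bd\<close> keep this set inside
    \<open>S\<close>; the test function vanishes off it and so has compact support in
    \<open>\<Omega>\<close>.\<close>
  define K where "K = {x \<in> A. \<Psi> x + \<epsilon> \<le> u x}"
  have "closed K" unfolding K_def
    by (rule continuous_on_closed_Collect_le[OF _ continuous_on_subset[OF uc A(2)] compact_imp_closed[OF A(1)]])
       (intro continuous_intros \<Psi>c)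
  from compact_Int_closed[OF A(1) this] have Kc: "compact K"
    by (simp add: K_def Int_absorb1 Int_def Collect_conj_eq[symmetric] cong: conj_cong)
  have Kcl: "closed K" using Kc by (rule compact_imp_closed)
  have KS: "K \<subseteq> S" using bd \<epsilon> by (force simp: K_def)
  define n where "n = CARD('n) - 2"
  define F where "F x = norm (P x) ^ n *\<^sub>R P x" for x
  define w where "w x = u x - \<Psi> x - \<epsilon>" for x
  define \<zeta> where "\<zeta> x = (if x \<in> S then (max (w x) 0)\<^sup>2 else 0)" for x
  define D where "D x = (if x \<in> S then (2 * max (w x) 0) *\<^sub>R (Du x - P x) else 0)" for x
  have w0: "w x \<le> 0" if "x \<in> S" "x \<notin> K" for x
    using sub[of x] that \<epsilon> by (force simp: w_def K_def)
  have \<zeta>0: "\<zeta> x = 0" and D0: "D x = 0" if "x \<notin> K" for x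
    using w0[of x] that by (auto simp: \<zeta>_def D_def)
  have wc: "continuous_on S w" unfolding w_def
    by (intro continuous_intros \<Psi>cS continuous_on_subset[OF uc S(2)])
  have DuS: "continuous_on S Du" using Du S(2) continuous_on_subset by blast
  have \<zeta>cS: "continuous_on S \<zeta>"
    by (rule continuous_on_eq[of _ "\<lambda>x. (max (w x) 0)\<^sup>2"]) (auto simp: \<zeta>_def intro!: continuous_intros wc)
  have DcS: "continuous_on S D"
    by (rule continuous_on_eq[of _ "\<lambda>x. (2 * max (w x) 0) *\<^sub>R (Du x - P x)"])
       (auto simp: D_def intro!: continuous_intros wc DuS Pc)
  have Dc: "continuous_on UNIV D"
    by (rule continuous_on_UNIV_if_supported[OF S(1) Kcl KS DcS D0])
  have zero_der: "(f has_derivative (\<lambda>h. 0)) (at x)"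
    if "x \<notin> K" "\<And>y. y \<notin> K \<Longrightarrow> f y = 0" for f :: "real^'n \<Rightarrow> real" and x
    by (rule has_derivative_transform_within_open[of "\<lambda>_. 0" _ _ _ "- K"]) (use that Kcl in auto)
  have \<zeta>dS: "(\<zeta> has_derivative (\<lambda>h. D x \<bullet> h)) (at x)" if "x \<in> S" for x
  proof -
    have "(w has_derivative (\<lambda>h. (Du x - P x) \<bullet> h)) (at x)"
      unfolding w_def using u_diff[of x] \<Psi>d[of x] that S(2)
      by (auto intro!: derivative_eq_intros simp: inner_diff_left)
    from pos_part_square_has_derivative[OF this]
    have "((\<lambda>x. (max (w x) 0)\<^sup>2) has_derivative (\<lambda>h. D x \<bullet> h)) (at x)"
      using that by (simp add: D_def)
    then show ?thesis
      by (rule has_derivative_transform_within_open[OF _ S(1) that]) (simp add: \<zeta>_def)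
  qed
  have \<zeta>d: "(\<zeta> has_derivative (\<lambda>h. D x \<bullet> h)) (at x)" for x
  proof (cases "x \<in> S")
    case False
    then have "x \<notin> K" using KS by auto
    then show ?thesis using zero_der[OF _ \<zeta>0] D0 by simp
  qed (rule \<zeta>dS)
  have "test_fun \<Omega> \<zeta> D"
    unfolding test_fun_def using \<zeta>d Dc Kc KS S(2) \<zeta>0 by blast
  then have lint: "(LINT x:\<Omega>|lborel. norm (Du x) ^ n * (Du x \<bullet> D x) + g (u x) * \<zeta> x) = 0"
    using sol unfolding weak_solution_def n_def by blast
  define I1 where "I1 x = (if x \<in> S then norm (Du x) ^ n * (Du x \<bullet> D x) + g (u x) * \<zeta> x else 0)" for x
  have "(\<lambda>x. indicator \<Omega> x *\<^sub>R (norm (Du x) ^ n * (Du x \<bullet> D x) + g (u x) * \<zeta> x)) = I1"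
    using S(2) by (auto simp: fun_eq_iff I1_def indicator_def D_def \<zeta>_def)
  with lint have int1: "integral\<^sup>L lborel I1 = 0"
    unfolding set_lebesgue_integral_def by metis
  have I10: "I1 x = 0" if "x \<notin> K" for x using that \<zeta>0 D0 by (simp add: I1_def)
  have guS: "continuous_on S (\<lambda>x. g (u x))"
    by (rule continuous_on_compose2[OF g continuous_on_subset[OF uc S(2)]]) simp
  have "continuous_on S (\<lambda>x. norm (Du x) ^ n * (Du x \<bullet> D x) + g (u x) * \<zeta> x)"
    by (intro continuous_intros DuS DcS \<zeta>cS guS)
  then have "continuous_on S I1"
    by (rule continuous_on_eq) (simp add: I1_def)
  then have I1c: "continuous_on UNIV I1"
    by (rule continuous_on_UNIV_if_supported[OF S(1) Kcl KS _ I10])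
  have I1i: "integrable lborel I1" by (rule compact_support_integrable[OF I1c Kc I10])
  \<comment> \<open>A component of the field \<zeta> |P|^n P, extended by zero. Its divergence
    integrates to zero, which stands in for a weak formulation satisfied by the barrier.\<close>
  define G where "G b x = (if x \<in> S then \<zeta> x * (F x \<bullet> b) else 0)" for b x
  define G' where "G' b x h = (if x \<in> S then (D x \<bullet> h) * (F x \<bullet> b) + \<zeta> x * (F' x h \<bullet> b) else 0)" for b x h
  have Fd': "(F has_derivative F' x) (at x)" if "x \<in> S" for x
    using Fd[OF that] by (simp add: F_def[abs_def] n_def)
  have FcS: "continuous_on S F"
    unfolding F_def by (intro continuous_intros Pc)
  have G0: "G b x = 0" and G'0: "G' b x h = 0" if "x \<notin> K" for b x h
    using that \<zeta>0 D0 by (auto simp: G_def G'_def)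
  have Gd: "(G b has_derivative G' b x) (at x)" for b x
  proof (cases "x \<in> S")
    case True
    have "((\<lambda>x. \<zeta> x * (F x \<bullet> b)) has_derivative G' b x) (at x)"
      unfolding G'_def using True Fd'[OF True] \<zeta>d[of x]
      by (auto intro!: derivative_eq_intros simp: algebra_simps)
    then show ?thesis
      by (rule has_derivative_transform_within_open[OF _ S(1) True]) (simp add: G_def)
  next
    case False
    then have "x \<notin> K" using KS by auto
    then have "(G b has_derivative (\<lambda>h. 0)) (at x)" by (rule zero_der[OF _ G0])
    moreover have "G' b x = (\<lambda>h. 0)" using G'0[OF \<open>x \<notin> K\<close>] by (simp add: fun_eq_iff)
    ultimately show ?thesis by simp
  qed
  have G'c: "continuous_on UNIV (\<lambda>x. G' b x b)" if "b \<in> Basis" for b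
  proof (rule continuous_on_UNIV_if_supported[OF S(1) Kcl KS _ G'0])
    show "continuous_on S (\<lambda>x. G' b x b)"
    proof (rule continuous_on_eq)
      show "continuous_on S (\<lambda>x. (D x \<bullet> b) * (F x \<bullet> b) + \<zeta> x * (F' x b \<bullet> b))"
        by (intro continuous_intros DcS FcS \<zeta>cS F'c that)
    qed (simp add: G'_def)
  qed
  define I2 where "I2 x = (\<Sum>b\<in>Basis. G' b x b)" for x
  have G'i: "integrable lborel (\<lambda>x. G' b x b)" if "b \<in> Basis" for b
    by (rule compact_support_integrable[OF G'c[OF that] Kc G'0])
  have int2: "integral\<^sup>L lborel I2 = 0"
    unfolding I2_def
    by (subst Bochner_Integration.integral_sum[OF G'i])
       (auto intro!: sum.neutral integral_directional_derivative_zero[OF Gd G'c Kc G0])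
  have I2c: "continuous_on UNIV I2" unfolding I2_def by (intro continuous_intros G'c)
  have I2i: "integrable lborel I2" unfolding I2_def by (intro Bochner_Integration.integrable_sum G'i)
  have diff: "I1 x - I2 x = (norm (Du x) ^ n *\<^sub>R Du x - F x) \<bullet> D x + (g (u x) - (\<Sum>b\<in>Basis. F' x b \<bullet> b)) * \<zeta> x"
    if "x \<in> S" for x
  proof -
    have "(\<Sum>b\<in>Basis. (D x \<bullet> b) * (F x \<bullet> b)) = F x \<bullet> D x"
      by (simp add: euclidean_inner[of "F x" "D x"] mult.commute)
    then show ?thesis using that
      by (simp add: I1_def I2_def G'_def sum.distrib inner_diff_left algebra_simps sum_distrib_left)
  qed
  have mono: "(norm (Du x) ^ n *\<^sub>R Du x - F x) \<bullet> D x \<ge> 0" if "x \<in> S" for x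
  proof -
    have "(norm (Du x) ^ n *\<^sub>R Du x - F x) \<bullet> D x
        = (2 * max (w x) 0) * ((norm (Du x) ^ n *\<^sub>R Du x - norm (P x) ^ n *\<^sub>R P x) \<bullet> (Du x - P x))"
      using that by (simp add: D_def F_def)
    also have "\<dots> \<ge> 0"
      by (intro mult_nonneg_nonneg norm_power_monotone) auto
    finally show ?thesis .
  qed
  have pos: "(g (u x) - (\<Sum>b\<in>Basis. F' x b \<bullet> b)) * \<zeta> x \<ge> 0" if "x \<in> S" for x
  proof (cases "w x > 0")
    case True
    then have "\<Psi> x < u x" using \<epsilon> by (simp add: w_def)
    then have "g (u x) - (\<Sum>b\<in>Basis. F' x b \<bullet> b) > 0" using ineq[OF that] by simp
    then show ?thesis using that by (intro mult_nonneg_nonneg) (auto simp: \<zeta>_def)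
  next
    case False
    then show ?thesis using that by (simp add: \<zeta>_def)
  qed
  have "I1 x - I2 x \<ge> 0" for x
  proof (cases "x \<in> S")
    case True
    then show ?thesis using diff mono pos by simp
  qed (simp add: I1_def I2_def G'_def)
  then have "I1 x0 - I2 x0 = 0"
    using int1 int2 I1i I2i I1c I2c
    by (intro continuous_nonneg_integral_zero[where f="\<lambda>x. I1 x - I2 x"]) (auto intro!: continuous_intros)
  moreover have "(g (u x0) - (\<Sum>b\<in>Basis. F' x0 b \<bullet> b)) * \<zeta> x0 > 0"
  proof (rule mult_pos_pos)
    show "0 < g (u x0) - (\<Sum>b\<in>Basis. F' x0 b \<bullet> b)" using ineq[OF \<open>x0 \<in> S\<close>] \<epsilon> by simp
    show "0 < \<zeta> x0" using \<epsilon>(2) \<open>x0 \<in> S\<close> by (simp add: w_def \<zeta>_def)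
  qed
  ultimately show False using diff[OF \<open>x0 \<in> S\<close>] mono[OF \<open>x0 \<in> S\<close>] by linarith
qed

subsection \<open>Inversion\<close>

text \<open>The reflection in the hyperplane orthogonal to \<open>v\<close>, the orthogonal part of
  the derivative of the inversion. Division by zero makes it the identity for \<open>v = 0\<close>,
  so it is an isometry for every \<open>v\<close>.\<close>

definition refl_along :: "'a::real_inner \<Rightarrow> 'a \<Rightarrow> 'a" where
  "refl_along v h = h - (2 * (v \<bullet> h) / (v \<bullet> v)) *\<^sub>R v"

text \<open>Inversion in the unit sphere around \<open>a\<close>, translated so that infinity
  corresponds to \<open>t\<close>. Exchanging the two parameters gives the inverse map away from the
  centres. At \<open>x = a\<close> division by zero yields the value \<open>t\<close>, whence the
  conditions \<open>x \<noteq> a\<close> below.\<close>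

definition inversion :: "'a::real_inner \<Rightarrow> 'a \<Rightarrow> 'a \<Rightarrow> 'a" where
  "inversion a t x = (1 / ((x - a) \<bullet> (x - a))) *\<^sub>R (x - a) + t"

lemma norm_refl_along [simp]: "norm (refl_along v h) = norm h"
proof (cases "v = 0")
  case False
  then have "refl_along v h \<bullet> refl_along v h = h \<bullet> h"
    by (simp add: refl_along_def inner_diff_left inner_diff_right inner_commute field_simps)
  then show ?thesis by (simp add: norm_eq_sqrt_inner)
qed (simp add: refl_along_def)

lemma refl_along_self_adjoint: "refl_along v p \<bullet> h = p \<bullet> refl_along v h"
  by (simp add: refl_along_def inner_diff_left inner_diff_right inner_commute)

lemma refl_along_scaleR: "refl_along v (r *\<^sub>R h) = r *\<^sub>R refl_along v h"
  by (simp add: refl_along_def scaleR_diff_right)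

lemma inversion_inverse:
  assumes "x \<noteq> a" shows "inversion t a (inversion a t x) = x"
  using assms by (simp add: inversion_def)

lemma inversion_neq: "x \<noteq> a \<Longrightarrow> inversion a t x \<noteq> t"
  by (simp add: inversion_def)

lemma inversion_inner:
  "(inversion a t x - t) \<bullet> (inversion a t x - t) = 1 / ((x - a) \<bullet> (x - a))"
  by (cases "x = a") (simp_all add: inversion_def)

lemma continuous_on_inversion: "a \<notin> S \<Longrightarrow> continuous_on S (inversion a t)"
  unfolding inversion_def by (intro continuous_intros) auto

lemma recip_square_has_derivative:
  fixes a :: "'a::real_inner"
  assumes "x \<noteq> a"
  shows "((\<lambda>x. 1 / ((x - a) \<bullet> (x - a))) has_derivative
    (\<lambda>h. - 2 * (1 / ((x - a) \<bullet> (x - a)))\<^sup>2 * ((x - a) \<bullet> h))) (at x)"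
  using assms
  by (auto intro!: derivative_eq_intros simp: inner_commute power2_eq_square fun_eq_iff field_simps)

lemma inversion_has_derivative:
  fixes a :: "'a::real_inner"
  assumes "x \<noteq> a"
  shows "(inversion a t has_derivative
    (\<lambda>h. (1 / ((x - a) \<bullet> (x - a))) *\<^sub>R refl_along (x - a) h)) (at x)"
  unfolding inversion_def
  by (rule derivative_eq_intros recip_square_has_derivative[OF assms] refl)+
     (auto simp: refl_along_def fun_eq_iff algebra_simps power2_eq_square)

lemma trace_rank_one: "(\<Sum>b\<in>Basis. (v \<bullet> b) * (w \<bullet> b)) = v \<bullet> w"
  by (simp add: euclidean_inner[of v w])

lemma trace_linear_rank_one:
  assumes "linear L"
  shows "(\<Sum>b\<in>Basis. (v \<bullet> b) * (w \<bullet> L b)) = w \<bullet> L v"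
proof -
  have "w \<bullet> L v = w \<bullet> L (\<Sum>b\<in>Basis. (v \<bullet> b) *\<^sub>R b)" by (simp add: euclidean_representation)
  also have "\<dots> = (\<Sum>b\<in>Basis. (v \<bullet> b) * (w \<bullet> L b))"
    by (simp add: linear_sum[OF assms] linear_cmul[OF assms] inner_sum_right)
  finally show ?thesis ..
qed

text \<open>The conformal invariance of the \<open>N\<close>-Laplacian: the exponent \<open>m = N - 1\<close> is exactly the
  one for which the derivatives of the conformal factor cancel in the divergence.\<close>

lemma divergence_inversion:
  fixes a :: "'a::euclidean_space" and F :: "'a \<Rightarrow> 'a"
  assumes xa: "x \<noteq> a" and F: "(F has_derivative F') (at (inversion a t x))"
    and m: "DIM('a) = Suc m"
    and j: "j = 1 / ((x - a) \<bullet> (x - a))" and v: "v = x - a"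
    and H': "H' = (\<lambda>h. (- 2 * real m * j ^ Suc m * (v \<bullet> h)) *\<^sub>R F (inversion a t x)
      + j ^ Suc m *\<^sub>R F' (refl_along v h)
      + (4 * real (Suc m) * j ^ Suc (Suc m) * (v \<bullet> h) * (v \<bullet> F (inversion a t x))) *\<^sub>R v
      - (2 * j ^ Suc m * (h \<bullet> F (inversion a t x) + j * (v \<bullet> F' (refl_along v h)))) *\<^sub>R v
      - (2 * j ^ Suc m * (v \<bullet> F (inversion a t x))) *\<^sub>R h)"
  shows "((\<lambda>x. (1 / ((x - a) \<bullet> (x - a))) ^ m *\<^sub>R refl_along (x - a) (F (inversion a t x)))
      has_derivative H') (at x)"
    and "(\<Sum>b\<in>Basis. H' b \<bullet> b) = j ^ Suc m * (\<Sum>b\<in>Basis. F' b \<bullet> b)"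
proof -
  have lin: "linear F'" using F by (rule has_derivative_linear)
  have v0: "v \<bullet> v \<noteq> 0" using xa by (simp add: v)
  have jv: "j * (v \<bullet> v) = 1" using v0 by (simp add: j v)
  have dj: "((\<lambda>x. 1 / ((x - a) \<bullet> (x - a))) has_derivative (\<lambda>h. - 2 * j\<^sup>2 * (v \<bullet> h))) (at x)"
    using recip_square_has_derivative[OF xa] by (simp add: j v)
  have dG: "((\<lambda>x. F (inversion a t x)) has_derivative (\<lambda>h. j *\<^sub>R F' (refl_along v h))) (at x)"
    using has_derivative_compose[OF inversion_has_derivative[OF xa] F]
    by (simp add: linear_cmul[OF lin] j v)
  have dv: "((\<lambda>x. x - a) has_derivative (\<lambda>h. h)) (at x)"
    by (auto intro!: derivative_eq_intros)
  have pw: "real m * (- 2 * j\<^sup>2 * k) * j ^ (m - 1) = - 2 * real m * j ^ Suc m * k" for k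
    by (cases m) (simp_all add: power2_eq_square algebra_simps)
  have "((\<lambda>x. (1 / ((x - a) \<bullet> (x - a))) ^ m *\<^sub>R F (inversion a t x)
      - (2 * (1 / ((x - a) \<bullet> (x - a))) ^ Suc m * ((x - a) \<bullet> F (inversion a t x))) *\<^sub>R (x - a))
      has_derivative H') (at x)"
  proof (rule has_derivative_eq_rhs)
    show "((\<lambda>x. (1 / ((x - a) \<bullet> (x - a))) ^ m *\<^sub>R F (inversion a t x)
      - (2 * (1 / ((x - a) \<bullet> (x - a))) ^ Suc m * ((x - a) \<bullet> F (inversion a t x))) *\<^sub>R (x - a))
      has_derivative (\<lambda>h. (j ^ m *\<^sub>R (j *\<^sub>R F' (refl_along v h))
         + (real m * (- 2 * j\<^sup>2 * (v \<bullet> h)) * j ^ (m - 1)) *\<^sub>R F (inversion a t x))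
         - ((2 * j ^ Suc m * (v \<bullet> F (inversion a t x))) *\<^sub>R h
         + ((2 * j ^ Suc m) * (v \<bullet> (j *\<^sub>R F' (refl_along v h)) + h \<bullet> F (inversion a t x))
            + (2 * (real (Suc m) * (- 2 * j\<^sup>2 * (v \<bullet> h)) * j ^ (Suc m - 1))) * (v \<bullet> F (inversion a t x))) *\<^sub>R v))) (at x)"
      unfolding j v
      by (intro has_derivative_diff has_derivative_scaleR has_derivative_mult has_derivative_inner
          has_derivative_power has_derivative_mult_right dG[unfolded j v] dv dj[unfolded j v])
    show "(\<lambda>h. (j ^ m *\<^sub>R (j *\<^sub>R F' (refl_along v h))
         + (real m * (- 2 * j\<^sup>2 * (v \<bullet> h)) * j ^ (m - 1)) *\<^sub>R F (inversion a t x))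
         - ((2 * j ^ Suc m * (v \<bullet> F (inversion a t x))) *\<^sub>R h
         + ((2 * j ^ Suc m) * (v \<bullet> (j *\<^sub>R F' (refl_along v h)) + h \<bullet> F (inversion a t x))
            + (2 * (real (Suc m) * (- 2 * j\<^sup>2 * (v \<bullet> h)) * j ^ (Suc m - 1))) * (v \<bullet> F (inversion a t x))) *\<^sub>R v)) = H'"
      unfolding H' pw
      by (simp add: fun_eq_iff algebra_simps power2_eq_square)
  qed
  moreover have "(\<lambda>x. (1 / ((x - a) \<bullet> (x - a))) ^ m *\<^sub>R refl_along (x - a) (F (inversion a t x)))
     = (\<lambda>x. (1 / ((x - a) \<bullet> (x - a))) ^ m *\<^sub>R F (inversion a t x)
      - (2 * (1 / ((x - a) \<bullet> (x - a))) ^ Suc m * ((x - a) \<bullet> F (inversion a t x))) *\<^sub>R (x - a))"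
    by (simp add: fun_eq_iff refl_along_def scaleR_diff_right mult_ac)
  ultimately show "((\<lambda>x. (1 / ((x - a) \<bullet> (x - a))) ^ m *\<^sub>R refl_along (x - a) (F (inversion a t x)))
      has_derivative H') (at x)"
    by simp
  define G where "G = F (inversion a t x)"
  have reflb: "F' (refl_along v h) = F' h - (2 * j * (v \<bullet> h)) *\<^sub>R F' v" for h
    by (simp add: refl_along_def linear_diff[OF lin] linear_cmul[OF lin] j v)
  have "H' b \<bullet> b = (- 2 * real m * j ^ Suc m) * ((v \<bullet> b) * (G \<bullet> b))
     + j ^ Suc m * (F' b \<bullet> b - 2 * j * ((v \<bullet> b) * (F' v \<bullet> b)))
     + (4 * real (Suc m) * j ^ Suc (Suc m) * (v \<bullet> G)) * ((v \<bullet> b) * (v \<bullet> b))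
     - 2 * j ^ Suc m * ((G \<bullet> b) * (v \<bullet> b) + j * ((v \<bullet> b) * (v \<bullet> F' b) - 2 * j * (v \<bullet> F' v) * ((v \<bullet> b) * (v \<bullet> b))))
     - 2 * j ^ Suc m * (v \<bullet> G) * (b \<bullet> b)" for b
    unfolding H' reflb G_def[symmetric]
    by (simp add: inner_add_left inner_diff_left inner_diff_right inner_commute algebra_simps)
  then have "(\<Sum>b\<in>Basis. H' b \<bullet> b) = (- 2 * real m * j ^ Suc m) * (v \<bullet> G)
     + j ^ Suc m * ((\<Sum>b\<in>Basis. F' b \<bullet> b) - 2 * j * (v \<bullet> F' v))
     + (4 * real (Suc m) * j ^ Suc (Suc m) * (v \<bullet> G)) * (v \<bullet> v)
     - 2 * j ^ Suc m * ((G \<bullet> v) + j * ((v \<bullet> F' v) - 2 * j * (v \<bullet> F' v) * (v \<bullet> v)))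
     - 2 * j ^ Suc m * (v \<bullet> G) * real (Suc m)"
    by (simp only: sum.distrib sum_subtractf sum_distrib_left[symmetric] trace_rank_one
        trace_linear_rank_one[OF lin]) (simp add: m[symmetric])
  \<comment> \<open>The multiples -2m, -2 and -2(m+1) of \<open>v \<bullet> G\<close> add up to
    -4(m+1), which is where the dimension m+1 enters; together with the terms in \<open>F' v\<close>
    they leave the factor \<open>j * (v \<bullet> v) - 1\<close>, which is zero.\<close>
  also have "\<dots> = j ^ Suc m * (\<Sum>b\<in>Basis. F' b \<bullet> b)
     + (j * (v \<bullet> v) - 1) * (4 * real (Suc m) * j ^ Suc m * (v \<bullet> G) + 4 * j ^ Suc m * j * (v \<bullet> F' v))"
    by (simp add: algebra_simps inner_commute)
  finally show "(\<Sum>b\<in>Basis. H' b \<bullet> b) = j ^ Suc m * (\<Sum>b\<in>Basis. F' b \<bullet> b)"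
    by (simp add: jv)
qed

text \<open>Composition with the inversion turns the gradient \<open>P\<close> into j times a
  reflection of \<open>P\<close>, hence the field |P|^(N-2) P into j^(N-1) times its reflection, and
  by \<open>divergence_inversion\<close> the divergence is multiplied by j^N. Here j = |x - a|^(-2)
  = |z - t|^2, so moving j^N to the other side produces the weight in \<open>ineq\<close>.\<close>

lemma comparison_inversion:
  fixes \<Omega> :: "(real^'n) set" and P :: "real^'n \<Rightarrow> real^'n"
  assumes N: "CARD('n) \<ge> 2" and "open \<Omega>" and a: "a \<notin> \<Omega>" and sol: "weak_solution \<Omega> g u Du"
    and u_diff: "\<And>x. x \<in> \<Omega> \<Longrightarrow> (u has_derivative (\<lambda>h. Du x \<bullet> h)) (at x)"
    and Du: "continuous_on \<Omega> Du" and g: "continuous_on UNIV g"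
    and S: "open S" "S \<subseteq> inversion a t ` \<Omega>"
    and A: "compact A" "A \<subseteq> inversion a t ` \<Omega>"
    and sub: "\<And>z. z \<in> S \<Longrightarrow> \<Psi> z < u (inversion t a z) \<Longrightarrow> z \<in> A"
    and bd: "\<And>z. z \<in> A \<Longrightarrow> z \<notin> S \<Longrightarrow> u (inversion t a z) \<le> \<Psi> z"
    and \<Psi>c: "continuous_on A \<Psi>"
    and \<Psi>d: "\<And>z. z \<in> S \<Longrightarrow> (\<Psi> has_derivative (\<lambda>h. P z \<bullet> h)) (at z)"
    and Pc: "continuous_on S P"
    and Fd: "\<And>z. z \<in> S \<Longrightarrow>
      ((\<lambda>z. norm (P z) ^ (CARD('n) - 2) *\<^sub>R P z) has_derivative F' z) (at z)"
    and F'c: "\<And>b. b \<in> Basis \<Longrightarrow> continuous_on S (\<lambda>z. F' z b)"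
    and ineq: "\<And>z. z \<in> S \<Longrightarrow> \<Psi> z < u (inversion t a z) \<Longrightarrow>
      (\<Sum>b\<in>Basis. F' z b \<bullet> b) < (1 / ((z - t) \<bullet> (z - t))) ^ CARD('n) * g (u (inversion t a z))"
    and z0: "z0 \<in> S"
  shows "u (inversion t a z0) \<le> \<Psi> z0"
proof -
  define I where "I = inversion a t"
  define J where "J = inversion t a"
  have JI: "J (I x) = x" if "x \<noteq> a" for x using that by (simp add: I_def J_def inversion_inverse)
  have IJ: "I (J z) = z" if "z \<noteq> t" for z using that by (simp add: I_def J_def inversion_inverse)
  have imI: "z \<noteq> t" "J z \<noteq> a" "J z \<in> \<Omega>" if z: "z \<in> I ` \<Omega>" for z
  proof -
    obtain x where x: "x \<in> \<Omega>" "z = I x" using z by auto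
    then have "x \<noteq> a" using a by auto
    then show "z \<noteq> t" "J z \<noteq> a" "J z \<in> \<Omega>"
      using x JI inversion_neq[of x a t] by (auto simp: I_def)
  qed
  have tA: "t \<notin> A" using imI(1)[of t] A(2) by (auto simp: I_def)
  define S' where "S' = {x. x \<noteq> a \<and> I x \<in> S}"
  have Ic: "continuous_on (- {a}) I" unfolding I_def by (rule continuous_on_inversion) simp
  have S'o: "open S'"
  proof -
    have "open (- {a} \<inter> I -` S)" by (rule continuous_open_preimage[OF Ic _ S(1)]) auto
    moreover have "- {a} \<inter> I -` S = S'" by (auto simp: S'_def)
    ultimately show ?thesis by simp
  qed
  have S'\<Omega>: "S' \<subseteq> \<Omega>"
  proof
    fix x assume "x \<in> S'"
    then have "x \<noteq> a" "I x \<in> I ` \<Omega>" using S(2) by (auto simp: S'_def I_def)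
    then show "x \<in> \<Omega>" using imI(3)[of "I x"] JI by simp
  qed
  have IcS': "continuous_on S' I" using Ic by (rule continuous_on_subset) (auto simp: S'_def)
  have A'c: "compact (J ` A)"
    unfolding J_def by (intro compact_continuous_image continuous_on_inversion tA A(1))
  have A'\<Omega>: "J ` A \<subseteq> \<Omega>" using A(2) imI(3) by (auto simp: I_def)
  obtain m where m: "CARD('n) = Suc m" "m \<ge> 1" using N by (cases "CARD('n)") auto
  define j where "j x = 1 / ((x - a) \<bullet> (x - a))" for x
  define F where "F z = norm (P z) ^ (CARD('n) - 2) *\<^sub>R P z" for z
  define P' where "P' x = j x *\<^sub>R refl_along (x - a) (P (I x))" for x
  have field: "norm (P' x) ^ (CARD('n) - 2) *\<^sub>R P' x = (1 / ((x - a) \<bullet> (x - a))) ^ m *\<^sub>R refl_along (x - a) (F (I x))" for x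
  proof -
    have "\<bar>j x\<bar> = j x" by (simp add: j_def)
    moreover from this have "norm (P' x) = j x * norm (P (I x))" by (simp add: P'_def)
    moreover have "CARD('n) - 2 = m - 1" "j x ^ m = j x ^ (m - 1) * j x"
      using m by (simp_all add: power_eq_if)
    ultimately show ?thesis
      by (simp add: P'_def F_def power_mult_distrib refl_along_scaleR j_def[symmetric] mult_ac)
  qed
  define H' where "H' x h = (- 2 * real m * j x ^ Suc m * ((x - a) \<bullet> h)) *\<^sub>R F (I x)
      + j x ^ Suc m *\<^sub>R F' (I x) (refl_along (x - a) h)
      + (4 * real (Suc m) * j x ^ Suc (Suc m) * ((x - a) \<bullet> h) * ((x - a) \<bullet> F (I x))) *\<^sub>R (x - a)
      - (2 * j x ^ Suc m * (h \<bullet> F (I x) + j x * ((x - a) \<bullet> F' (I x) (refl_along (x - a) h)))) *\<^sub>R (x - a)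
      - (2 * j x ^ Suc m * ((x - a) \<bullet> F (I x))) *\<^sub>R h" for x h
  have Fd': "(F has_derivative F' z) (at z)" if "z \<in> S" for z
    using Fd[OF that] by (simp add: F_def[abs_def])
  have H'd: "((\<lambda>x. norm (P' x) ^ (CARD('n) - 2) *\<^sub>R P' x) has_derivative H' x) (at x)"
    and H't: "(\<Sum>b\<in>Basis. H' x b \<bullet> b) = j x ^ Suc m * (\<Sum>b\<in>Basis. F' (I x) b \<bullet> b)"
    if "x \<in> S'" for x
  proof -
    have x: "x \<noteq> a" "inversion a t x \<in> S" using that by (auto simp: S'_def I_def)
    have d: "DIM(real^'n) = Suc m" using m by simp
    have H'eq: "H' x = (\<lambda>h. (- 2 * real m * j x ^ Suc m * ((x - a) \<bullet> h)) *\<^sub>R F (inversion a t x)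
      + j x ^ Suc m *\<^sub>R F' (inversion a t x) (refl_along (x - a) h)
      + (4 * real (Suc m) * j x ^ Suc (Suc m) * ((x - a) \<bullet> h) * ((x - a) \<bullet> F (inversion a t x))) *\<^sub>R (x - a)
      - (2 * j x ^ Suc m * (h \<bullet> F (inversion a t x) + j x * ((x - a) \<bullet> F' (inversion a t x) (refl_along (x - a) h)))) *\<^sub>R (x - a)
      - (2 * j x ^ Suc m * ((x - a) \<bullet> F (inversion a t x))) *\<^sub>R h)"
      by (simp add: H'_def[abs_def] I_def)
    show "((\<lambda>x. norm (P' x) ^ (CARD('n) - 2) *\<^sub>R P' x) has_derivative H' x) (at x)"
      unfolding field I_def
      by (rule divergence_inversion(1)[OF x(1) Fd'[OF x(2)] d j_def refl H'eq])
    show "(\<Sum>b\<in>Basis. H' x b \<bullet> b) = j x ^ Suc m * (\<Sum>b\<in>Basis. F' (I x) b \<bullet> b)"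
      unfolding I_def
      by (rule divergence_inversion(2)[OF x(1) Fd'[OF x(2)] d j_def refl H'eq])
  qed
  have jc: "continuous_on S' j" unfolding j_def
    by (intro continuous_intros) (auto simp: S'_def)
  have rc: "continuous_on S' (\<lambda>x. refl_along (x - a) (k x))"
    if "continuous_on S' k" for k :: "real^'n \<Rightarrow> real^'n"
    unfolding refl_along_def using that by (intro continuous_intros) (auto simp: S'_def)
  have comp: "continuous_on S' (\<lambda>x. k (I x))" if "continuous_on S k" for k :: "real^'n \<Rightarrow> real^'n"
    by (rule continuous_on_compose2[OF that IcS']) (auto simp: S'_def)
  have P'c: "continuous_on S' P'" unfolding P'_def
    by (intro continuous_intros jc rc comp Pc)
  have FcS: "continuous_on S F" unfolding F_def by (intro continuous_intros Pc)
  have FI: "continuous_on S' (\<lambda>x. F (I x))" by (rule comp[OF FcS])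
  \<comment> \<open>Continuity of \<open>F'\<close> is given in fixed basis directions only, whereas
    this direction moves with \<open>x\<close>; it is expanded in the basis.\<close>
  have F'I: "continuous_on S' (\<lambda>x. F' (I x) (refl_along (x - a) b))" for b
  proof (rule continuous_on_eq)
    show "continuous_on S' (\<lambda>x. \<Sum>i\<in>Basis. (refl_along (x - a) b \<bullet> i) *\<^sub>R F' (I x) i)"
      by (intro continuous_intros rc comp F'c)
    show "(\<Sum>i\<in>Basis. (refl_along (x - a) b \<bullet> i) *\<^sub>R F' (I x) i) = F' (I x) (refl_along (x - a) b)"
      if "x \<in> S'" for x
    proof -
      have lin: "linear (F' (I x))" using Fd'[of "I x"] that by (auto simp: S'_def has_derivative_linear)
      have "F' (I x) (refl_along (x - a) b) = F' (I x) (\<Sum>i\<in>Basis. (refl_along (x - a) b \<bullet> i) *\<^sub>R i)"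
        by (simp add: euclidean_representation)
      also have "\<dots> = (\<Sum>i\<in>Basis. (refl_along (x - a) b \<bullet> i) *\<^sub>R F' (I x) i)"
        by (simp add: linear_sum[OF lin] linear_cmul[OF lin])
      finally show ?thesis ..
    qed
  qed
  have H'c: "continuous_on S' (\<lambda>x. H' x b)" for b
    unfolding H'_def by (intro continuous_intros jc FI F'I)
  have x0: "J z0 \<in> S'" using z0 S(2) imI(1,2)[of z0] IJ[of z0] by (auto simp: S'_def I_def)
  have "u (J z0) \<le> \<Psi> (I (J z0))"
  proof (rule comparison_weak_solution[OF \<open>open \<Omega>\<close> sol u_diff Du g S'o S'\<Omega> A'c A'\<Omega>, where P=P' and F'=H'])
    fix x
    { assume x: "x \<in> S'" "\<Psi> (I x) < u x"
      have xa: "x \<noteq> a" "I x \<in> S" using x by (auto simp: S'_def)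
      then have "I x \<in> A" using sub[of "I x"] x JI[of x] by (simp add: J_def)
      then show "x \<in> J ` A" using JI[OF xa(1)] by force
      have j0: "j x > 0" using xa by (simp add: j_def)
      have jj: "1 / ((I x - t) \<bullet> (I x - t)) = (x - a) \<bullet> (x - a)"
        by (simp add: I_def inversion_inner)
      have "(\<Sum>b\<in>Basis. F' (I x) b \<bullet> b) < ((x - a) \<bullet> (x - a)) ^ Suc m * g (u x)"
        using ineq[OF xa(2)] x JI[OF xa(1)] unfolding jj m J_def by simp
      then have "j x ^ Suc m * (\<Sum>b\<in>Basis. F' (I x) b \<bullet> b) < j x ^ Suc m * (((x - a) \<bullet> (x - a)) ^ Suc m * g (u x))"
        using j0 by (intro mult_strict_left_mono) auto
      also have "\<dots> = (j x * ((x - a) \<bullet> (x - a))) ^ Suc m * g (u x)"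
        by (simp only: power_mult_distrib mult.assoc)
      also have "j x * ((x - a) \<bullet> (x - a)) = 1" using xa by (simp add: j_def)
      finally show "(\<Sum>b\<in>Basis. H' x b \<bullet> b) < g (u x)" using H't[OF x(1)] by simp
    }
    { assume x: "x \<in> J ` A" "x \<notin> S'"
      then obtain z where z: "z \<in> A" "x = J z" by auto
      then have "z \<in> I ` \<Omega>" using A(2) by (auto simp: I_def)
      then have "I x = z" "x \<noteq> a" using z imI IJ by auto
      then show "u x \<le> \<Psi> (I x)" using x z bd[of z] by (auto simp: S'_def J_def) }
    { assume x: "x \<in> S'"
      then have xa: "x \<noteq> a" "I x \<in> S" by (auto simp: S'_def)
      have "((\<lambda>x. \<Psi> (I x)) has_derivative (\<lambda>h. P (I x) \<bullet> (j x *\<^sub>R refl_along (x - a) h))) (at x)"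
        using has_derivative_compose[OF inversion_has_derivative[OF xa(1)] \<Psi>d[OF xa(2)[unfolded I_def]]]
        by (simp add: I_def j_def)
      then show "((\<lambda>x. \<Psi> (I x)) has_derivative (\<lambda>h. P' x \<bullet> h)) (at x)"
        by (simp add: P'_def refl_along_self_adjoint) }
  next
    show "continuous_on (J ` A) (\<lambda>x. \<Psi> (I x))"
    proof (rule continuous_on_compose2[OF \<Psi>c])
      show "continuous_on (J ` A) I" unfolding I_def
        using A'\<Omega> a by (intro continuous_on_inversion) auto
      show "I ` J ` A \<subseteq> A" using IJ tA by (force simp: image_iff)
    qed
  qed (use P'c H'd H'c x0 in auto)
  moreover have "I (J z0) = z0" using z0 S(2) imI(1) IJ by (auto simp: I_def)
  ultimately show ?thesis by (simp add: J_def)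
qed

text \<open>Dividing by the squared norm instead of writing a truncated exponent
  \<open>n - 2\<close> lets one formula cover \<open>n = 0\<close>, that is N = 2, as well.\<close>

lemma norm_power_scaleR_has_derivative:
  fixes P :: "'a::euclidean_space \<Rightarrow> 'a"
  assumes "(P has_derivative P') (at z)" "P z \<noteq> 0"
  shows "((\<lambda>z. norm (P z) ^ n *\<^sub>R P z) has_derivative
    (\<lambda>h. norm (P z) ^ n *\<^sub>R P' h + (real n * norm (P z) ^ n * (P z \<bullet> P' h) / (norm (P z))\<^sup>2) *\<^sub>R P z)) (at z)"
proof -
  have "(norm has_derivative (\<lambda>h. h \<bullet> sgn (P z))) (at (P z))"
    using has_derivative_norm[OF assms(2)] .
  from has_derivative_compose[OF assms(1) this]
  have nd: "((\<lambda>z. norm (P z)) has_derivative (\<lambda>h. P' h \<bullet> sgn (P z))) (at z)" .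
  have "((\<lambda>z. norm (P z) ^ n *\<^sub>R P z) has_derivative
     (\<lambda>h. norm (P z) ^ n *\<^sub>R P' h + (real n * (P' h \<bullet> sgn (P z)) * norm (P z) ^ (n - 1)) *\<^sub>R P z)) (at z)"
    by (intro has_derivative_scaleR has_derivative_power nd assms(1))
  moreover have "real n * (P' h \<bullet> sgn (P z)) * norm (P z) ^ (n - 1)
     = real n * norm (P z) ^ n * (P z \<bullet> P' h) / (norm (P z))\<^sup>2" for h
    using assms(2) by (cases n) (auto simp: sgn_div_norm inner_commute power2_eq_square field_simps)
  ultimately show ?thesis by simp
qed

subsection \<open>Barriers in the inverted picture\<close>

locale inverted_solution =
  fixes \<Omega> :: "(real^'n) set" and a t :: "real^'n" and g :: "real \<Rightarrow> real"
    and u :: "real^'n \<Rightarrow> real" and Du :: "real^'n \<Rightarrow> real^'n"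
  assumes N: "CARD('n) \<ge> 2" and open_\<Omega>: "open \<Omega>" and a_notin: "a \<notin> \<Omega>"
    and sol: "weak_solution \<Omega> g u Du"
    and u_diff: "\<And>x. x \<in> \<Omega> \<Longrightarrow> (u has_derivative (\<lambda>h. Du x \<bullet> h)) (at x)"
    and Du_cont: "continuous_on \<Omega> Du" and g_cont: "continuous_on UNIV g"
begin

definition U where "U = inversion a t ` \<Omega>"
definition v where "v z = u (inversion t a z)"
text \<open>The Jacobian |z - t|^(-2N) of the inverse inversion.\<close>

definition W where "W z = (1 / ((z - t) \<bullet> (z - t))) ^ CARD('n)"

lemma t_notin_U: "t \<notin> U"
proof
  assume "t \<in> U"
  then obtain x where "x \<in> \<Omega>" "inversion a t x = t" by (auto simp: U_def)
  then show False using a_notin inversion_neq[of x a t] by metis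
qed

lemma inversion_U:
  assumes "z \<in> U" shows "inversion t a z \<in> \<Omega>"
proof -
  obtain x where "x \<in> \<Omega>" "z = inversion a t x" using assms by (auto simp: U_def)
  then show ?thesis using a_notin inversion_inverse[of x a t] by metis
qed

lemma open_U: "open U"
proof -
  have "U = - {t} \<inter> inversion t a -` \<Omega>"
  proof (intro equalityI subsetI)
    fix z assume "z \<in> - {t} \<inter> inversion t a -` \<Omega>"
    then show "z \<in> U" unfolding U_def
      by (intro image_eqI[where x="inversion t a z"]) (auto simp: inversion_inverse)
  qed (use inversion_U t_notin_U in auto)
  moreover have "open (- {t} \<inter> inversion t a -` \<Omega>)"
    by (rule continuous_open_preimage[OF continuous_on_inversion]) (auto simp: open_\<Omega>)
  ultimately show ?thesis by simp
qed

lemma v_cont: "continuous_on U v"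
proof -
  have "continuous_on \<Omega> u"
    by (intro continuous_at_imp_continuous_on ballI has_derivative_continuous[OF u_diff])
  then show ?thesis unfolding v_def
    by (rule continuous_on_compose2[OF _ continuous_on_inversion]) (use t_notin_U inversion_U in auto)
qed

lemma W_pos: "z \<in> U \<Longrightarrow> W z > 0"
  using t_notin_U by (auto simp: W_def intro!: zero_less_power)

text \<open>All barriers are a linear function plus a function of the squared distance s to a
  centre, which keeps square roots out of the derivatives. With w = z - c the Hessian H is 2\<xi>
  times the identity plus 4\<xi>' times the projection-like map h to (w \<bullet> h) w. The left
  side of \<open>ineq\<close> is the N-Laplacian |P|^(N-2) (tr H + (N-2) (P \<bullet> HP) / |P|^2);
  the contributions 2N\<xi> and 2(N-2)\<xi> merge into 4(N-1)\<xi>.\<close>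

lemma comparison_barrier:
  assumes S: "open S" "S \<subseteq> U" and A: "compact A" "A \<subseteq> U"
    and \<Psi>: "\<And>z. \<Psi> z = C + K * (e \<bullet> z) + X ((z - c) \<bullet> (z - c))"
    and P: "\<And>z. P z = K *\<^sub>R e + (2 * \<xi> ((z - c) \<bullet> (z - c))) *\<^sub>R (z - c)"
    and sub: "\<And>z. z \<in> S \<Longrightarrow> \<Psi> z < v z \<Longrightarrow> z \<in> A"
    and bd: "\<And>z. z \<in> A \<Longrightarrow> z \<notin> S \<Longrightarrow> v z \<le> \<Psi> z"
    and \<Psi>c: "continuous_on A \<Psi>"
    and X: "\<And>s. s \<in> I \<Longrightarrow> (X has_real_derivative \<xi> s) (at s)"
    and \<xi>: "\<And>s. s \<in> I \<Longrightarrow> (\<xi> has_real_derivative \<xi>' s) (at s)"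
    and \<xi>'c: "continuous_on I \<xi>'"
    and SI: "\<And>z. z \<in> S \<Longrightarrow> (z - c) \<bullet> (z - c) \<in> I"
    and P0: "\<And>z. z \<in> S \<Longrightarrow> P z \<noteq> 0"
    and ineq: "\<And>z s. z \<in> S \<Longrightarrow> \<Psi> z < v z \<Longrightarrow> s = (z - c) \<bullet> (z - c) \<Longrightarrow>
       norm (P z) ^ (CARD('n) - 2) * (4 * real (CARD('n) - 1) * \<xi> s + 4 * s * \<xi>' s
         + 4 * real (CARD('n) - 2) * \<xi>' s * ((z - c) \<bullet> P z)\<^sup>2 / (norm (P z))\<^sup>2) < W z * g (v z)"
    and z0: "z0 \<in> S"
  shows "v z0 \<le> \<Psi> z0"
proof -
  define q where "q z = (z - c) \<bullet> (z - c)" for z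
  define n where "n = CARD('n) - 2"
  define P' where "P' z h = (2 * \<xi> (q z)) *\<^sub>R h + (4 * \<xi>' (q z) * ((z - c) \<bullet> h)) *\<^sub>R (z - c)" for z h
  define F' where "F' z h = norm (P z) ^ n *\<^sub>R P' z h
     + (real n * norm (P z) ^ n * (P z \<bullet> P' z h) / (norm (P z))\<^sup>2) *\<^sub>R P z" for z h
  have dq: "(q has_derivative (\<lambda>h. 2 * ((z - c) \<bullet> h))) (at z)" for z
    unfolding q_def by (auto intro!: derivative_eq_intros simp: inner_commute)
  have \<Psi>d: "(\<Psi> has_derivative (\<lambda>h. P z \<bullet> h)) (at z)" if "z \<in> S" for z
  proof -
    have "((\<lambda>z. X (q z)) has_derivative (\<lambda>h. \<xi> (q z) * (2 * ((z - c) \<bullet> h)))) (at z)"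
      using has_derivative_compose[OF dq X[OF SI[OF that], folded q_def, unfolded has_field_derivative_def]]
      by simp
    then have "((\<lambda>z. C + K * (e \<bullet> z) + X (q z)) has_derivative (\<lambda>h. P z \<bullet> h)) (at z)"
      by (auto intro!: derivative_eq_intros simp: P q_def inner_add_left algebra_simps)
    moreover have "\<Psi> = (\<lambda>z. C + K * (e \<bullet> z) + X (q z))" using \<Psi> by (simp add: fun_eq_iff q_def)
    ultimately show ?thesis by simp
  qed
  have Pd: "(P has_derivative P' z) (at z)" if "z \<in> S" for z
  proof -
    have "((\<lambda>z. \<xi> (q z)) has_derivative (\<lambda>h. \<xi>' (q z) * (2 * ((z - c) \<bullet> h)))) (at z)"
      using has_derivative_compose[OF dq \<xi>[OF SI[OF that], folded q_def, unfolded has_field_derivative_def]]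
      by simp
    then have "((\<lambda>z. K *\<^sub>R e + (2 * \<xi> (q z)) *\<^sub>R (z - c)) has_derivative P' z) (at z)"
      unfolding P'_def by (auto intro!: derivative_eq_intros simp: fun_eq_iff algebra_simps)
    moreover have "P = (\<lambda>z. K *\<^sub>R e + (2 * \<xi> (q z)) *\<^sub>R (z - c))" using P by (simp add: fun_eq_iff q_def)
    ultimately show ?thesis by simp
  qed
  have qc: "continuous_on S q" unfolding q_def by (intro continuous_intros)
  have \<xi>c: "continuous_on I \<xi>"
    by (intro continuous_at_imp_continuous_on ballI DERIV_isCont[OF \<xi>])
  have \<xi>q: "continuous_on S (\<lambda>z. \<xi> (q z))"
    by (rule continuous_on_compose2[OF \<xi>c qc]) (use SI in \<open>auto simp: q_def\<close>)
  have \<xi>'q: "continuous_on S (\<lambda>z. \<xi>' (q z))"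
    by (rule continuous_on_compose2[OF \<xi>'c qc]) (use SI in \<open>auto simp: q_def\<close>)
  have Pc: "continuous_on S P"
    by (intro continuous_at_imp_continuous_on ballI has_derivative_continuous[OF Pd])
  have F'c: "continuous_on S (\<lambda>z. F' z b)" for b
    unfolding F'_def P'_def using P0
    by (intro continuous_intros Pc \<xi>q \<xi>'q) auto
  have tr: "(\<Sum>b\<in>Basis. F' z b \<bullet> b) = norm (P z) ^ n * (4 * real (CARD('n) - 1) * \<xi> (q z) + 4 * q z * \<xi>' (q z)
         + 4 * real n * \<xi>' (q z) * ((z - c) \<bullet> P z)\<^sup>2 / (norm (P z))\<^sup>2)" if "z \<in> S" for z
  proof -
    have P2: "(norm (P z))\<^sup>2 = P z \<bullet> P z" "P z \<bullet> P z \<noteq> 0" using P0[OF that] by (simp_all add: power2_norm_eq_inner)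
    define y where "y = norm (P z) ^ n"
    define i where "i = 1 / (P z \<bullet> P z)"
    have i: "i * (P z \<bullet> P z) = 1" using P2 by (simp add: i_def)
    define w where "w = z - c"
    have "F' z b \<bullet> b = y * (2 * \<xi> (q z)) * (b \<bullet> b) + y * (4 * \<xi>' (q z)) * ((w \<bullet> b) * (w \<bullet> b))
       + (real n * y * i * (2 * \<xi> (q z))) * ((P z \<bullet> b) * (P z \<bullet> b))
       + (real n * y * i * (4 * \<xi>' (q z)) * (P z \<bullet> w)) * ((w \<bullet> b) * (P z \<bullet> b))" for b
    proof -
      have "F' z b = y *\<^sub>R P' z b + (real n * y * i * (P z \<bullet> P' z b)) *\<^sub>R P z"
        by (simp add: F'_def P2 y_def i_def)
      then show ?thesis
        unfolding P'_def w_def[symmetric]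
        by (simp add: inner_add_left inner_add_right inner_commute algebra_simps)
    qed
    then have "(\<Sum>b\<in>Basis. F' z b \<bullet> b) = y * (2 * \<xi> (q z)) * real CARD('n) + y * (4 * \<xi>' (q z)) * (w \<bullet> w)
       + (real n * y * i * (2 * \<xi> (q z))) * (P z \<bullet> P z)
       + (real n * y * i * (4 * \<xi>' (q z)) * (P z \<bullet> w)) * (w \<bullet> P z)"
      by (simp only: sum.distrib sum_distrib_left[symmetric] trace_rank_one) simp
    also have "\<dots> = y * (2 * \<xi> (q z)) * real CARD('n) + y * (4 * \<xi>' (q z)) * (w \<bullet> w)
       + (real n * y * (2 * \<xi> (q z))) * (i * (P z \<bullet> P z))
       + (real n * y * i * (4 * \<xi>' (q z)) * (P z \<bullet> w)) * (w \<bullet> P z)" by simp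
    finally have "(\<Sum>b\<in>Basis. F' z b \<bullet> b) = y * (2 * \<xi> (q z)) * real CARD('n) + y * (4 * \<xi>' (q z)) * q z
       + (real n * y * (2 * \<xi> (q z)))
       + (real n * y * i * (4 * \<xi>' (q z)) * (P z \<bullet> w)) * (w \<bullet> P z)"
      unfolding i by (simp add: q_def w_def)
    moreover have "real CARD('n) = real n + 2" "real (CARD('n) - 1) = real n + 1" using N by (simp_all add: n_def)
    ultimately show ?thesis
      unfolding P2 y_def[symmetric] w_def[symmetric]
      by (simp add: i_def inner_commute power2_eq_square algebra_simps)
  qed
  show ?thesis unfolding v_def
  proof (rule comparison_inversion[OF N open_\<Omega> a_notin sol u_diff Du_cont g_cont S(1) S(2)[unfolded U_def]
      A(1) A(2)[unfolded U_def] sub[unfolded v_def] bd[unfolded v_def] \<Psi>c \<Psi>d Pc _ F'c _ z0])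
    show "((\<lambda>z. norm (P z) ^ (CARD('n) - 2) *\<^sub>R P z) has_derivative F' z) (at z)" if "z \<in> S" for z
      unfolding F'_def n_def by (rule norm_power_scaleR_has_derivative[OF Pd[OF that] P0[OF that]])
    show "(\<Sum>b\<in>Basis. F' z b \<bullet> b) < (1 / ((z - t) \<bullet> (z - t))) ^ CARD('n) * g (u (inversion t a z))"
      if "z \<in> S" "\<Psi> z < u (inversion t a z)" for z
      using ineq[OF that(1) _ refl] that tr[OF that(1)]
      by (simp add: v_def W_def q_def n_def)
  qed
qed

text \<open>Without the linear part the gradient is radial, the quotient of squares in
  \<open>comparison_barrier\<close> equals s, and everything collapses to a positive factor times
  \<xi> + s \<xi>'. This is negative for X s = -B/s, the profile used whenever the absorption cannot
  help quantitatively.\<close>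

lemma comparison_radial:
  assumes S: "open S" "S \<subseteq> U" and A: "compact A" "A \<subseteq> U"
    and \<Psi>: "\<And>z. \<Psi> z = C + X ((z - c) \<bullet> (z - c))"
    and sub: "\<And>z. z \<in> S \<Longrightarrow> \<Psi> z < v z \<Longrightarrow> z \<in> A"
    and bd: "\<And>z. z \<in> A \<Longrightarrow> z \<notin> S \<Longrightarrow> v z \<le> \<Psi> z"
    and \<Psi>c: "continuous_on A \<Psi>"
    and X: "\<And>s. s \<in> I \<Longrightarrow> (X has_real_derivative \<xi> s) (at s)"
    and \<xi>: "\<And>s. s \<in> I \<Longrightarrow> (\<xi> has_real_derivative \<xi>' s) (at s)"
    and \<xi>'c: "continuous_on I \<xi>'"
    and SI: "\<And>z. z \<in> S \<Longrightarrow> (z - c) \<bullet> (z - c) \<in> I"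
    and pos: "\<And>s. s \<in> I \<Longrightarrow> s > 0 \<and> \<xi> s > 0"
    and ineq: "\<And>z s. z \<in> S \<Longrightarrow> \<Psi> z < v z \<Longrightarrow> s = (z - c) \<bullet> (z - c) \<Longrightarrow>
       4 * real (CARD('n) - 1) * (2 * \<xi> s * norm (z - c)) ^ (CARD('n) - 2) * (\<xi> s + s * \<xi>' s) < W z * g (v z)"
    and z0: "z0 \<in> S"
  shows "v z0 \<le> \<Psi> z0"
proof (rule comparison_barrier[OF S A, where K=0 and e=0 and I=I and P="\<lambda>z. (2 * \<xi> ((z - c) \<bullet> (z - c))) *\<^sub>R (z - c)"])
  fix z s
  assume z: "z \<in> S"
  have p: "(z - c) \<bullet> (z - c) > 0" "\<xi> ((z - c) \<bullet> (z - c)) > 0" using pos[OF SI[OF z]] by auto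
  then show P0: "(2 * \<xi> ((z - c) \<bullet> (z - c))) *\<^sub>R (z - c) \<noteq> 0" by auto
  assume *: "\<Psi> z < v z" "s = (z - c) \<bullet> (z - c)"
  define P where "P = (2 * \<xi> ((z - c) \<bullet> (z - c))) *\<^sub>R (z - c)"
  have nP: "norm P = 2 * \<xi> s * norm (z - c)" using p by (simp add: P_def *(2))
  have s: "(norm (z - c))\<^sup>2 = s" by (simp add: * power2_norm_eq_inner)
  have "((z - c) \<bullet> P)\<^sup>2 / (norm P)\<^sup>2 = s"
  proof -
    have "(z - c) \<bullet> P = 2 * \<xi> s * s" by (simp add: P_def *)
    moreover have "(norm P)\<^sup>2 = (2 * \<xi> s)\<^sup>2 * s" unfolding nP by (simp only: power_mult_distrib s)
    moreover have "s > 0" "\<xi> s > 0" using p by (simp_all add: *)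
    ultimately show ?thesis by (simp add: power2_eq_square)
  qed
  then have t: "4 * real (CARD('n) - 2) * \<xi>' s * ((z - c) \<bullet> P)\<^sup>2 / (norm P)\<^sup>2 = 4 * real (CARD('n) - 2) * \<xi>' s * s"
    by (metis times_divide_eq_right)
  have r: "real (CARD('n) - 1) = real (CARD('n) - 2) + 1" using N by simp
  have "y * (4 * (k + 1) * x + 4 * s * x' + 4 * k * x' * s) = 4 * (k + 1) * y * (x + s * x')"
    for y k x x' s :: real
    by algebra
  then have "norm P ^ (CARD('n) - 2) * (4 * real (CARD('n) - 1) * \<xi> s + 4 * s * \<xi>' s
       + 4 * real (CARD('n) - 2) * \<xi>' s * ((z - c) \<bullet> P)\<^sup>2 / (norm P)\<^sup>2)
     = 4 * real (CARD('n) - 1) * (2 * \<xi> s * norm (z - c)) ^ (CARD('n) - 2) * (\<xi> s + s * \<xi>' s)"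
    unfolding nP[symmetric] t r .
  then show "norm ((2 * \<xi> ((z - c) \<bullet> (z - c))) *\<^sub>R (z - c)) ^ (CARD('n) - 2)
       * (4 * real (CARD('n) - 1) * \<xi> s + 4 * s * \<xi>' s
       + 4 * real (CARD('n) - 2) * \<xi>' s * ((z - c) \<bullet> (2 * \<xi> ((z - c) \<bullet> (z - c))) *\<^sub>R (z - c))\<^sup>2
         / (norm ((2 * \<xi> ((z - c) \<bullet> (z - c))) *\<^sub>R (z - c)))\<^sup>2) < W z * g (v z)"
    using ineq[OF z *] unfolding P_def by simp
next
  show "\<Psi> z = C + 0 * (0 \<bullet> z) + X ((z - c) \<bullet> (z - c))" for z using \<Psi> by simp
qed (simp_all add: \<Psi>c X \<xi> \<xi>'c SI z0 sub bd)

end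

subsection \<open>Boundedness\<close>

lemma one_minus_exp_bounds:
  fixes x y :: real
  assumes "x \<le> y"
  shows "exp (- x) - exp (- y) \<le> (y - x) * exp (- x)" "exp (- x) - exp (- y) \<ge> (y - x) * exp (- y)"
proof -
  have "exp (- y) = exp (- x) * exp (x - y)" by (simp flip: exp_add)
  also have "\<dots> \<ge> exp (- x) * (1 + (x - y))" by (intro mult_left_mono exp_ge_add_one_self) auto
  finally show "exp (- x) - exp (- y) \<le> (y - x) * exp (- x)" by (simp add: algebra_simps)
  have "exp (- x) = exp (- y) * exp (y - x)" by (simp flip: exp_add)
  also have "\<dots> \<ge> exp (- y) * (1 + (y - x))" by (intro mult_left_mono exp_ge_add_one_self) auto
  finally show "exp (- x) - exp (- y) \<ge> (y - x) * exp (- y)" by (simp add: algebra_simps)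
qed

lemma DERIV_recip_diff:
  fixes q s c :: real
  assumes "q \<noteq> s"
  shows "((\<lambda>s. c / (q - s)) has_real_derivative c / (q - s)\<^sup>2) (at s)"
    "((\<lambda>s. c / (q - s)\<^sup>2) has_real_derivative 2 * c / (q - s) ^ 3) (at s)"
proof -
  define d where "d = q - s"
  have d: "d \<noteq> 0" using assms by (simp add: d_def)
  have 1: "((\<lambda>s. q - s) has_real_derivative - 1) (at s)"
    by (auto intro!: derivative_eq_intros)
  have 2: "((\<lambda>s. (q - s)\<^sup>2) has_real_derivative - 2 * (q - s)) (at s)"
    by (auto intro!: derivative_eq_intros)
  show "((\<lambda>s. c / (q - s)) has_real_derivative c / (q - s)\<^sup>2) (at s)"
    by (rule DERIV_cong[OF DERIV_divide[OF DERIV_const 1]])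
       (use d in \<open>simp_all add: d_def[symmetric] power2_eq_square\<close>)
  show "((\<lambda>s. c / (q - s)\<^sup>2) has_real_derivative 2 * c / (q - s) ^ 3) (at s)"
    by (rule DERIV_cong[OF DERIV_divide[OF DERIV_const 2]])
       (use d in \<open>simp_all add: d_def[symmetric] power2_eq_square power3_eq_cube mult_ac\<close>)
qed

lemma mult_power_mult_mono:
  fixes r q Q p P :: real
  assumes "0 \<le> r" "0 \<le> q" "q \<le> Q" "0 \<le> p" "p \<le> P"
  shows "r * q ^ n * p \<le> r * Q ^ n * P"
  using assms by (intro mult_mono power_mono mult_nonneg_nonneg) auto

text \<open>Applied with \<open>d\<close> the radius of a ball touching the hyperplane from below
  and \<open>p\<close> the height of a point above it: the value of the barrier -1/s becomes a
  multiple of the height.\<close>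

lemma recip_square_diff_le:
  fixes p d :: real
  assumes "p \<ge> 0" "d > 0"
  shows "1 / d\<^sup>2 - 1 / (p + d)\<^sup>2 \<le> 2 * p / d ^ 3"
proof -
  have "1 / d\<^sup>2 - 1 / (p + d)\<^sup>2 = p * (2 * d + p) / (d\<^sup>2 * (p + d)\<^sup>2)"
    using assms by (simp add: divide_simps) (simp add: power2_eq_square algebra_simps)
  also have "\<dots> \<le> 2 * p / d ^ 3"
  proof -
    have "p * (2 * d + p) * d \<le> p * (2 * (p + d)\<^sup>2)"
      using assms by (simp add: power2_eq_square algebra_simps)
    then have "p * (2 * d + p) * d * d\<^sup>2 \<le> p * (2 * (p + d)\<^sup>2) * d\<^sup>2" by (intro mult_right_mono) auto
    then show ?thesis using assms
      by (simp add: divide_simps) (simp add: power2_eq_square power3_eq_cube algebra_simps)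
  qed
  finally show ?thesis .
qed

lemma norm_less_if_inner_less: "w \<bullet> w < r\<^sup>2 \<Longrightarrow> 0 \<le> r \<Longrightarrow> norm w < r"
  by (metis power2_norm_eq_inner power_less_imp_less_base)

lemma norm_le_if_inner_le: "w \<bullet> w \<le> r\<^sup>2 \<Longrightarrow> 0 \<le> r \<Longrightarrow> norm w \<le> r"
  by (metis power2_norm_eq_inner power2_le_imp_le)

text \<open>The assumption \<open>compact_super\<close> replaces a boundary condition: in bounded
  regions outside the ball of radius \<open>R\<close>, \<open>v\<close> is below \<open>M\<close>
  near the boundary of \<open>U\<close>. The assumption \<open>half\<close> is the exterior ball
  condition seen after inversion, and \<open>tR\<close> makes |z - t| at most 2|z| where |z| is at
  least \<open>R\<close>.\<close>

locale half_space_solution = inverted_solution \<Omega> a t g u Du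
  for \<Omega> :: "(real^'n) set" and a t g u Du +
  fixes e :: "real^'n" and R M :: real
  assumes e: "norm e = 1" and R: "R > 0" and tR: "norm t \<le> R"
    and half: "\<And>z. z \<in> U \<Longrightarrow> R \<le> norm z \<Longrightarrow> 0 < e \<bullet> z"
    and compact_super: "\<And>T. compact {z \<in> U. R \<le> norm z \<and> norm z \<le> T \<and> M \<le> v z}"
begin

definition L where "L T = {z \<in> U. R \<le> norm z \<and> norm z \<le> T \<and> M \<le> v z}"

lemma compact_L: "compact (L T)" and L_U: "L T \<subseteq> U"
  using compact_super[of T] by (auto simp: L_def)

lemma compact_L_ball: "compact {z \<in> L T. (z - c) \<bullet> (z - c) \<le> r}"
proof -
  have "closed {z. (z - c) \<bullet> (z - c) \<le> r}"
    by (intro closed_Collect_le continuous_intros)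
  from compact_Int_closed[OF compact_L this] show ?thesis by (simp add: Int_def)
qed

lemma open_outer: "open {z \<in> U. R < norm z \<and> (z - c) \<bullet> (z - c) < r}"
proof -
  have "open {z. R < norm z}" "open {z. (z - c) \<bullet> (z - c) < r}"
    by (intro open_Collect_less continuous_intros)+
  then have "open (U \<inter> {z. R < norm z} \<inter> {z. (z - c) \<bullet> (z - c) < r})" using open_U by auto
  moreover have "U \<inter> {z. R < norm z} \<inter> {z. (z - c) \<bullet> (z - c) < r} = {z \<in> U. R < norm z \<and> (z - c) \<bullet> (z - c) < r}"
    by auto
  ultimately show ?thesis by simp
qed

lemma e_inner_e: "e \<bullet> e = 1"
  using e by (simp add: norm_eq_1)

lemma e_le: "e \<bullet> z \<le> norm z"
  using norm_cauchy_schwarz[of e z] e by simp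

lemma W_lower:
  assumes "z \<in> U" "R \<le> norm z" "norm z \<le> T"
  shows "(1 / (4 * T\<^sup>2)) ^ CARD('n) \<le> W z"
  unfolding W_def
proof (rule power_mono)
  have "norm (z - t) \<le> 2 * T" using norm_triangle_ineq4[of z t] tR assms by linarith
  then have "(norm (z - t))\<^sup>2 \<le> (2 * T)\<^sup>2" by (intro power_mono) auto
  then have "(z - t) \<bullet> (z - t) \<le> 4 * T\<^sup>2" by (simp add: power2_norm_eq_inner power_mult_distrib)
  moreover have "(z - t) \<bullet> (z - t) > 0" using t_notin_U assms by auto
  moreover have "T > 0" using assms R by simp
  ultimately show "1 / (4 * T\<^sup>2) \<le> 1 / ((z - t) \<bullet> (z - t))"
    by (intro divide_left_mono) (auto intro!: mult_pos_pos)
qed auto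

end

text \<open>The strict bound \<open>inner\<close> settles the inner sphere of the region. Elsewhere
  every barrier stays above \<open>M\<close>, so the solution can exceed it only at values for which
  \<open>growth\<close> is available.\<close>

locale absorbed_solution = half_space_solution \<Omega> a t g u Du e R M
  for \<Omega> :: "(real^'n) set" and a t g u Du e R M +
  fixes k :: real
  assumes inner: "\<And>z. z \<in> U \<Longrightarrow> norm z = R \<Longrightarrow> v z < M"
    and M: "M \<ge> 0" and k: "k > 0" and growth: "\<And>r. r \<ge> M \<Longrightarrow> g r \<ge> k * r ^ (2 * CARD('n) - 1)"
begin

lemma Wg_pos:
  assumes "z \<in> U" "v z > M"
  shows "0 < W z * g (v z)"
proof -
  have "0 < k * v z ^ (2 * CARD('n) - 1)" using k assms M by simp
  also have "\<dots> \<le> g (v z)" using growth assms by simp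
  finally show ?thesis using W_pos assms by simp
qed

lemma Wg_lower:
  assumes z: "z \<in> U" "R \<le> norm z" "norm z \<le> T" and vM: "v z > M" and y: "0 \<le> y" "y < v z"
  shows "(1 / (4 * T\<^sup>2)) ^ CARD('n) * (k * y ^ (2 * CARD('n) - 1)) < W z * g (v z)"
proof -
  have T: "T > 0" using z R by simp
  have "y ^ (2 * CARD('n) - 1) < v z ^ (2 * CARD('n) - 1)"
    using y N by (intro power_strict_mono) auto
  then have "k * y ^ (2 * CARD('n) - 1) < k * v z ^ (2 * CARD('n) - 1)" using k by simp
  also have "\<dots> \<le> g (v z)" using growth vM by simp
  finally have g: "k * y ^ (2 * CARD('n) - 1) < g (v z)" .
  have "(1 / (4 * T\<^sup>2)) ^ CARD('n) * (k * y ^ (2 * CARD('n) - 1)) < (1 / (4 * T\<^sup>2)) ^ CARD('n) * g (v z)"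
    using g T by (intro mult_strict_left_mono) auto
  also have "\<dots> \<le> W z * g (v z)"
    using W_lower[OF z] g k y by (intro mult_right_mono) (auto intro: order_trans[of _ "k * y ^ (2 * CARD('n) - 1)"])
  finally show ?thesis .
qed

text \<open>The Keller-Osserman bound, from a barrier that is infinite on a sphere around a point
  below the half-space.\<close>

lemma keller_osserman:
  "\<exists>C>0. \<forall>z\<in>U. R \<le> norm z \<longrightarrow> v z \<le> M + C * norm z"
proof -
  define n where "n = CARD('n) - 2"
  have Nn: "CARD('n) = n + 2" using N by (simp add: n_def)
  \<comment> \<open>The numerator comes from the N-Laplacian of the barrier, with 72 = 4 * 18; the
    factor 64 = 4 * 4^2 comes from \<open>W\<close> on |z| \<le> 4\<rho>. The barrier side carries
    B^(n+1), the absorption B^(2n+3), so a large \<open>B\<close> suffices.\<close>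
  define B where "B = max 1 (72 * real (n + 1) * 6 ^ n * 64 ^ CARD('n) / k)"
  have B1: "B \<ge> 1" and B2: "72 * real (n + 1) * 6 ^ n \<le> k * (1 / 64) ^ CARD('n) * B"
    using k by (auto simp: B_def max_def field_simps)
  have main: "v z0 \<le> M + B * norm z0" if z0: "z0 \<in> U" "R < norm z0" for z0
  proof -
    define \<rho> where "\<rho> = norm z0"
    have \<rho>: "\<rho> > 0" using z0 R unfolding \<rho>_def by linarith
    \<comment> \<open>At depth \<rho> below the hyperplane: the points of \<open>U\<close>
      considered are farther than \<rho> from \<open>c\<close>, and \<open>z0\<close> is within
      2\<rho>, well inside the sphere of radius 3\<rho> where the barrier is infinite.\<close>
    define c where "c = - \<rho> *\<^sub>R e"
    define \<Psi> where "\<Psi> z = M + B * \<rho> ^ 3 / (9 * \<rho>\<^sup>2 - (z - c) \<bullet> (z - c))" for z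
    define S where "S = {z \<in> U. R < norm z \<and> (z - c) \<bullet> (z - c) < 9 * \<rho>\<^sup>2}"
    have cn: "norm c = \<rho>" using \<rho> e by (simp add: c_def)
    have s_gt: "\<rho>\<^sup>2 < (z - c) \<bullet> (z - c)" if "z \<in> U" "R \<le> norm z" for z
    proof -
      have "(z - c) \<bullet> (z - c) = z \<bullet> z + 2 * \<rho> * (e \<bullet> z) + \<rho>\<^sup>2"
        by (simp add: c_def inner_add_left inner_add_right inner_commute e_inner_e power2_eq_square)
      moreover have "2 * \<rho> * (e \<bullet> z) > 0" using half[OF that] \<rho> by simp
      ultimately show ?thesis using inner_ge_zero[of z] by linarith
    qed
    have nz: "norm (z - c) < 3 * \<rho>" "norm z \<le> 4 * \<rho>" if "(z - c) \<bullet> (z - c) < 9 * \<rho>\<^sup>2" for z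
    proof -
      show 1: "norm (z - c) < 3 * \<rho>" using that \<rho> by (intro norm_less_if_inner_less) (auto simp: power_mult_distrib)
      then show "norm z \<le> 4 * \<rho>" using norm_triangle_ineq[of "z - c" c] cn by simp
    qed
    obtain V where V: "V > 0" "\<And>z. z \<in> L (4 * \<rho>) \<Longrightarrow> v z - M \<le> V"
    proof -
      have "compact (v ` L (4 * \<rho>))"
        by (rule compact_continuous_image[OF continuous_on_subset[OF v_cont L_U] compact_L])
      then obtain b where "\<And>z. z \<in> L (4 * \<rho>) \<Longrightarrow> norm (v z) \<le> b"
        using compact_imp_bounded bounded_iff by (metis imageI)
      then have "v z - M \<le> max 1 (b - M)" if "z \<in> L (4 * \<rho>)" for z using that by fastforce
      then show ?thesis using that[of "max 1 (b - M)"] by auto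
    qed
    \<comment> \<open>Where 9\<rho>^2 - s is below this number, the barrier exceeds M + V and hence
      \<open>v\<close>; so the points where \<open>v\<close> is larger stay away from the singular
      sphere.\<close>
    define \<epsilon> where "\<epsilon> = B * \<rho> ^ 3 / V"
    have \<epsilon>: "\<epsilon> > 0" using B1 \<rho> V by (simp add: \<epsilon>_def)
    define A where "A = {z \<in> L (4 * \<rho>). (z - c) \<bullet> (z - c) \<le> 9 * \<rho>\<^sup>2 - \<epsilon>}"
    have z0S: "(z0 - c) \<bullet> (z0 - c) \<le> 4 * \<rho>\<^sup>2"
    proof -
      have "norm (z0 - c) \<le> 2 * \<rho>" using norm_triangle_ineq4[of z0 c] cn by (simp add: \<rho>_def)
      then have "(norm (z0 - c))\<^sup>2 \<le> (2 * \<rho>)\<^sup>2" by (intro power_mono) auto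
      then show ?thesis by (simp add: power2_norm_eq_inner power_mult_distrib)
    qed
    have "v z0 \<le> \<Psi> z0"
    proof (rule comparison_radial[where c=c and C=M and S=S and A=A and I="{\<rho>\<^sup>2<..<9 * \<rho>\<^sup>2}"
        and X="\<lambda>s. B * \<rho> ^ 3 / (9 * \<rho>\<^sup>2 - s)" and \<xi>="\<lambda>s. B * \<rho> ^ 3 / (9 * \<rho>\<^sup>2 - s)\<^sup>2"
        and \<xi>'="\<lambda>s. 2 * B * \<rho> ^ 3 / (9 * \<rho>\<^sup>2 - s) ^ 3"])
      show "open S" unfolding S_def by (rule open_outer)
      show "S \<subseteq> U" by (auto simp: S_def)
      show "compact A" unfolding A_def by (rule compact_L_ball)
      show "A \<subseteq> U" using L_U by (auto simp: A_def)
      show "\<Psi> z = M + B * \<rho> ^ 3 / (9 * \<rho>\<^sup>2 - (z - c) \<bullet> (z - c))" for z by (simp add: \<Psi>_def)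
      show "continuous_on A \<Psi>" unfolding \<Psi>_def
        using \<epsilon> by (intro continuous_intros) (auto simp: A_def)
      show "continuous_on {\<rho>\<^sup>2<..<9 * \<rho>\<^sup>2} (\<lambda>s. 2 * B * \<rho> ^ 3 / (9 * \<rho>\<^sup>2 - s) ^ 3)"
        by (intro continuous_intros) auto
      show "z0 \<in> S" using z0 z0S \<rho> by (auto simp: S_def intro: le_less_trans)
    next
      fix z assume z: "z \<in> S"
      then have zU: "z \<in> U" "R < norm z" "(z - c) \<bullet> (z - c) < 9 * \<rho>\<^sup>2" by (auto simp: S_def)
      show I: "(z - c) \<bullet> (z - c) \<in> {\<rho>\<^sup>2<..<9 * \<rho>\<^sup>2}" using s_gt[of z] zU by simp
      assume vz: "\<Psi> z < v z"
      define d where "d = 9 * \<rho>\<^sup>2 - (z - c) \<bullet> (z - c)"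
      have d: "d > 0" using zU by (simp add: d_def)
      have X0: "B * \<rho> ^ 3 / d > 0" using d B1 \<rho> by simp
      have vM: "v z > M" using vz X0 by (simp add: \<Psi>_def d_def)
      have zL: "z \<in> L (4 * \<rho>)" using zU nz[of z] vM by (auto simp: L_def)
      have "B * \<rho> ^ 3 / d \<le> V" using vz V(2)[OF zL] by (simp add: \<Psi>_def d_def)
      then have "\<epsilon> \<le> d" using d V(1) by (simp add: \<epsilon>_def field_simps)
      then show "z \<in> A" using zL by (simp add: A_def d_def)
      fix s assume s: "s = (z - c) \<bullet> (z - c)"
      \<comment> \<open>A dimensionless variable. Up to constants, the bounds for both sides become
        \<kappa>^(2n+3) / \<rho>; the exponents agree because 2N - 1 = 2n + 3.\<close>
      define \<kappa> where "\<kappa> = \<rho>\<^sup>2 / d"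
      have \<kappa>: "\<kappa> > 0" using \<rho> d by (simp add: \<kappa>_def)
      have ds: "9 * \<rho>\<^sup>2 - s = d" by (simp add: s d_def)
      have x1: "2 * (B * \<rho> ^ 3 / d\<^sup>2) * norm (z - c) \<le> 6 * B * \<kappa>\<^sup>2"
      proof -
        have "2 * (B * \<rho> ^ 3 / d\<^sup>2) * norm (z - c) \<le> 2 * (B * \<rho> ^ 3 / d\<^sup>2) * (3 * \<rho>)"
          using nz(1)[OF zU(3)] B1 \<rho> by (intro mult_left_mono) auto
        also have "\<dots> = 6 * B * \<kappa>\<^sup>2" by (simp add: \<kappa>_def power2_eq_square power3_eq_cube field_simps)
        finally show ?thesis .
      qed
      have x2: "B * \<rho> ^ 3 / d\<^sup>2 + s * (2 * B * \<rho> ^ 3 / d ^ 3) \<le> 18 * B * \<kappa> ^ 3 / \<rho>"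
      proof -
        have "B * \<rho> ^ 3 / d\<^sup>2 + s * (2 * B * \<rho> ^ 3 / d ^ 3) = B * \<rho> ^ 3 * (d + 2 * s) / d ^ 3"
          using d by (simp add: power2_eq_square power3_eq_cube field_simps)
        also have "\<dots> \<le> B * \<rho> ^ 3 * (18 * \<rho>\<^sup>2) / d ^ 3"
          using d ds B1 \<rho> zU(3) s by (intro divide_right_mono mult_left_mono) auto
        also have "\<dots> = 18 * B * \<kappa> ^ 3 / \<rho>"
          using \<rho> d by (simp add: \<kappa>_def power2_eq_square power3_eq_cube field_simps)
        finally show ?thesis .
      qed
      have "4 * real (CARD('n) - 1) * (2 * (B * \<rho> ^ 3 / d\<^sup>2) * norm (z - c)) ^ n * (B * \<rho> ^ 3 / d\<^sup>2 + s * (2 * B * \<rho> ^ 3 / d ^ 3))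
        \<le> 4 * real (CARD('n) - 1) * (6 * B * \<kappa>\<^sup>2) ^ n * (18 * B * \<kappa> ^ 3 / \<rho>)"
        using x1 x2 B1 \<rho> d s by (intro mult_power_mult_mono) auto
      also have "\<dots> = (72 * real (n + 1) * 6 ^ n) * (B ^ (n + 1) * \<kappa> ^ (2 * n + 3) / \<rho>)"
        by (simp add: Nn power_mult_distrib power_add power_mult power3_eq_cube power2_eq_square)
      also have "\<dots> \<le> (k * (1 / 64) ^ CARD('n) * B) * (B ^ (n + 1) * \<kappa> ^ (2 * n + 3) / \<rho>)"
        using B2 B1 \<kappa> \<rho> by (intro mult_right_mono) auto
      also have "\<dots> \<le> (k * (1 / 64) ^ CARD('n) * B ^ (n + 2)) * (B ^ (n + 1) * \<kappa> ^ (2 * n + 3) / \<rho>)"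
        using B1 \<kappa> \<rho> k self_le_power[of B "n + 2"] by (intro mult_right_mono mult_left_mono) auto
      also have "\<dots> = (1 / (4 * (4 * \<rho>)\<^sup>2)) ^ CARD('n) * (k * (B * \<rho> * \<kappa>) ^ (2 * CARD('n) - 1))"
      proof -
        define m where "m = 2 * n + 3"
        have m: "2 * CARD('n) - 1 = m" "2 * CARD('n) = Suc m" "2 * n + 3 = m" by (simp_all add: Nn m_def)
        have mm: "m = (n + 2) + (n + 1)" by (simp add: m_def)
        have Bm: "B ^ (n + 2) * B ^ (n + 1) = B ^ m" unfolding mm by (simp only: power_add)
        have "(1 / (4 * (4 * \<rho>)\<^sup>2)) ^ CARD('n) = (1 / 64) ^ CARD('n) / \<rho> ^ (2 * CARD('n))"
          by (simp add: power_mult_distrib power_divide power_mult)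
        then have Wm: "(1 / (4 * (4 * \<rho>)\<^sup>2)) ^ CARD('n) = (1 / 64) ^ CARD('n) / (\<rho> * \<rho> ^ m)"
          unfolding m by simp
        have "k * (1 / 64) ^ CARD('n) * B ^ (n + 2) * (B ^ (n + 1) * \<kappa> ^ m / \<rho>)
           = k * (1 / 64) ^ CARD('n) * (B ^ (n + 2) * B ^ (n + 1)) * \<kappa> ^ m / \<rho>"
          by (simp only: mult_ac times_divide_eq_right times_divide_eq_left)
        then show ?thesis using \<rho> unfolding Wm m Bm by (simp add: power_mult_distrib)
      qed
      also have "B * \<rho> * \<kappa> = B * \<rho> ^ 3 / d" by (simp add: \<kappa>_def power2_eq_square power3_eq_cube)
      also have "(1 / (4 * (4 * \<rho>)\<^sup>2)) ^ CARD('n) * (k * (B * \<rho> ^ 3 / d) ^ (2 * CARD('n) - 1)) < W z * g (v z)"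
        using zU nz(2)[OF zU(3)] vM X0 vz M by (intro Wg_lower) (auto simp: \<Psi>_def d_def)
      finally show "4 * real (CARD('n) - 1) * (2 * (B * \<rho> ^ 3 / (9 * \<rho>\<^sup>2 - s)\<^sup>2) * norm (z - c)) ^ (CARD('n) - 2) *
         (B * \<rho> ^ 3 / (9 * \<rho>\<^sup>2 - s)\<^sup>2 + s * (2 * B * \<rho> ^ 3 / (9 * \<rho>\<^sup>2 - s) ^ 3)) < W z * g (v z)"
        unfolding ds n_def .
    next
      fix z assume "z \<in> A" "z \<notin> S"
      then have "z \<in> U" "norm z = R" "M \<le> v z" using \<epsilon> by (auto simp: A_def S_def L_def)
      then show "v z \<le> \<Psi> z" using inner by fastforce
    next
      fix s assume s: "s \<in> {\<rho>\<^sup>2<..<9 * \<rho>\<^sup>2}"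
      have "0 < \<rho>\<^sup>2" using \<rho> by simp
      then show "0 < s \<and> 0 < B * \<rho> ^ 3 / (9 * \<rho>\<^sup>2 - s)\<^sup>2" using s B1 \<rho> by auto
      show "((\<lambda>s. B * \<rho> ^ 3 / (9 * \<rho>\<^sup>2 - s)) has_real_derivative B * \<rho> ^ 3 / (9 * \<rho>\<^sup>2 - s)\<^sup>2) (at s)"
        using s by (intro DERIV_recip_diff) auto
      show "((\<lambda>s. B * \<rho> ^ 3 / (9 * \<rho>\<^sup>2 - s)\<^sup>2) has_real_derivative 2 * B * \<rho> ^ 3 / (9 * \<rho>\<^sup>2 - s) ^ 3) (at s)"
        using s DERIV_recip_diff(2)[of "9 * \<rho>\<^sup>2" s "B * \<rho> ^ 3"] by (simp add: mult.assoc)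
    qed
    also have "\<Psi> z0 \<le> M + B * \<rho> ^ 3 / (5 * \<rho>\<^sup>2)"
    proof -
      have "\<rho>\<^sup>2 > 0" using \<rho> by simp
      then have "5 * \<rho>\<^sup>2 \<le> 9 * \<rho>\<^sup>2 - (z0 - c) \<bullet> (z0 - c)" "0 < 5 * \<rho>\<^sup>2"
        "0 < 9 * \<rho>\<^sup>2 - (z0 - c) \<bullet> (z0 - c)" using z0S by linarith+
      then show ?thesis unfolding \<Psi>_def using \<rho> B1
        by (intro add_left_mono divide_left_mono mult_pos_pos) simp_all
    qed
    also have "\<dots> \<le> M + B * \<rho>"
      using \<rho> B1 by (simp add: power2_eq_square power3_eq_cube)
    finally show ?thesis by (simp add: \<rho>_def)
  qed
  show ?thesis
  proof (intro exI conjI ballI impI)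
    show "B > 0" using B1 by simp
    fix z assume z: "z \<in> U" "R \<le> norm z"
    show "v z \<le> M + B * norm z"
    proof (cases "norm z = R")
      case True
      then have "v z < M" using inner z by simp
      moreover have "B * norm z \<ge> 0" using B1 by simp
      ultimately show ?thesis by linarith
    qed (use main z in auto)
  qed
qed

text \<open>The bound by \<open>C * norm z\<close> is used as data on a sphere of radius comparable
  to |z0| around a point below \<open>z0\<close>. The barrier is \<open>M\<close> on a concentric
  sphere touching the hyperplane from below, so at \<open>z0\<close> it exceeds \<open>M\<close> by
  a multiple of the height. Its N-Laplacian is negative, and the absorption enters by its sign
  only.\<close>

lemma linear_bound:
  "\<exists>C>0. \<forall>z\<in>U. R \<le> norm z \<longrightarrow> v z \<le> M + C * (e \<bullet> z)"
proof -
  obtain C where C: "C > 0" "\<And>z. z \<in> U \<Longrightarrow> R \<le> norm z \<Longrightarrow> v z \<le> M + C * norm z"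
    using keller_osserman by blast
  have main: "v z0 \<le> M + (12 * C) * (e \<bullet> z0)" if z0: "z0 \<in> U" "R < norm z0" for z0
  proof -
    define \<rho> where "\<rho> = norm z0"
    define p where "p = e \<bullet> z0"
    have \<rho>: "\<rho> > 0" using z0 R unfolding \<rho>_def by linarith
    have p: "p > 0" "p \<le> \<rho>" using half[of z0] z0 e_le by (auto simp: p_def \<rho>_def)
    \<comment> \<open>Vertically below \<open>z0\<close> at depth \<rho> under the hyperplane, so
      that the ball of radius \<rho> touches the hyperplane at the foot of
      \<open>z0\<close>.\<close>
    define c where "c = z0 - (p + \<rho>) *\<^sub>R e"
    \<comment> \<open>At distance 3\<rho> the barrier exceeds \<open>M\<close> by 8/9 of 6C\<rho>,
      that is 16/3 C\<rho>, which covers C |z| \<le> 5C\<rho>.\<close>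
    define B where "B = 6 * C * \<rho> ^ 3"
    have B: "B > 0" using C \<rho> by (simp add: B_def)
    define \<Psi> where "\<Psi> z = (M + B / \<rho>\<^sup>2) + (- B / ((z - c) \<bullet> (z - c)))" for z
    define S where "S = {z \<in> U. R < norm z \<and> (z - c) \<bullet> (z - c) < 9 * \<rho>\<^sup>2}"
    define A where "A = {z \<in> L (5 * \<rho>). (z - c) \<bullet> (z - c) \<le> 9 * \<rho>\<^sup>2}"
    have cn: "norm c \<le> 2 * \<rho>"
    proof -
      have "(z0 - p *\<^sub>R e) \<bullet> (z0 - p *\<^sub>R e) = z0 \<bullet> z0 - p\<^sup>2"
        by (simp add: inner_diff_left inner_diff_right inner_commute e_inner_e p_def power2_eq_square algebra_simps)
      also have "\<dots> \<le> \<rho>\<^sup>2" by (simp add: \<rho>_def power2_norm_eq_inner)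
      finally have "norm (z0 - p *\<^sub>R e) \<le> \<rho>" using \<rho> by (intro norm_le_if_inner_le) auto
      moreover have "c = (z0 - p *\<^sub>R e) - \<rho> *\<^sub>R e" by (simp add: c_def algebra_simps)
      ultimately show ?thesis using norm_triangle_ineq4[of "z0 - p *\<^sub>R e" "\<rho> *\<^sub>R e"] e \<rho> by simp
    qed
    have s_gt: "\<rho>\<^sup>2 < (z - c) \<bullet> (z - c)" if "z \<in> U" "R \<le> norm z" for z
    proof -
      have "e \<bullet> (z - c) = e \<bullet> z + \<rho>" by (simp add: c_def inner_diff_right e_inner_e p_def)
      then have "\<rho> < norm (z - c)" using half[OF that] e_le[of "z - c"] by linarith
      then have "\<rho>\<^sup>2 < (norm (z - c))\<^sup>2" using \<rho> by (intro power_strict_mono) auto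
      then show ?thesis by (simp add: power2_norm_eq_inner)
    qed
    have nz: "norm z \<le> 5 * \<rho>" if "(z - c) \<bullet> (z - c) \<le> 9 * \<rho>\<^sup>2" for z
    proof -
      have "norm (z - c) \<le> 3 * \<rho>" using that \<rho> by (intro norm_le_if_inner_le) (auto simp: power_mult_distrib)
      then show ?thesis using norm_triangle_ineq[of "z - c" c] cn by simp
    qed
    have \<rho>2: "\<rho>\<^sup>2 > 0" using \<rho> by simp
    have z0c: "(z0 - c) \<bullet> (z0 - c) = (p + \<rho>)\<^sup>2" by (simp add: c_def e_inner_e power2_eq_square)
    have "v z0 \<le> \<Psi> z0"
    proof (rule comparison_radial[where c=c and C="M + B / \<rho>\<^sup>2" and S=S and A=A and I="{\<rho>\<^sup>2<..}"
        and X="\<lambda>s. - B / s" and \<xi>="\<lambda>s. B / s\<^sup>2" and \<xi>'="\<lambda>s. - 2 * B / s ^ 3"])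
      show "open S" unfolding S_def by (rule open_outer)
      show "S \<subseteq> U" by (auto simp: S_def)
      show "compact A" unfolding A_def by (rule compact_L_ball)
      show "A \<subseteq> U" using L_U by (auto simp: A_def)
      show "\<Psi> z = M + B / \<rho>\<^sup>2 + - B / ((z - c) \<bullet> (z - c))" for z by (simp add: \<Psi>_def)
      have "(z - c) \<bullet> (z - c) \<noteq> 0" if "z \<in> A" for z
        using s_gt[of z] \<rho>2 that by (auto simp: A_def L_def)
      then show "continuous_on A \<Psi>" unfolding \<Psi>_def by (intro continuous_intros) auto
      show "continuous_on {\<rho>\<^sup>2<..} (\<lambda>s. - 2 * B / s ^ 3)"
        using \<rho>2 by (intro continuous_intros) auto
      have "(p + \<rho>)\<^sup>2 \<le> (2 * \<rho>)\<^sup>2" using p \<rho> by (intro power_mono) auto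
      also have "\<dots> < 9 * \<rho>\<^sup>2" using \<rho>2 by (simp add: power_mult_distrib)
      finally show "z0 \<in> S" using z0 z0c by (simp add: S_def)
    next
      fix z assume z: "z \<in> S"
      then have zU: "z \<in> U" "R < norm z" "(z - c) \<bullet> (z - c) < 9 * \<rho>\<^sup>2" by (auto simp: S_def)
      then have s: "\<rho>\<^sup>2 < (z - c) \<bullet> (z - c)" using s_gt[of z] by simp
      then show "(z - c) \<bullet> (z - c) \<in> {\<rho>\<^sup>2<..}" by simp
      assume vz: "\<Psi> z < v z"
      have "B / ((z - c) \<bullet> (z - c)) \<le> B / \<rho>\<^sup>2" by (intro divide_left_mono mult_pos_pos) (use s \<rho>2 B in linarith)+
      then have vM: "v z > M" using vz by (simp add: \<Psi>_def)
      then show "z \<in> A" using zU nz[of z] by (auto simp: A_def L_def)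
      fix s assume s': "s = (z - c) \<bullet> (z - c)"
      have s0: "s > 0" using s \<rho>2 unfolding s' by linarith
      have "B / s\<^sup>2 + s * (- 2 * B / s ^ 3) = - (B / s\<^sup>2)"
        using s0 by (simp add: power2_eq_square power3_eq_cube divide_simps)
      moreover have "B / s\<^sup>2 > 0" using B s0 by simp
      ultimately have "4 * real (CARD('n) - 1) * (2 * (B / s\<^sup>2) * norm (z - c)) ^ (CARD('n) - 2) *
         (B / s\<^sup>2 + s * (- 2 * B / s ^ 3)) \<le> 0"
        by (intro mult_nonneg_nonpos mult_nonneg_nonneg zero_le_power) auto
      also have "0 < W z * g (v z)" by (rule Wg_pos[OF zU(1) vM])
      finally show "4 * real (CARD('n) - 1) * (2 * (B / s\<^sup>2) * norm (z - c)) ^ (CARD('n) - 2) *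
         (B / s\<^sup>2 + s * (- 2 * B / s ^ 3)) < W z * g (v z)" .
    next
      fix z assume z: "z \<in> A" "z \<notin> S"
      then have zU: "z \<in> U" "M \<le> v z" "R \<le> norm z" "norm z \<le> 5 * \<rho>" by (auto simp: A_def L_def)
      have "norm z \<noteq> R" using inner[of z] zU by auto
      then have "(z - c) \<bullet> (z - c) = 9 * \<rho>\<^sup>2" using z zU by (auto simp: A_def S_def)
      then have "\<Psi> z = M + B / \<rho>\<^sup>2 - B / (9 * \<rho>\<^sup>2)" by (simp add: \<Psi>_def)
      also have "\<dots> = M + C * (16 / 3 * \<rho>)"
        using \<rho> by (simp add: B_def power2_eq_square power3_eq_cube)
      also have "\<dots> \<ge> M + C * norm z" using C(1) zU \<rho> by (intro add_left_mono mult_left_mono) auto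
      finally show "v z \<le> \<Psi> z" using C(2)[of z] zU by simp
    next
      fix s assume "s \<in> {\<rho>\<^sup>2<..}"
      then have s: "s > 0" using \<rho>2 unfolding greaterThan_iff by linarith
      then show "0 < s \<and> 0 < B / s\<^sup>2" using B by simp
      show "((\<lambda>s. - B / s) has_real_derivative B / s\<^sup>2) (at s)"
        using DERIV_recip_diff(1)[of 0 s B] s by simp
      show "((\<lambda>s. B / s\<^sup>2) has_real_derivative - 2 * B / s ^ 3) (at s)"
        using DERIV_recip_diff(2)[of 0 s B] s by simp
    qed
    also have "\<Psi> z0 \<le> M + 12 * C * p"
    proof -
      have "\<Psi> z0 = M + 6 * C * \<rho> ^ 3 * (1 / \<rho>\<^sup>2 - 1 / (p + \<rho>)\<^sup>2)"
        unfolding \<Psi>_def z0c by (simp add: B_def right_diff_distrib)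
      also have "1 / \<rho>\<^sup>2 - 1 / (p + \<rho>)\<^sup>2 \<le> 2 * p / \<rho> ^ 3"
        using p \<rho> by (intro recip_square_diff_le) auto
      finally show ?thesis using \<rho> C by (simp add: mult_left_mono)
    qed
    finally show ?thesis by (simp add: p_def)
  qed
  show ?thesis
  proof (intro exI conjI ballI impI)
    show "12 * C > 0" using C by simp
    fix z assume z: "z \<in> U" "R \<le> norm z"
    show "v z \<le> M + 12 * C * (e \<bullet> z)"
    proof (cases "norm z = R")
      case True
      then have "v z < M" using inner z by simp
      moreover have "12 * C * (e \<bullet> z) \<ge> 0" using C half[OF z] by simp
      ultimately show ?thesis by linarith
    qed (use main z in auto)
  qed
qed

text \<open>Inside a ball tangent to the boundary hyperplane the absorption makes a multiple of the
  Hopf function available as a correction; the gain does not depend on the size of the ball.\<close>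

lemma slope_improvement:
  assumes K: "K > 0" and vK: "\<And>z. z \<in> U \<Longrightarrow> R \<le> norm z \<Longrightarrow> v z \<le> M + K * (e \<bullet> z)"
  shows "\<exists>K'\<ge>0. K' < K \<and> (\<forall>z\<in>U. R \<le> norm z \<longrightarrow> v z \<le> M + K' * (e \<bullet> z))"
proof -
  define n where "n = CARD('n) - 2"
  have Nn: "CARD('n) = n + 2" using N by (simp add: n_def)
  \<comment> \<open>The value of \<alpha>s on the sphere. With this choice 4(N-1)\<xi> + 4s\<xi>' =
    \<xi> (\<beta> - 4\<alpha>s) is positive only for s < \<rho>^2 / 4, in the ball of half the
    radius. There the height is more than \<rho>/2, so a solution above the barrier exceeds
    K\<rho>/4.\<close>
  define \<beta> where "\<beta> = 4 * real (n + 1)"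
  have \<beta>: "\<beta> \<ge> 4" by (simp add: \<beta>_def)
  \<comment> \<open>In that smaller ball \<gamma>/\<rho> is a lower bound of the absorption: 36 = 4
    * 3^2 stems from \<open>W\<close> on |z| \<le> 3\<rho>, and K/4 from the size of
    \<open>v\<close>.\<close>
  define \<gamma> where "\<gamma> = (1 / 36) ^ CARD('n) * (k * (K / 4) ^ (2 * CARD('n) - 1))"
  have \<gamma>: "\<gamma> > 0" using k K by (simp add: \<gamma>_def)
  \<comment> \<open>The first entry keeps the gradient of the correction below K/2, so that |P|
    stays between K/2 and 2K; the second makes the absorption dominate. Neither involves the
    radius.\<close>
  define \<delta> where "\<delta> = min (K / (4 * \<beta>)) (\<gamma> / ((2 * K) ^ n * \<beta>\<^sup>2))"
  have \<delta>: "\<delta> > 0" using K \<beta> \<gamma> by (simp add: \<delta>_def)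
  have \<delta>1: "\<delta> * \<beta> \<le> K / 4"
  proof -
    have "\<delta> \<le> K / (4 * \<beta>)" by (simp add: \<delta>_def)
    then show ?thesis using \<beta> by (simp add: field_simps)
  qed
  have \<delta>2: "(2 * K) ^ n * (\<beta> * (\<delta> * \<beta>)) \<le> \<gamma>"
  proof -
    have "\<delta> \<le> \<gamma> / ((2 * K) ^ n * \<beta>\<^sup>2)" by (simp add: \<delta>_def)
    moreover have "(2 * K) ^ n * \<beta>\<^sup>2 > 0" using K \<beta> by simp
    ultimately have "\<delta> * ((2 * K) ^ n * \<beta>\<^sup>2) \<le> \<gamma>" by (simp add: pos_le_divide_eq)
    then show ?thesis by (simp add: power2_eq_square mult_ac)
  qed
  \<comment> \<open>A lower bound for the decrease of the correction per unit of height along the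
    axis through the tangent point.\<close>
  define \<theta> where "\<theta> = \<delta> * \<beta> * exp (- \<beta>)"
  have \<theta>: "\<theta> > 0" using \<delta> \<beta> by (simp add: \<theta>_def)
  have \<theta>K: "\<theta> \<le> K / 4"
  proof -
    have "\<theta> \<le> \<delta> * \<beta> * 1" unfolding \<theta>_def using \<delta> \<beta> by (intro mult_left_mono) auto
    then show ?thesis using \<delta>1 by simp
  qed
  have main: "v z0 \<le> M + (K - \<theta>) * (e \<bullet> z0)" if z0: "z0 \<in> U" "R < norm z0" for z0
  proof -
    define \<rho> where "\<rho> = norm z0"
    define p where "p = e \<bullet> z0"
    have \<rho>: "\<rho> > 0" using z0 R unfolding \<rho>_def by linarith
    have \<rho>2: "\<rho>\<^sup>2 > 0" using \<rho> by simp
    have p: "p > 0" "p \<le> \<rho>" using half[of z0] z0 e_le by (auto simp: p_def \<rho>_def)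
    \<comment> \<open>On the vertical line through \<open>z0\<close> at height \<rho>: the ball of
      radius \<rho> touches the hyperplane from above, and \<open>z0\<close> lies inside it because
      0 < p \<le> \<rho>.\<close>
    define c where "c = z0 + (\<rho> - p) *\<^sub>R e"
    define \<alpha> where "\<alpha> = \<beta> / \<rho>\<^sup>2"
    have \<alpha>: "\<alpha> > 0" "\<alpha> * \<rho>\<^sup>2 = \<beta>" using \<beta> \<rho> by (simp_all add: \<alpha>_def)
    \<comment> \<open>Hopf's exponential function with negative sign, zero on the sphere and
      negative inside; the prefactor \<rho> makes the size of its gradient independent of
      \<rho>.\<close>
    define X where "X s = - (\<delta> * \<rho>) * (exp (- (\<alpha> * s)) - exp (- \<beta>))" for s
    define \<xi> where "\<xi> s = \<delta> * \<rho> * \<alpha> * exp (- (\<alpha> * s))" for s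
    define \<xi>' where "\<xi>' s = - (\<delta> * \<rho> * \<alpha> * \<alpha> * exp (- (\<alpha> * s)))" for s
    define \<Psi> where "\<Psi> z = M + K * (e \<bullet> z) + X ((z - c) \<bullet> (z - c))" for z
    define P where "P z = K *\<^sub>R e + (2 * \<xi> ((z - c) \<bullet> (z - c))) *\<^sub>R (z - c)" for z
    define S where "S = {z \<in> U. R < norm z \<and> (z - c) \<bullet> (z - c) < \<rho>\<^sup>2}"
    define A where "A = {z \<in> L (3 * \<rho>). (z - c) \<bullet> (z - c) \<le> \<rho>\<^sup>2}"
    have da: "\<delta> * \<rho> * \<alpha> = \<delta> * \<beta> / \<rho>" using \<rho> by (simp add: \<alpha>_def power2_eq_square)
    have cn: "norm c \<le> 2 * \<rho>"
      unfolding c_def using norm_triangle_ineq[of z0 "(\<rho> - p) *\<^sub>R e"] e p by (simp add: \<rho>_def)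
    have z0c: "(z0 - c) \<bullet> (z0 - c) = (\<rho> - p)\<^sup>2" by (simp add: c_def e_inner_e power2_eq_square algebra_simps)
    have ec: "e \<bullet> c = \<rho>" by (simp add: c_def inner_add_right e_inner_e p_def)
    have nz: "norm (z - c) \<le> \<rho>" "norm z \<le> 3 * \<rho>" if "(z - c) \<bullet> (z - c) \<le> \<rho>\<^sup>2" for z
    proof -
      show 1: "norm (z - c) \<le> \<rho>" using that \<rho> by (intro norm_le_if_inner_le) auto
      then show "norm z \<le> 3 * \<rho>" using norm_triangle_ineq[of "z - c" c] cn by simp
    qed
    have height: "\<rho> - norm (z - c) \<le> e \<bullet> z" for z
    proof -
      have "- (e \<bullet> (z - c)) \<le> norm (z - c)" using e_le[of "c - z"] by (simp add: inner_diff_right norm_minus_commute)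
      then show ?thesis using ec by (simp add: inner_diff_right)
    qed
    have \<xi>_bound: "0 < \<xi> s" "s \<ge> 0 \<Longrightarrow> \<xi> s \<le> \<delta> * \<beta> / \<rho>" for s
    proof -
      show "0 < \<xi> s" using \<delta> \<rho> \<alpha> by (simp add: \<xi>_def)
      assume "s \<ge> 0"
      then have "\<xi> s \<le> \<delta> * \<rho> * \<alpha> * 1" unfolding \<xi>_def using \<delta> \<rho> \<alpha>(1) by (intro mult_left_mono) auto
      then show "\<xi> s \<le> \<delta> * \<beta> / \<rho>" using da by simp
    qed
    have X_bound: "X ((z - c) \<bullet> (z - c)) \<ge> - (K / 2) * (\<rho> - norm (z - c))"
      if "(z - c) \<bullet> (z - c) \<le> \<rho>\<^sup>2" for z
    proof -
      define s where "s = (z - c) \<bullet> (z - c)"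
      define w where "w = norm (z - c)"
      have sw: "s = w\<^sup>2" by (simp add: s_def w_def power2_norm_eq_inner)
      have w: "0 \<le> w" "w \<le> \<rho>" using nz(1)[OF that] by (auto simp: w_def)
      have as: "\<alpha> * s \<le> \<beta>" using that \<alpha> mult_left_mono[of s "\<rho>\<^sup>2" \<alpha>] by (simp add: s_def)
      have "exp (- (\<alpha> * s)) - exp (- \<beta>) \<le> (\<beta> - \<alpha> * s) * exp (- (\<alpha> * s))"
        by (rule one_minus_exp_bounds(1)[OF as])
      also have "\<dots> \<le> (\<beta> - \<alpha> * s) * 1"
        using as \<alpha>(1) by (intro mult_left_mono) (auto simp: sw)
      also have "\<dots> = \<alpha> * (\<rho> - w) * (\<rho> + w)"
        using \<alpha>(2) by (simp add: sw power2_eq_square algebra_simps)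
      also have "\<dots> \<le> \<alpha> * (\<rho> - w) * (2 * \<rho>)" using \<alpha>(1) w by (intro mult_left_mono) auto
      finally have "\<delta> * \<rho> * (exp (- (\<alpha> * s)) - exp (- \<beta>)) \<le> \<delta> * \<rho> * (\<alpha> * (\<rho> - w) * (2 * \<rho>))"
        using \<delta> \<rho> by (intro mult_left_mono) auto
      also have "\<dots> = (\<delta> * \<rho> * \<alpha> * \<rho>) * 2 * (\<rho> - w)" by simp
      also have "\<delta> * \<rho> * \<alpha> * \<rho> = \<delta> * \<beta>" using da \<rho> by simp
      also have "\<delta> * \<beta> * 2 * (\<rho> - w) \<le> (K / 2) * (\<rho> - w)" using \<delta>1 w by (intro mult_right_mono) auto
      finally show ?thesis by (simp add: X_def s_def w_def)
    qed
    have P_bound: "K / 2 \<le> norm (P z)" "norm (P z) \<le> 2 * K" if "(z - c) \<bullet> (z - c) \<le> \<rho>\<^sup>2" for z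
    proof -
      have "norm ((2 * \<xi> ((z - c) \<bullet> (z - c))) *\<^sub>R (z - c)) = 2 * \<xi> ((z - c) \<bullet> (z - c)) * norm (z - c)"
        using \<xi>_bound(1)[of "(z - c) \<bullet> (z - c)"] by simp
      also have "\<dots> \<le> 2 * (\<delta> * \<beta> / \<rho>) * \<rho>"
        using \<xi>_bound[of "(z - c) \<bullet> (z - c)"] nz(1)[OF that] \<delta> \<beta> \<rho>
        by (intro mult_mono) auto
      also have "\<dots> \<le> K / 2" using \<rho> \<delta>1 by simp
      finally have 1: "norm ((2 * \<xi> ((z - c) \<bullet> (z - c))) *\<^sub>R (z - c)) \<le> K / 2" .
      have 2: "norm (K *\<^sub>R e) = K" using e K by simp
      show "norm (P z) \<le> 2 * K"
        using norm_triangle_ineq[of "K *\<^sub>R e" "(2 * \<xi> ((z - c) \<bullet> (z - c))) *\<^sub>R (z - c)"] 1 2 K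
        unfolding P_def by linarith
      show "K / 2 \<le> norm (P z)"
        using norm_diff_ineq[of "K *\<^sub>R e" "(2 * \<xi> ((z - c) \<bullet> (z - c))) *\<^sub>R (z - c)"] 1 2
        unfolding P_def by linarith
    qed
    \<comment> \<open>The correction uses up at most half of the linear part, so a solution above
      the barrier is above \<open>M\<close>, where the absorption is known to be positive.\<close>
    have \<Psi>_low: "\<Psi> z \<ge> M + (K / 2) * (e \<bullet> z)" if "(z - c) \<bullet> (z - c) \<le> \<rho>\<^sup>2" for z
    proof -
      have "(K / 2) * (\<rho> - norm (z - c)) \<le> (K / 2) * (e \<bullet> z)"
        using height[of z] K by (intro mult_left_mono) auto
      then have "X ((z - c) \<bullet> (z - c)) \<ge> - ((K / 2) * (e \<bullet> z))" using X_bound[OF that] by linarith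
      moreover have "K * (e \<bullet> z) = (K / 2) * (e \<bullet> z) + (K / 2) * (e \<bullet> z)" by simp
      ultimately show ?thesis unfolding \<Psi>_def by linarith
    qed
    have "v z0 \<le> \<Psi> z0"
    proof (rule comparison_barrier[where c=c and C=M and K=K and e=e and S=S and A=A and I=UNIV
        and X=X and \<xi>=\<xi> and \<xi>'=\<xi>' and P=P])
      show "open S" unfolding S_def by (rule open_outer)
      show "S \<subseteq> U" by (auto simp: S_def)
      show "compact A" unfolding A_def by (rule compact_L_ball)
      show "A \<subseteq> U" using L_U by (auto simp: A_def)
      show "\<Psi> z = M + K * (e \<bullet> z) + X ((z - c) \<bullet> (z - c))" for z by (simp add: \<Psi>_def)
      show "P z = K *\<^sub>R e + (2 * \<xi> ((z - c) \<bullet> (z - c))) *\<^sub>R (z - c)" for z by (simp add: P_def)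
      show "continuous_on A \<Psi>" unfolding \<Psi>_def X_def by (intro continuous_intros)
      show "continuous_on UNIV \<xi>'" unfolding \<xi>'_def by (intro continuous_intros)
      show "(X has_real_derivative \<xi> s) (at s)" for s
        unfolding X_def \<xi>_def by (auto intro!: derivative_eq_intros)
      show "(\<xi> has_real_derivative \<xi>' s) (at s)" for s
        unfolding \<xi>_def \<xi>'_def by (auto intro!: derivative_eq_intros)
      have "(\<rho> - p)\<^sup>2 < \<rho>\<^sup>2" using p by (intro power_strict_mono) auto
      then show "z0 \<in> S" using z0 z0c by (simp add: S_def)
    next
      fix z assume z: "z \<in> S"
      then have zU: "z \<in> U" "R < norm z" "(z - c) \<bullet> (z - c) \<le> \<rho>\<^sup>2" by (auto simp: S_def)
      show "P z \<noteq> 0" using P_bound(1)[OF zU(3)] K by auto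
      assume vz: "\<Psi> z < v z"
      have ez: "e \<bullet> z > 0" using half zU by simp
      then have "(K / 2) * (e \<bullet> z) > 0" using K by simp
      then have vM: "v z > M" using \<Psi>_low[OF zU(3)] vz by linarith
      then show "z \<in> A" using zU nz(2)[OF zU(3)] by (auto simp: A_def L_def)
      fix s assume s: "s = (z - c) \<bullet> (z - c)"
      have s0: "s \<ge> 0" by (simp add: s)
      have \<xi>'\<xi>: "\<xi>' s = - (\<alpha> * \<xi> s)" by (simp add: \<xi>_def \<xi>'_def)
      have third: "4 * real (CARD('n) - 2) * \<xi>' s * ((z - c) \<bullet> P z)\<^sup>2 / (norm (P z))\<^sup>2 \<le> 0"
        using \<alpha>(1) \<xi>_bound(1)[of s] unfolding \<xi>'\<xi>
        by (intro divide_nonpos_nonneg mult_nonpos_nonneg mult_nonneg_nonpos) auto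
      have "4 * real (CARD('n) - 1) * \<xi> s + 4 * s * \<xi>' s = \<xi> s * (\<beta> - 4 * (\<alpha> * s))"
        by (simp add: \<xi>'\<xi> Nn \<beta>_def algebra_simps)
      then have "norm (P z) ^ (CARD('n) - 2) * (4 * real (CARD('n) - 1) * \<xi> s + 4 * s * \<xi>' s
         + 4 * real (CARD('n) - 2) * \<xi>' s * ((z - c) \<bullet> P z)\<^sup>2 / (norm (P z))\<^sup>2)
         \<le> norm (P z) ^ n * (\<xi> s * (\<beta> - 4 * (\<alpha> * s)))"
        using third unfolding n_def by (intro mult_left_mono) auto
      also have "\<dots> < W z * g (v z)"
      proof (cases "\<beta> \<le> 4 * (\<alpha> * s)")
        case True
        then have "norm (P z) ^ n * (\<xi> s * (\<beta> - 4 * (\<alpha> * s))) \<le> 0"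
          using \<xi>_bound(1)[of s] by (intro mult_nonneg_nonpos) (auto simp: less_imp_le)
        also have "0 < W z * g (v z)" by (rule Wg_pos[OF zU(1) vM])
        finally show ?thesis .
      next
        case False
        then have "4 * (\<alpha> * s) < \<alpha> * \<rho>\<^sup>2" using \<alpha>(2) by simp
        then have "\<alpha> * (4 * s) < \<alpha> * \<rho>\<^sup>2" by (simp add: mult_ac)
        then have "4 * s < \<rho>\<^sup>2" using \<alpha>(1) mult_less_cancel_left_pos by blast
        then have "(z - c) \<bullet> (z - c) < (\<rho> / 2)\<^sup>2" by (simp add: s power_divide)
        then have "norm (z - c) < \<rho> / 2" using \<rho> by (intro norm_less_if_inner_less) auto
        then have "e \<bullet> z > \<rho> / 2" using height[of z] by linarith
        then have "(K / 2) * (\<rho> / 2) \<le> (K / 2) * (e \<bullet> z)" using K by (intro mult_left_mono) auto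
        then have vlow: "(K / 4) * \<rho> < v z" using \<Psi>_low[OF zU(3)] vz M by simp
        have "norm (P z) ^ n * (\<xi> s * (\<beta> - 4 * (\<alpha> * s))) \<le> (2 * K) ^ n * ((\<delta> * \<beta> / \<rho>) * \<beta>)"
        proof (rule mult_mono)
          show "norm (P z) ^ n \<le> (2 * K) ^ n" using P_bound(2)[OF zU(3)] by (intro power_mono) auto
          have "0 \<le> \<alpha> * s" using \<alpha>(1) s0 by simp
          then show "\<xi> s * (\<beta> - 4 * (\<alpha> * s)) \<le> \<delta> * \<beta> / \<rho> * \<beta>"
            using \<xi>_bound[of s] s0 \<delta> \<beta> \<rho> False by (intro mult_mono) auto
          show "0 \<le> \<xi> s * (\<beta> - 4 * (\<alpha> * s))" using \<xi>_bound(1)[of s] False by simp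
        qed (use K in simp)
        also have "\<dots> = (2 * K) ^ n * (\<beta> * (\<delta> * \<beta>)) / \<rho>" by simp
        also have "\<dots> \<le> \<gamma> / \<rho>" using \<delta>2 \<rho> by (intro divide_right_mono) auto
        also have "\<dots> = (1 / (4 * (3 * \<rho>)\<^sup>2)) ^ CARD('n) * (k * ((K / 4) * \<rho>) ^ (2 * CARD('n) - 1))"
        proof -
          define m where "m = 2 * CARD('n) - 1"
          have m: "2 * CARD('n) - 1 = m" "2 * CARD('n) = Suc m" using N by (simp_all add: m_def)
          have "(1 / (4 * (3 * \<rho>)\<^sup>2)) ^ CARD('n) = (1 / 36) ^ CARD('n) / \<rho> ^ (2 * CARD('n))"
            by (simp add: power_mult_distrib power_divide power_mult)
          then have Wm: "(1 / (4 * (3 * \<rho>)\<^sup>2)) ^ CARD('n) = (1 / 36) ^ CARD('n) / (\<rho> * \<rho> ^ m)"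
            unfolding m by simp
          show ?thesis unfolding Wm unfolding \<gamma>_def m power_mult_distrib using \<rho> by simp
        qed
        also have "\<dots> < W z * g (v z)"
          using zU nz(2)[OF zU(3)] vM vlow K \<rho> by (intro Wg_lower) auto
        finally show ?thesis .
      qed
      finally show "norm (P z) ^ (CARD('n) - 2) * (4 * real (CARD('n) - 1) * \<xi> s + 4 * s * \<xi>' s
         + 4 * real (CARD('n) - 2) * \<xi>' s * ((z - c) \<bullet> P z)\<^sup>2 / (norm (P z))\<^sup>2) < W z * g (v z)" .
    next
      fix z assume z: "z \<in> A" "z \<notin> S"
      then have zU: "z \<in> U" "M \<le> v z" "R \<le> norm z" by (auto simp: A_def L_def)
      have "norm z \<noteq> R" using inner[of z] zU by auto
      then have "(z - c) \<bullet> (z - c) = \<rho>\<^sup>2" using z zU by (auto simp: A_def S_def)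
      then have "\<Psi> z = M + K * (e \<bullet> z)" by (simp add: \<Psi>_def X_def \<alpha>(2))
      then show "v z \<le> \<Psi> z" using vK[of z] zU by simp
    qed simp
    also have "\<Psi> z0 \<le> M + (K - \<theta>) * p"
    proof -
      define s where "s = (\<rho> - p)\<^sup>2"
      have ps: "\<rho> * p \<le> \<rho>\<^sup>2 - s"
      proof -
        have "\<rho>\<^sup>2 - s = \<rho> * p + p * (\<rho> - p)" by (simp add: s_def power2_eq_square algebra_simps)
        moreover have "p * (\<rho> - p) \<ge> 0" using p by simp
        ultimately show ?thesis by simp
      qed
      have b: "\<beta> - \<alpha> * s = \<alpha> * (\<rho>\<^sup>2 - s)" using \<alpha>(2) by (simp add: right_diff_distrib)
      have "\<rho> * p > 0" using \<rho> p by simp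
      then have "\<alpha> * (\<rho>\<^sup>2 - s) \<ge> 0" using ps \<alpha>(1) by simp
      then have as: "\<alpha> * s \<le> \<beta>" using b by simp
      have "\<theta> * p = (\<delta> * \<rho>) * (\<alpha> * (\<rho> * p) * exp (- \<beta>))"
        using \<rho> by (simp add: \<theta>_def \<alpha>_def power2_eq_square)
      also have "\<dots> \<le> (\<delta> * \<rho>) * (\<alpha> * (\<rho>\<^sup>2 - s) * exp (- \<beta>))"
        using ps \<alpha>(1) \<delta> \<rho> by (intro mult_left_mono mult_right_mono) auto
      also have "\<dots> \<le> (\<delta> * \<rho>) * (exp (- (\<alpha> * s)) - exp (- \<beta>))"
        using one_minus_exp_bounds(2)[OF as] \<delta> \<rho> unfolding b by (intro mult_left_mono) auto
      finally have "X s \<le> - (\<theta> * p)" by (simp add: X_def)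
      moreover have "\<Psi> z0 = M + K * p + X s" by (simp add: \<Psi>_def z0c s_def p_def)
      ultimately show ?thesis by (simp add: left_diff_distrib)
    qed
    finally show ?thesis by (simp add: p_def)
  qed
  show ?thesis
  proof (intro exI[of _ "K - \<theta>"] conjI ballI impI)
    show "K - \<theta> \<ge> 0" "K - \<theta> < K" using \<theta> \<theta>K K by auto
    fix z assume z: "z \<in> U" "R \<le> norm z"
    show "v z \<le> M + (K - \<theta>) * (e \<bullet> z)"
    proof (cases "norm z = R")
      case True
      then have "v z < M" using inner z by simp
      moreover have "(K - \<theta>) * (e \<bullet> z) \<ge> 0" using \<theta>K K half[OF z] by (intro mult_nonneg_nonneg) auto
      ultimately show ?thesis by linarith
    qed (use main z in auto)
  qed
qed

lemma absorbed_bound: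
  assumes "z \<in> U" "R \<le> norm z"
  shows "v z \<le> M"
proof -
  define Ks where "Ks = {K. K \<ge> 0 \<and> (\<forall>z\<in>U. R \<le> norm z \<longrightarrow> v z \<le> M + K * (e \<bullet> z))}"
  have ne: "Ks \<noteq> {}" proof -
    obtain C where "C > 0" "\<forall>z\<in>U. R \<le> norm z \<longrightarrow> v z \<le> M + C * (e \<bullet> z)" using linear_bound by blast
    then have "C \<in> Ks" by (simp add: Ks_def)
    then show ?thesis by blast
  qed
  have bb: "bdd_below Ks" by (auto simp: Ks_def bdd_below_def)
  define K where "K = Inf Ks"
  have K0: "K \<ge> 0" unfolding K_def by (rule cInf_greatest[OF ne]) (auto simp: Ks_def)
  have KK: "v z \<le> M + K * (e \<bullet> z)" if z: "z \<in> U" "R \<le> norm z" for z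
  proof -
    have ez: "e \<bullet> z > 0" using half z by simp
    \<comment> \<open>Every admissible slope is at least this quotient, hence so is the infimum;
      thus the infimum is itself admissible.\<close>
    have "(v z - M) / (e \<bullet> z) \<le> K" unfolding K_def
      by (rule cInf_greatest[OF ne]) (use z ez in \<open>auto simp: Ks_def field_simps\<close>)
    then show ?thesis using ez by (simp add: field_simps)
  qed
  have "K = 0"
  proof (rule ccontr)
    assume "K \<noteq> 0"
    then have "K > 0" using K0 by simp
    from slope_improvement[OF this KK] obtain K' where "K' \<in> Ks" "K' < K" by (auto simp: Ks_def)
    then show False using cInf_lower[OF _ bb] by (force simp: K_def)
  qed
  then show ?thesis using KK[OF assms] by simp
qed

end

subsection \<open>The limit at infinity\<close>

text \<open>Here \<open>M\<close> is meant to lie slightly above the boundary value at the singular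
  point, and \<open>V\<close> is the upper bound found from the absorption. Between the two
  \<open>g\<close> has no definite sign, and only a bound from below by \<open>- Q\<close>
  remains.\<close>

locale bounded_solution = half_space_solution \<Omega> a t g u Du e R M
  for \<Omega> :: "(real^'n) set" and a t g u Du e R M +
  fixes Q V :: real
  assumes Q: "Q \<ge> 0" and g_low: "\<And>z. z \<in> U \<Longrightarrow> R \<le> norm z \<Longrightarrow> M \<le> v z \<Longrightarrow> g (v z) \<ge> - Q"
    and V: "\<And>z. z \<in> U \<Longrightarrow> R \<le> norm z \<Longrightarrow> v z \<le> V"
begin

lemma Wg_lower_bound:
  assumes z: "z \<in> U" "T \<le> norm z" "M \<le> v z" and T: "2 * R \<le> T"
  shows "W z * g (v z) \<ge> - (Q * (4 / T\<^sup>2) ^ CARD('n))"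
proof -
  have T0: "T > 0" using T R by simp
  have "T / 2 \<le> norm (z - t)" using norm_triangle_ineq2[of z t] tR T z by linarith
  then have "(T / 2)\<^sup>2 \<le> (norm (z - t))\<^sup>2" using T0 by (intro power_mono) auto
  then have "T\<^sup>2 / 4 \<le> (z - t) \<bullet> (z - t)" by (simp add: power2_norm_eq_inner power_divide)
  moreover have "T\<^sup>2 / 4 > 0" using T0 by simp
  ultimately have "1 / ((z - t) \<bullet> (z - t)) \<le> 1 / (T\<^sup>2 / 4)"
    by (intro divide_left_mono mult_pos_pos) linarith+
  then have "W z \<le> (4 / T\<^sup>2) ^ CARD('n)" unfolding W_def by (intro power_mono) auto
  then have "W z * Q \<le> (4 / T\<^sup>2) ^ CARD('n) * Q" using Q by (rule mult_right_mono)
  moreover have "W z * (- Q) \<le> W z * g (v z)"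
    using g_low[of z] z T R W_pos[OF z(1)] by (intro mult_left_mono) auto
  ultimately show ?thesis by (simp add: mult.commute)
qed

text \<open>All radii are between T/2 and D T, so minus the N-Laplacian of the barrier is at least a
  constant times S^(N-1) / T^N, while the reaction is at least -Q (4 / T^2)^N. The hypothesis
  \<open>small\<close> states that the former wins. The excess at a point between two spheres is
  then bounded by interpolation with -1/s, the sphere of radius \<open>r\<close> carrying the excess
  \<open>S'\<close>.\<close>

lemma radial_gain:
  fixes c :: "real^'n"
  assumes T: "2 * R \<le> T" and r: "T / 2 \<le> r" "r < \<rho>" "\<rho> \<le> D * T" and S: "S > 0" and S': "S' \<ge> 0"
    and B: "B \<ge> S * r\<^sup>2 / 2"
    and far: "\<And>z. z \<in> U \<Longrightarrow> r \<le> norm (z - c) \<Longrightarrow> norm (z - c) \<le> \<rho> \<Longrightarrow> T \<le> norm z"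
    and outer: "\<And>z. z \<in> U \<Longrightarrow> norm (z - c) = \<rho> \<Longrightarrow> v z \<le> M + S' + B * (1 / r\<^sup>2 - 1 / \<rho>\<^sup>2)"
    and inner: "\<And>z. z \<in> U \<Longrightarrow> norm (z - c) = r \<Longrightarrow> v z \<le> M + S'"
    and small: "Q * (2 * 4 ^ CARD('n) * 4 ^ (CARD('n) - 2) * D ^ (3 * (CARD('n) - 2) + 4))
      < S ^ (CARD('n) - 1) * T ^ CARD('n)"
    and z0: "z0 \<in> U" "r \<le> norm (z0 - c)" "norm (z0 - c) \<le> \<rho>"
  shows "v z0 \<le> M + S' + B * (1 / r\<^sup>2 - 1 / (norm (z0 - c))\<^sup>2)"
proof -
  define n where "n = CARD('n) - 2"
  have Nn: "CARD('n) = n + 2" using N by (simp add: n_def)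
  have T0: "T > 0" using T R by simp
  have r0: "r > 0" using r T0 by simp
  have \<rho>0: "\<rho> > 0" using r r0 by simp
  have D0: "D > 0" using \<rho>0 r(3) T0 by (metis less_le_trans zero_less_mult_pos2)
  have "S * r\<^sup>2 / 2 > 0" using S r0 by simp
  then have B0: "B > 0" using B by linarith
  have nrm: "(z - c) \<bullet> (z - c) = (norm (z - c))\<^sup>2" for z by (simp add: power2_norm_eq_inner)
  define \<Psi> where "\<Psi> z = (M + S' + B / r\<^sup>2) + (- B / ((z - c) \<bullet> (z - c)))" for z
  have \<Psi>n: "\<Psi> z = M + S' + B * (1 / r\<^sup>2 - 1 / (norm (z - c))\<^sup>2)" for z
    by (simp add: \<Psi>_def nrm right_diff_distrib)
  have bdry: "v z \<le> \<Psi> z" if "z \<in> U" "norm (z - c) = r \<or> norm (z - c) = \<rho>" for z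
    using outer[of z] inner[of z] that unfolding \<Psi>n by auto
  show ?thesis
  proof (cases "norm (z0 - c) = r \<or> norm (z0 - c) = \<rho>")
    case True
    then show ?thesis using bdry[of z0] z0 by (simp add: \<Psi>n)
  next
    case False
    define G where "G = {z \<in> U. r < norm (z - c) \<and> norm (z - c) < \<rho>}"
    define A where "A = {z \<in> L (norm c + \<rho>). r \<le> norm (z - c) \<and> norm (z - c) \<le> \<rho>}"
    have "v z0 \<le> \<Psi> z0"
    proof (rule comparison_radial[where c=c and C="M + S' + B / r\<^sup>2" and S=G and A=A and I="{r\<^sup>2<..<\<rho>\<^sup>2}"
        and X="\<lambda>s. - B / s" and \<xi>="\<lambda>s. B / s\<^sup>2" and \<xi>'="\<lambda>s. - 2 * B / s ^ 3"])
      have "open (U \<inter> {z. r < norm (z - c)} \<inter> {z. norm (z - c) < \<rho>})"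
        by (intro open_Int open_U open_Collect_less continuous_intros)
      moreover have "U \<inter> {z. r < norm (z - c)} \<inter> {z. norm (z - c) < \<rho>} = G" by (auto simp: G_def)
      ultimately show "open G" by simp
      show "G \<subseteq> U" by (auto simp: G_def)
      have "closed ({z. r \<le> norm (z - c)} \<inter> {z. norm (z - c) \<le> \<rho>})"
        by (intro closed_Int closed_Collect_le continuous_intros)
      then have "compact (L (norm c + \<rho>) \<inter> ({z. r \<le> norm (z - c)} \<inter> {z. norm (z - c) \<le> \<rho>}))"
        by (rule compact_Int_closed[OF compact_L])
      moreover have "L (norm c + \<rho>) \<inter> ({z. r \<le> norm (z - c)} \<inter> {z. norm (z - c) \<le> \<rho>}) = A"
        by (auto simp: A_def)
      ultimately show "compact A" by simp
      show "A \<subseteq> U" using L_U by (auto simp: A_def)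
      show "\<Psi> z = M + S' + B / r\<^sup>2 + - B / ((z - c) \<bullet> (z - c))" for z by (simp add: \<Psi>_def)
      show "continuous_on A \<Psi>" unfolding \<Psi>_def
        using r0 by (intro continuous_intros) (auto simp: A_def)
      show "continuous_on {r\<^sup>2<..<\<rho>\<^sup>2} (\<lambda>s. - 2 * B / s ^ 3)"
        using r0 by (intro continuous_intros) (auto simp: power2_eq_square)
      show "z0 \<in> G" using z0 False by (auto simp: G_def)
    next
      fix z assume z: "z \<in> G"
      then have zU: "z \<in> U" "r < norm (z - c)" "norm (z - c) < \<rho>" by (auto simp: G_def)
      define \<tau> where "\<tau> = norm (z - c)"
      have \<tau>: "r < \<tau>" "\<tau> < \<rho>" "\<tau> > 0" using zU r0 by (auto simp: \<tau>_def)
      have zT: "T \<le> norm z" using far zU by simp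
      have "r\<^sup>2 < \<tau>\<^sup>2" "\<tau>\<^sup>2 < \<rho>\<^sup>2" using \<tau> r0 by (auto intro!: power_strict_mono)
      then show "(z - c) \<bullet> (z - c) \<in> {r\<^sup>2<..<\<rho>\<^sup>2}" by (simp add: nrm \<tau>_def)
      assume vz: "\<Psi> z < v z"
      have "1 / \<tau>\<^sup>2 \<le> 1 / r\<^sup>2" using \<tau> r0 by (intro divide_left_mono power_mono) auto
      then have "B * (1 / r\<^sup>2 - 1 / \<tau>\<^sup>2) \<ge> 0" using B0 by simp
      then have vM: "v z > M" using vz S' unfolding \<Psi>n \<tau>_def by linarith
      have "norm z \<le> norm c + \<rho>" using norm_triangle_ineq[of "z - c" c] zU by simp
      then show "z \<in> A" using zU zT T R vM by (auto simp: A_def L_def)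
      fix s assume s: "s = (z - c) \<bullet> (z - c)"
      have s\<tau>: "s = \<tau>\<^sup>2" by (simp add: s nrm \<tau>_def)
      have e1: "B / s\<^sup>2 + s * (- 2 * B / s ^ 3) = - (B / \<tau> ^ 4)"
        using \<tau> by (simp add: s\<tau> power2_eq_square power3_eq_cube divide_simps eval_nat_numeral)
      have e2: "2 * (B / s\<^sup>2) * norm (z - c) = 2 * B / \<tau> ^ 3"
        using \<tau> by (simp add: s\<tau> \<tau>_def[symmetric] power2_eq_square power3_eq_cube divide_simps)
      \<comment> \<open>Both factors are bounded below through \<tau> \<le> D T and B \<ge> S T^2 /
        8, the latter from T/2 \<le> r. The powers \<tau>^3, taken n times, and \<tau>^4 give
        D^(3n+4).\<close>
      have "S ^ (n + 1) / (2 * 4 ^ n * D ^ (3 * n + 4) * T ^ (n + 2)) \<le> 4 * ((2 * B / \<tau> ^ 3) ^ n * (B / \<tau> ^ 4))"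
      proof -
        have TD: "\<tau> \<le> D * T" using \<tau> r by simp
        have Br: "B \<ge> S * T\<^sup>2 / 8"
        proof -
          have "(T / 2)\<^sup>2 \<le> r\<^sup>2" using r T0 by (intro power_mono) auto
          then have "S * (T\<^sup>2 / 4) \<le> S * r\<^sup>2" using S by (simp add: power_divide)
          then show ?thesis using B by simp
        qed
        have "S / (4 * D ^ 3 * T) = 2 * (S * T\<^sup>2 / 8) / (D * T) ^ 3"
          using T0 D0 by (simp add: power_mult_distrib power2_eq_square power3_eq_cube divide_simps)
        also have "\<dots> \<le> 2 * B / \<tau> ^ 3"
          using Br B0 \<tau> TD S by (intro frac_le power_mono mult_left_mono) auto
        finally have i1: "S / (4 * D ^ 3 * T) \<le> 2 * B / \<tau> ^ 3" .
        have "S / (8 * D ^ 4 * T\<^sup>2) = (S * T\<^sup>2 / 8) / (D * T) ^ 4"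
          using T0 D0 by (simp add: power_mult_distrib power2_eq_square divide_simps eval_nat_numeral)
        also have "\<dots> \<le> B / \<tau> ^ 4"
          using Br B0 \<tau> TD S by (intro frac_le power_mono) auto
        finally have i2: "S / (8 * D ^ 4 * T\<^sup>2) \<le> B / \<tau> ^ 4" .
        have "S ^ (n + 1) / (2 * 4 ^ n * D ^ (3 * n + 4) * T ^ (n + 2))
          = 4 * (S / (4 * D ^ 3 * T)) ^ n * (S / (8 * D ^ 4 * T\<^sup>2))"
          by (simp add: power_divide power_mult_distrib power_add power_mult power2_eq_square)
        also have "\<dots> \<le> 4 * (2 * B / \<tau> ^ 3) ^ n * (B / \<tau> ^ 4)"
          using i1 i2 S D0 T0 by (intro mult_power_mult_mono) auto
        finally show ?thesis by simp
      qed
      moreover have "Q * (4 / T\<^sup>2) ^ CARD('n) < S ^ (n + 1) / (2 * 4 ^ n * D ^ (3 * n + 4) * T ^ (n + 2))"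
      proof -
        have q: "2 * 4 ^ n * D ^ (3 * n + 4) * T ^ (n + 2) > 0" using D0 T0 by simp
        have "Q * (4 / T\<^sup>2) ^ CARD('n) * (2 * 4 ^ n * D ^ (3 * n + 4) * T ^ (n + 2))
          = Q * (2 * 4 ^ (n + 2) * 4 ^ n * D ^ (3 * n + 4)) / T ^ (n + 2)"
        proof -
          have "(4 / T\<^sup>2) ^ CARD('n) = 4 ^ (n + 2) / (T ^ (n + 2) * T ^ (n + 2))"
            unfolding Nn by (simp add: power_divide power2_eq_square power_mult_distrib)
          moreover have "T ^ (n + 2) \<noteq> 0" using T0 by simp
          ultimately show ?thesis by simp
        qed
        also have "\<dots> < S ^ (n + 1)"
          using small T0 by (simp add: Nn pos_divide_less_eq)
        finally show ?thesis using q by (simp add: pos_less_divide_eq)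
      qed
      moreover have "4 * ((2 * B / \<tau> ^ 3) ^ n * (B / \<tau> ^ 4)) \<le> 4 * real (CARD('n) - 1) * (2 * B / \<tau> ^ 3) ^ n * (B / \<tau> ^ 4)"
      proof -
        have "0 \<le> (2 * B / \<tau> ^ 3) ^ n * (B / \<tau> ^ 4)" using B0 \<tau> by simp
        then have "1 * ((2 * B / \<tau> ^ 3) ^ n * (B / \<tau> ^ 4)) \<le> real (CARD('n) - 1) * ((2 * B / \<tau> ^ 3) ^ n * (B / \<tau> ^ 4))"
          by (intro mult_right_mono) (auto simp: Nn)
        moreover have "4 * real (CARD('n) - 1) * (2 * B / \<tau> ^ 3) ^ n * (B / \<tau> ^ 4)
          = 4 * (real (CARD('n) - 1) * ((2 * B / \<tau> ^ 3) ^ n * (B / \<tau> ^ 4)))" by (simp only: mult.assoc)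
        ultimately show ?thesis by linarith
      qed
      moreover have "W z * g (v z) \<ge> - (Q * (4 / T\<^sup>2) ^ CARD('n))"
        by (rule Wg_lower_bound[OF zU(1) zT less_imp_le[OF vM] T])
      ultimately show "4 * real (CARD('n) - 1) * (2 * (B / s\<^sup>2) * norm (z - c)) ^ (CARD('n) - 2) *
         (B / s\<^sup>2 + s * (- 2 * B / s ^ 3)) < W z * g (v z)"
        unfolding e1 e2 n_def[symmetric] by simp
    next
      fix z assume z: "z \<in> A" "z \<notin> G"
      then have "z \<in> U" "norm (z - c) = r \<or> norm (z - c) = \<rho>" by (auto simp: A_def G_def L_def)
      then show "v z \<le> \<Psi> z" by (rule bdry)
    next
      fix s assume s': "s \<in> {r\<^sup>2<..<\<rho>\<^sup>2}"
      have "r\<^sup>2 > 0" using r0 by simp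
      then have s: "s > 0" using s' unfolding greaterThanLessThan_iff by linarith
      then show "0 < s \<and> 0 < B / s\<^sup>2" using B0 by simp
      show "((\<lambda>s. - B / s) has_real_derivative B / s\<^sup>2) (at s)"
        using DERIV_recip_diff(1)[of 0 s B] s by simp
      show "((\<lambda>s. B / s\<^sup>2) has_real_derivative - 2 * B / s ^ 3) (at s)"
        using DERIV_recip_diff(2)[of 0 s B] s by simp
    qed
    then show ?thesis by (simp add: \<Psi>n)
  qed
qed

text \<open>The number \<open>D\<close> bounds the ratio of the radii to \<open>T\<close>. For fixed
  \<open>D\<close> and positive \<open>S\<close> the condition holds for all large
  \<open>T\<close>.\<close>

definition small :: "real \<Rightarrow> real \<Rightarrow> real \<Rightarrow> bool" where
  "small D S T \<longleftrightarrow> Q * (2 * 4 ^ CARD('n) * 4 ^ (CARD('n) - 2) * D ^ (3 * (CARD('n) - 2) + 4))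
      < S ^ (CARD('n) - 1) * T ^ CARD('n)"

text \<open>A ball touching the hyperplane from below at the projection \<open>h\<close> of
  \<open>z\<close> has no point of \<open>U\<close> on its sphere, so the barrier may start there
  with excess zero. At a point that is low compared with the radius, only a fraction of the full
  excess \<open>S\<close> has accumulated.\<close>

lemma boundary_gain:
  assumes T: "2 * R \<le> T" and S: "S > 0" and small: "small D S T"
    and vS: "\<And>z. z \<in> U \<Longrightarrow> T \<le> norm z \<Longrightarrow> v z \<le> M + S"
    and z: "z \<in> U" "R \<le> norm z" and h: "h = z - (e \<bullet> z) *\<^sub>R e"
    and hT: "2 * T \<le> norm h" "norm h \<le> D * T" and p: "e \<bullet> z \<le> norm h / 32"
  shows "v z \<le> M + S / 2"
proof -
  have T0: "T > 0" using T R by simp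
  \<comment> \<open>The ball of radius 2d around \<open>c\<close> avoids \<open>ball 0 T\<close>,
    since |c| \<ge> |h| = 4d and 2d \<ge> T.\<close>
  define d where "d = norm h / 4"
  have h0: "norm h > 0" using hT(1) T0 by linarith
  then have d0: "d > 0" by (simp add: d_def)
  define c where "c = h - d *\<^sub>R e"
  have p0: "e \<bullet> z > 0" using half z by simp
  have he: "e \<bullet> h = 0" by (simp add: h inner_diff_right e_inner_e)
  have zc: "z - c = (e \<bullet> z + d) *\<^sub>R e" by (simp add: c_def h algebra_simps)
  have nzc: "norm (z - c) = e \<bullet> z + d" unfolding zc using e p0 d0 by simp
  have cn: "norm h \<le> norm c"
  proof -
    have "c \<bullet> c = h \<bullet> h + d\<^sup>2"
      using he by (simp add: c_def inner_diff_left inner_diff_right inner_commute e_inner_e power2_eq_square)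
    then have "h \<bullet> h \<le> c \<bullet> c" by simp
    then show ?thesis by (simp add: norm_le)
  qed
  \<comment> \<open>The factor 4/3 makes the barrier gain exactly \<open>S\<close> between the radii
    d and 2d. At height at most d/8 the gain is at most 8/3 * 1/8 * S = S/3.\<close>
  define B where "B = 4 / 3 * S * d\<^sup>2"
  have out: "d < norm (w - c)" if "w \<in> U" "R \<le> norm w" for w
  proof -
    have "e \<bullet> (w - c) = e \<bullet> w + d" using he by (simp add: c_def inner_diff_right e_inner_e)
    then show ?thesis using e_le[of "w - c"] half[OF that] by linarith
  qed
  have far: "T \<le> norm w" if "norm (w - c) \<le> 2 * d" for w
  proof -
    have "norm c - norm (w - c) \<le> norm w" using norm_triangle_ineq2[of c "c - w"] by (simp add: norm_minus_commute)
    then show ?thesis using cn that hT by (simp add: d_def)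
  qed
  have "v z \<le> M + 0 + B * (1 / d\<^sup>2 - 1 / (norm (z - c))\<^sup>2)"
  proof (rule radial_gain[where T=T and \<rho>="2 * d" and D=D and S=S])
    show "2 * R \<le> T" by (rule T)
    show "T / 2 \<le> d" "2 * d \<le> D * T" using hT h0 unfolding d_def by linarith+
    show "d < 2 * d" using d0 by simp
    show "S * d\<^sup>2 / 2 \<le> B" using S by (simp add: B_def)
    show "v w \<le> M + 0 + B * (1 / d\<^sup>2 - 1 / (2 * d)\<^sup>2)" if "w \<in> U" "norm (w - c) = 2 * d" for w
    proof -
      have "B * (1 / d\<^sup>2 - 1 / (2 * d)\<^sup>2) = S" using d0 by (simp add: B_def power_mult_distrib divide_simps)
      then show ?thesis using vS[of w] far[of w] that by simp
    qed
    show "v w \<le> M + 0" if "w \<in> U" "norm (w - c) = d" for w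
      using out[of w] far[of w] that T R d0 by auto
    show "z \<in> U" "d \<le> norm (z - c)" using z out[of z] by auto
    show "norm (z - c) \<le> 2 * d" unfolding nzc using p h0 unfolding d_def by linarith
    show "Q * (2 * 4 ^ CARD('n) * 4 ^ (CARD('n) - 2) * D ^ (3 * (CARD('n) - 2) + 4))
      < S ^ (CARD('n) - 1) * T ^ CARD('n)" using small by (simp add: small_def)
  qed (use S far in auto)
  moreover have "B * (1 / d\<^sup>2 - 1 / (norm (z - c))\<^sup>2) \<le> S / 3"
  proof -
    have "1 / d\<^sup>2 - 1 / (norm (z - c))\<^sup>2 \<le> 2 * (e \<bullet> z) / d ^ 3"
      unfolding nzc using p0 d0 by (intro recip_square_diff_le) auto
    then have "B * (1 / d\<^sup>2 - 1 / (norm (z - c))\<^sup>2) \<le> B * (2 * (e \<bullet> z) / d ^ 3)"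
      using S by (intro mult_left_mono) (auto simp: B_def)
    also have "\<dots> = 8 / 3 * S * ((e \<bullet> z) / d)"
      using d0 by (simp add: B_def power2_eq_square power3_eq_cube)
    also have "\<dots> \<le> 8 / 3 * S * (1 / 8)"
      using p d0 S by (intro mult_left_mono) (auto simp: d_def divide_simps)
    finally show ?thesis by simp
  qed
  ultimately show ?thesis using S by linarith
qed

text \<open>A point \<open>y\<close> high above the origin lies in a ball that avoids \<open>ball 0 T\<close> and whose centre,
  far away in a horizontal direction \<open>f\<close>, is so low that the boundary gain applies near it.\<close>

lemma interior_gain:
  assumes T: "2 * R \<le> T" and S: "S > 0" and small: "small (2300 * 8800) S T"
    and vS: "\<And>z. z \<in> U \<Longrightarrow> T \<le> norm z \<Longrightarrow> v z \<le> M + S"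
    and y: "y \<in> U" "norm y = 8800 * T"
  shows "v y \<le> M + (1 - 33\<^sup>2 / (4 * 2200 ^ 4)) * S"
proof -
  have T0: "T > 0" using T R by simp
  define q where "q = norm y"
  have q: "q = 8800 * T" "q > 0" using y T0 by (auto simp: q_def)
  have half_le: "M + S / 2 \<le> M + (1 - 33\<^sup>2 / (4 * 2200 ^ 4)) * S"
    using S by (simp add: field_simps)
  define h where "h = y - (e \<bullet> y) *\<^sub>R e"
  have Ry: "R \<le> norm y" using y T R by simp
  have p0: "e \<bullet> y > 0" using half y(1) Ry by simp
  have he: "e \<bullet> h = 0" by (simp add: h_def inner_diff_right e_inner_e)
  have hq: "norm h \<le> q"
  proof -
    have "h \<bullet> h = y \<bullet> y - (e \<bullet> y)\<^sup>2"
      by (simp add: h_def inner_diff_left inner_diff_right inner_commute e_inner_e power2_eq_square algebra_simps)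
    then have "h \<bullet> h \<le> y \<bullet> y" by simp
    then show ?thesis by (simp add: norm_le q_def)
  qed
  show ?thesis
  proof (cases "2 * T \<le> norm h \<and> e \<bullet> y \<le> norm h / 32")
    case True
    have "v y \<le> M + S / 2"
      by (rule boundary_gain[OF T S small vS y(1) Ry h_def]) (use True hq q T0 in auto)
    then show ?thesis using half_le by linarith
  next
    case False
    have "y = h + (e \<bullet> y) *\<^sub>R e" by (simp add: h_def)
    then have "q \<le> norm h + e \<bullet> y"
      using norm_triangle_ineq[of h "(e \<bullet> y) *\<^sub>R e"] e p0 by (simp add: q_def)
    \<comment> \<open>Either |h| < 2T, so that almost all of |y| = q is vertical, or |h| < 32 (e
      \<bullet> y); then q \<le> |h| + e \<bullet> y gives the factor 33.\<close>
    then have p: "q / 33 \<le> e \<bullet> y" using False q by (cases "2 * T \<le> norm h") auto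
    obtain f where f: "norm f = 1" "e \<bullet> f = 0" "f \<bullet> y \<ge> 0"
    proof (cases "h = 0")
      case True
      have "2 \<le> DIM(real^'n)" using N by simp
      then obtain f0 where f0: "f0 \<noteq> 0" "orthogonal e f0" by (rule orthogonal_to_vector_exists)
      have "y = (e \<bullet> y) *\<^sub>R e" using True by (simp add: h_def)
      then have "f0 \<bullet> y = 0" using f0(2) by (metis inner_commute inner_scaleR_right mult_zero_right orthogonal_def)
      then show ?thesis using f0 by (intro that[of "(1 / norm f0) *\<^sub>R f0"]) (auto simp: orthogonal_def)
    next
      case False
      have "h \<bullet> y = h \<bullet> h" using he by (simp add: h_def inner_diff_left inner_diff_right inner_commute e_inner_e algebra_simps)
      then show ?thesis using False he by (intro that[of "(1 / norm h) *\<^sub>R h"]) auto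
    qed
    \<comment> \<open>Cancels the 33 in q/33 \<le> e \<bullet> y, so that y \<bullet> c \<ge> q^2
      and the squared distance from \<open>y\<close> to \<open>c\<close> is at most C^2 -
      q^2.\<close>
    define r where "r = 33 * q"
    \<comment> \<open>Within distance r of \<open>c\<close> one has f \<bullet> z \<ge> 64r and e
      \<bullet> z \<le> 2r, the ratio 32 required by \<open>boundary_gain\<close>. Moreover |c|
      \<le> 66r = 66 * 33 q, which is below 2200q.\<close>
    define c where "c = (65 * r) *\<^sub>R f + r *\<^sub>R e"
    define C where "C = norm c"
    have ff: "f \<bullet> f = 1" using f(1) by (simp add: norm_eq_1)
    have fc: "f \<bullet> c = 65 * r" "e \<bullet> c = r" using f ff e_inner_e by (simp_all add: c_def inner_add_right inner_commute)
    have r0: "r > 0" using q by (simp add: r_def)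
    have C: "C \<le> 2200 * q" "65 * r \<le> C"
    proof -
      show "C \<le> 2200 * q"
        unfolding C_def c_def using norm_triangle_ineq[of "(65 * r) *\<^sub>R f" "r *\<^sub>R e"] f e r0 q by (simp add: r_def)
      show "65 * r \<le> C" using norm_cauchy_schwarz[of f c] fc f by (simp add: C_def)
    qed
    \<comment> \<open>The distance from \<open>c\<close> to \<open>ball 0 T\<close>. As q = 8800T
      and C \<le> 2200q, shrinking the radius from C to C - T costs at most q^2/2 in the square, and
      \<open>y\<close> stays inside with a margin of q^2/2.\<close>
    define \<rho> where "\<rho> = C - T"
    have r\<rho>: "r < \<rho>" "\<rho> \<le> 2300 * 8800 * T" using C q r0 T0 by (auto simp: \<rho>_def r_def)
    have near: "v z \<le> M + S / 2" if z: "z \<in> U" "norm (z - c) \<le> r" for z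
    proof -
      define k where "k = z - (e \<bullet> z) *\<^sub>R e"
      have n1: "\<bar>f \<bullet> (z - c)\<bar> \<le> r" "\<bar>e \<bullet> (z - c)\<bar> \<le> r"
        using Cauchy_Schwarz_ineq2[of f "z - c"] Cauchy_Schwarz_ineq2[of e "z - c"] f e z by auto
      have fz: "64 * r \<le> f \<bullet> z" "e \<bullet> z \<le> 2 * r" using n1 fc by (auto simp: inner_diff_right)
      have "f \<bullet> k = f \<bullet> z" using f by (simp add: k_def inner_diff_right inner_commute)
      then have k1: "64 * r \<le> norm k" using norm_cauchy_schwarz[of f k] f fz by simp
      have nz: "norm z \<le> C + r" using norm_triangle_ineq[of "z - c" c] z by (simp add: C_def)
      have "k \<bullet> k = z \<bullet> z - (e \<bullet> z)\<^sup>2"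
        by (simp add: k_def inner_diff_left inner_diff_right inner_commute e_inner_e power2_eq_square algebra_simps)
      then have "k \<bullet> k \<le> z \<bullet> z" by simp
      then have k2: "norm k \<le> norm z" by (simp add: norm_le)
      show ?thesis
      proof (rule boundary_gain[OF T S small vS z(1) _ k_def])
        show "R \<le> norm z" using k1 k2 r0 q T R unfolding r_def by linarith
        show "2 * T \<le> norm k" using k1 q T0 unfolding r_def by linarith
        have "norm k \<le> 2200 * q + 33 * q" using k2 nz C unfolding r_def by linarith
        then show "norm k \<le> 2300 * 8800 * T" using q T0 by linarith
        show "e \<bullet> z \<le> norm k / 32" using fz k1 by linarith
      qed
    qed
    show ?thesis
    proof (cases "norm (y - c) \<le> r")
      case True
      then show ?thesis using near[OF y(1)] half_le by linarith
    next
      case False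
      define s where "s = (norm (y - c))\<^sup>2"
      have "r * (q / 33) \<le> r * (e \<bullet> y)" using p r0 by (intro mult_left_mono) auto
      then have "q\<^sup>2 \<le> r * (e \<bullet> y)" by (simp add: r_def power2_eq_square)
      moreover have "65 * r * (f \<bullet> y) \<ge> 0" using f r0 by simp
      ultimately have yc: "q\<^sup>2 \<le> y \<bullet> c"
        by (simp add: c_def inner_add_right inner_commute)
      have "s = y \<bullet> y - 2 * (y \<bullet> c) + c \<bullet> c"
        by (simp add: s_def power2_norm_eq_inner inner_diff_left inner_diff_right inner_commute)
      then have s_le: "s \<le> C\<^sup>2 - q\<^sup>2" using yc by (simp add: q_def C_def power2_norm_eq_inner)
      have \<rho>_ge: "C\<^sup>2 - q\<^sup>2 / 2 \<le> \<rho>\<^sup>2"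
      proof -
        have "2 * C * T \<le> 2 * (2200 * q) * T" using C T0 by (intro mult_right_mono) auto
        also have "\<dots> = q\<^sup>2 / 2" using q by (simp add: power2_eq_square)
        finally have "2 * C * T \<le> q\<^sup>2 / 2" .
        moreover have "\<rho>\<^sup>2 = C\<^sup>2 - 2 * C * T + T\<^sup>2" by (simp add: \<rho>_def power2_eq_square algebra_simps)
        ultimately show ?thesis using zero_le_power2[of T] by linarith
      qed
      have q2: "q\<^sup>2 > 0" using q by simp
      have rs: "r\<^sup>2 < s" unfolding s_def using False r0 by (intro power_strict_mono) auto
      have s0: "s > 0" using rs r0 by (smt (verit) zero_le_power2)
      have s\<rho>: "s + q\<^sup>2 / 2 \<le> \<rho>\<^sup>2" using s_le \<rho>_ge by linarith
      \<comment> \<open>Excess S/2 on the sphere of radius r, where \<open>near\<close> applies, and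
        excess S on the sphere of radius \<rho>.\<close>
      define B where "B = S / 2 / (1 / r\<^sup>2 - 1 / \<rho>\<^sup>2)"
      have r2\<rho>: "r\<^sup>2 < \<rho>\<^sup>2" using r\<rho> r0 by (intro power_strict_mono) auto
      have den: "1 / r\<^sup>2 - 1 / \<rho>\<^sup>2 > 0" "1 / r\<^sup>2 - 1 / \<rho>\<^sup>2 \<le> 1 / r\<^sup>2"
      proof -
        have "r\<^sup>2 > 0" using r0 by simp
        moreover from this have "\<rho>\<^sup>2 > 0" using r2\<rho> by linarith
        ultimately have "1 / \<rho>\<^sup>2 < 1 / r\<^sup>2"
          by (intro divide_strict_left_mono mult_pos_pos r2\<rho>) auto
        then show "1 / r\<^sup>2 - 1 / \<rho>\<^sup>2 > 0" by simp
        show "1 / r\<^sup>2 - 1 / \<rho>\<^sup>2 \<le> 1 / r\<^sup>2" by simp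
      qed
      have B_ge: "S * r\<^sup>2 / 2 \<le> B"
      proof -
        have "S / 2 / (1 / r\<^sup>2) \<le> B" unfolding B_def using den S r0
          by (intro divide_left_mono mult_pos_pos) auto
        then show ?thesis by simp
      qed
      have Bden: "B * (1 / r\<^sup>2 - 1 / \<rho>\<^sup>2) = S / 2" proof -
        have "S / 2 / x * x = S / 2" if "x > 0" for x using that by simp
        from this[OF den(1)] show ?thesis unfolding B_def .
      qed
      have far: "T \<le> norm z" if "norm (z - c) \<le> \<rho>" for z
      proof -
        have "norm c - norm (z - c) \<le> norm z" using norm_triangle_ineq2[of c "c - z"] by (simp add: norm_minus_commute)
        then show ?thesis using that by (simp add: \<rho>_def C_def)
      qed
      have y\<rho>: "norm (y - c) \<le> \<rho>"
      proof (rule power2_le_imp_le)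
        show "(norm (y - c))\<^sup>2 \<le> \<rho>\<^sup>2" using s\<rho> q2 unfolding s_def by linarith
        show "0 \<le> \<rho>" using r\<rho> r0 by simp
      qed
      have "v y \<le> M + S / 2 + B * (1 / r\<^sup>2 - 1 / (norm (y - c))\<^sup>2)"
      proof (rule radial_gain[where T=T and \<rho>=\<rho> and D="2300 * 8800" and S=S])
        show "2 * R \<le> T" by (rule T)
        show "T / 2 \<le> r" using q T0 by (simp add: r_def)
        show "r < \<rho>" "\<rho> \<le> 2300 * 8800 * T" by (fact r\<rho>)+
        show "S * r\<^sup>2 / 2 \<le> B" by (rule B_ge)
        show "v z \<le> M + S / 2 + B * (1 / r\<^sup>2 - 1 / \<rho>\<^sup>2)" if "z \<in> U" "norm (z - c) = \<rho>" for z
          using vS[of z] far[of z] that unfolding Bden by simp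
        show "v z \<le> M + S / 2" if "z \<in> U" "norm (z - c) = r" for z using near that by simp
        show "Q * (2 * 4 ^ CARD('n) * 4 ^ (CARD('n) - 2) * (2300 * 8800) ^ (3 * (CARD('n) - 2) + 4))
          < S ^ (CARD('n) - 1) * T ^ CARD('n)" using small by (simp only: small_def)
      qed (use S far False y y\<rho> in auto)
      moreover have "B * (1 / r\<^sup>2 - 1 / (norm (y - c))\<^sup>2) = S / 2 - B * (1 / s - 1 / \<rho>\<^sup>2)"
        unfolding Bden[symmetric] s_def by (simp add: right_diff_distrib)
      \<comment> \<open>The margin q^2/2 and the bound 2200q for the radii give 1/s - 1/\<rho>^2
        \<ge> 1 / (2 * 2200^4 q^2); multiplied by S r^2 / 2 with r = 33q, this is an absolute
        fraction of S.\<close>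
      moreover have "B * (1 / s - 1 / \<rho>\<^sup>2) \<ge> 33\<^sup>2 / (4 * 2200 ^ 4) * S"
      proof -
        have C0: "C > 0" using C r0 by linarith
        have sC: "s \<le> C\<^sup>2" using s_le q2 by linarith
        have "\<rho> \<le> C" using T0 by (simp add: \<rho>_def)
        then have \<rho>C: "\<rho>\<^sup>2 \<le> C\<^sup>2" using r\<rho> r0 by (intro power_mono) auto
        have \<rho>0: "\<rho>\<^sup>2 > 0" using r\<rho> r0 by simp
        have "1 / (2 * 2200 ^ 4 * q\<^sup>2) = (q\<^sup>2 / 2) / ((2200 * q)\<^sup>2 * (2200 * q)\<^sup>2)"
          using q by (simp add: power2_eq_square)
        also have "\<dots> \<le> (q\<^sup>2 / 2) / (C\<^sup>2 * C\<^sup>2)"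
        proof (rule divide_left_mono)
          have "C\<^sup>2 \<le> (2200 * q)\<^sup>2" using C C0 by (intro power_mono) auto
          then show "C\<^sup>2 * C\<^sup>2 \<le> (2200 * q)\<^sup>2 * (2200 * q)\<^sup>2" by (intro mult_mono) auto
          show "0 < (2200 * q)\<^sup>2 * (2200 * q)\<^sup>2 * (C\<^sup>2 * C\<^sup>2)" using C0 q by simp
        qed simp
        also have "\<dots> \<le> (\<rho>\<^sup>2 - s) / (s * \<rho>\<^sup>2)"
        proof (rule frac_le)
          show "s * \<rho>\<^sup>2 \<le> C\<^sup>2 * C\<^sup>2" using sC \<rho>C s0 \<rho>0 by (intro mult_mono) auto
          show "0 < s * \<rho>\<^sup>2" using s0 \<rho>0 by (rule mult_pos_pos)
        qed (use s\<rho> q2 in linarith)+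
        also have "\<dots> = 1 / s - 1 / \<rho>\<^sup>2" using s0 r\<rho> r0 by (simp add: diff_frac_eq)
        finally have "1 / (2 * 2200 ^ 4 * q\<^sup>2) \<le> 1 / s - 1 / \<rho>\<^sup>2" .
        then have "(S * r\<^sup>2 / 2) * (1 / (2 * 2200 ^ 4 * q\<^sup>2)) \<le> B * (1 / s - 1 / \<rho>\<^sup>2)"
          using B_ge S r0 by (intro mult_mono) (auto intro: order_trans[of 0 "S * r\<^sup>2 / 2"])
        moreover have "(S * r\<^sup>2 / 2) * (1 / (2 * 2200 ^ 4 * q\<^sup>2)) = 33\<^sup>2 / (4 * 2200 ^ 4) * S"
          using q by (simp add: r_def power2_eq_square)
        ultimately show ?thesis by simp
      qed
      ultimately show ?thesis unfolding left_diff_distrib mult_1 by linarith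
    qed
  qed
qed

lemma eventual_bound:
  assumes "\<eta> > 0"
  shows "\<exists>T. \<forall>z\<in>U. T \<le> norm z \<longrightarrow> v z \<le> M + \<eta>"
proof -
  define \<kappa> :: real where "\<kappa> = 33\<^sup>2 / (4 * 2200 ^ 4)"
  have \<kappa>: "0 < \<kappa>" "\<kappa> < 1" by (auto simp: \<kappa>_def)
  define Ss where "Ss = {S. S \<ge> 0 \<and> (\<exists>T\<ge>R. \<forall>z\<in>U. T \<le> norm z \<longrightarrow> v z \<le> M + S)}"
  have "max (V - M) 0 \<in> Ss"
  proof -
    have "\<forall>z\<in>U. R \<le> norm z \<longrightarrow> v z \<le> M + max (V - M) 0" using V by fastforce
    then show ?thesis by (auto simp: Ss_def)
  qed
  then have ne: "Ss \<noteq> {}" by blast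
  have bb: "bdd_below Ss" by (auto simp: Ss_def bdd_below_def)
  define S0 where "S0 = Inf Ss"
  have S0: "S0 \<ge> 0" unfolding S0_def by (rule cInf_greatest[OF ne]) (auto simp: Ss_def)
  have "S0 = 0"
  proof (rule ccontr)
    assume "S0 \<noteq> 0"
    then have S0p: "S0 > 0" using S0 by simp
    \<comment> \<open>Attainment of the infimum is not known, so an admissible \<open>S\<close>
      close enough to it is taken that (1 - \<kappa>) S falls below \<open>S0\<close>.\<close>
    have "S0 < S0 / (1 - \<kappa>)" using S0p \<kappa> by (simp add: field_simps)
    then obtain S where S: "S \<in> Ss" "S < S0 / (1 - \<kappa>)"
      unfolding S0_def using cInf_lessD[OF ne] by blast
    have SS0: "S0 \<le> S" unfolding S0_def by (rule cInf_lower[OF S(1) bb])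
    then have Sp: "S > 0" using S0p by simp
    obtain T1 where T1: "T1 \<ge> R" "\<And>z. z \<in> U \<Longrightarrow> T1 \<le> norm z \<Longrightarrow> v z \<le> M + S"
      using S(1) by (auto simp: Ss_def)
    define E where "E = Q * (2 * 4 ^ CARD('n) * 4 ^ (CARD('n) - 2) * (2300 * 8800) ^ (3 * (CARD('n) - 2) + 4))"
    have E: "E \<ge> 0" using Q by (simp add: E_def)
    define T2 where "T2 = max (max T1 (2 * R)) (max 1 (E / S ^ (CARD('n) - 1) + 1))"
    have T2: "T1 \<le> T2" "2 * R \<le> T2" "1 \<le> T2" "E / S ^ (CARD('n) - 1) + 1 \<le> T2"
      by (auto simp: T2_def)
    have "v z \<le> M + (1 - \<kappa>) * S" if z: "z \<in> U" "8800 * T2 \<le> norm z" for z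
    proof -
      \<comment> \<open>The scale is adapted to the point, since \<open>interior_gain\<close>
        concerns points at distance exactly 8800T; any such T beyond \<open>T2\<close> satisfies
        \<open>small\<close>.\<close>
      define T where "T = norm z / 8800"
      have "T2 \<le> T" using z by (simp add: T_def)
      then have T: "T1 \<le> T" "2 * R \<le> T" "1 \<le> T" "E / S ^ (CARD('n) - 1) + 1 \<le> T"
        using T2 by linarith+
      have "E / S ^ (CARD('n) - 1) < T" using T by simp
      also have "T \<le> T ^ CARD('n)" using T(3) by (intro self_le_power) auto
      finally have "E < T ^ CARD('n) * S ^ (CARD('n) - 1)" using Sp by (simp add: pos_divide_less_eq)
      then have sm: "small (2300 * 8800) S T" unfolding small_def E_def[symmetric] by (simp add: mult.commute)
      show ?thesis unfolding \<kappa>_def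
        by (rule interior_gain[OF T(2) Sp sm _ z(1)]) (use T1(2) T(1) in \<open>auto simp: T_def\<close>)
    qed
    moreover have "8800 * T2 \<ge> R"
      using T1(1) T2 R by linarith
    ultimately have "(1 - \<kappa>) * S \<in> Ss" using Sp \<kappa> by (auto simp: Ss_def)
    then have "S0 \<le> (1 - \<kappa>) * S" unfolding S0_def by (rule cInf_lower[OF _ bb])
    then show False using S(2) \<kappa> by (simp add: field_simps)
  qed
  then obtain S where S: "S \<in> Ss" "S < \<eta>" using cInf_lessD[OF ne, of \<eta>] assms by (auto simp: S0_def)
  then obtain T where "\<And>z. z \<in> U \<Longrightarrow> T \<le> norm z \<Longrightarrow> v z \<le> M + S" by (auto simp: Ss_def)
  then show ?thesis using S(2) by (intro exI[of _ T]) force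
qed

end

subsection \<open>The exterior ball and the boundary point\<close>

lemma has_derivative_pointwise_Lipschitz:
  fixes f :: "'a::real_normed_vector \<Rightarrow> 'b::real_normed_vector"
  assumes "(f has_derivative f') (at a)"
  shows "\<exists>L>0. \<exists>d>0. \<forall>x. norm (x - a) < d \<longrightarrow> norm (f x - f a) \<le> L * norm (x - a)"
proof -
  obtain d where d: "d > 0" "\<And>y. norm (y - a) < d \<Longrightarrow> norm (f y - f a - f' (y - a)) \<le> 1 * norm (y - a)"
    using assms unfolding has_derivative_at_alt by (meson zero_less_one)
  obtain K where K: "K > 0" "\<And>h. norm (f' h) \<le> norm h * K"
    using bounded_linear.pos_bounded[OF has_derivative_bounded_linear[OF assms]] by blast
  have "norm (f x - f a) \<le> (K + 1) * norm (x - a)" if "norm (x - a) < d" for x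
  proof -
    have "norm (f x - f a) \<le> norm (f x - f a - f' (x - a)) + norm (f' (x - a))"
      using norm_triangle_ineq[of "f x - f a - f' (x - a)" "f' (x - a)"] by simp
    then show ?thesis using d(2)[OF that] K(2)[of "x - a"] by (simp add: algebra_simps)
  qed
  then show ?thesis using d(1) K(1) by (intro exI[of _ "K + 1"]) auto
qed

text \<open>For \<open>s > 0\<close> the last condition says that \<open>\<Omega>\<close> avoids, near \<open>a\<close>, the closed ball of
  diameter \<open>1 / s\<close> touching \<open>a\<close> from the direction \<open>- e\<close>.\<close>

lemma exterior_ball:
  fixes \<Omega> :: "'a::euclidean_space set"
  assumes bdry: "compact_C2_boundary \<Omega>" and "open \<Omega>" and a: "a \<in> frontier \<Omega>"
  shows "\<exists>e s \<delta>. norm e = 1 \<and> s \<ge> 0 \<and> \<delta> > 0 \<and>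
    (\<forall>x\<in>\<Omega>. norm (x - a) < \<delta> \<longrightarrow> - s * ((x - a) \<bullet> (x - a)) < e \<bullet> (x - a))"
proof -
  obtain r \<sigma> D\<sigma> where r: "r > 0"
    and D\<sigma>: "\<And>x. x \<in> ball a r \<Longrightarrow> (\<sigma> has_derivative (\<lambda>h. D\<sigma> x \<bullet> h)) (at x) \<and> D\<sigma> x \<noteq> 0"
    and C2: "C2_on \<sigma> (ball a r)" and \<Omega>: "\<Omega> \<inter> ball a r = {x \<in> ball a r. \<sigma> x < 0}"
    using bdry a unfolding compact_C2_boundary_def by meson
  obtain f where f: "\<And>x. x \<in> ball a r \<Longrightarrow> (\<sigma> has_derivative (\<lambda>h. f x \<bullet> h)) (at x)"
    and f1: "\<And>i. i \<in> Basis \<Longrightarrow> C1_on (\<lambda>x. f x \<bullet> i) (ball a r)"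
    using C2 unfolding C2_on_def by blast
  have aball: "a \<in> ball a r" using r by simp
  \<comment> \<open>The boundary definition supplies two gradients of \<sigma>, one nonzero and one
    differentiable; uniqueness of the derivative identifies them.\<close>
  have "(\<lambda>h. f a \<bullet> h) = (\<lambda>h. D\<sigma> a \<bullet> h)"
    using has_derivative_unique[OF f[OF aball]] D\<sigma>[OF aball] by blast
  then have "f a \<bullet> h = D\<sigma> a \<bullet> h" for h by (rule fun_cong)
  then have "(f a - D\<sigma> a) \<bullet> (f a - D\<sigma> a) = 0" by (simp add: inner_diff_left)
  then have "f a = D\<sigma> a" by simp
  then have fa: "f a \<noteq> 0" using D\<sigma>[OF aball] by simp
  have "\<exists>d. ((\<lambda>x. f x \<bullet> i) has_derivative (\<lambda>h. d \<bullet> h)) (at a)" if "i \<in> Basis" for i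
    using f1[OF that] aball unfolding C1_on_def by blast
  then obtain d where d: "\<And>i. i \<in> Basis \<Longrightarrow> ((\<lambda>x. f x \<bullet> i) has_derivative (\<lambda>h. d i \<bullet> h)) (at a)"
    by metis
  have "(f has_derivative (\<lambda>h. \<Sum>i\<in>Basis. (d i \<bullet> h) *\<^sub>R i)) (at a)"
  proof (subst has_derivative_componentwise_within, intro ballI)
    fix i :: 'a assume i: "i \<in> Basis"
    then show "((\<lambda>x. f x \<bullet> i) has_derivative (\<lambda>h. (\<Sum>i\<in>Basis. (d i \<bullet> h) *\<^sub>R i) \<bullet> i)) (at a)"
      using d[OF i] by (simp add: inner_sum_left_Basis)
  qed
  from has_derivative_pointwise_Lipschitz[OF this]
  obtain L \<eta> where L: "L > 0" "\<eta> > 0" "\<And>x. norm (x - a) < \<eta> \<Longrightarrow> norm (f x - f a) \<le> L * norm (x - a)"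
    by blast
  define \<delta> where "\<delta> = min r \<eta>"
  have \<sigma>a: "\<sigma> a \<ge> 0"
  proof -
    have "a \<notin> \<Omega>" using a \<open>open \<Omega>\<close> by (simp add: frontier_def interior_open)
    then show ?thesis using \<Omega> aball by force
  qed
  \<comment> \<open>From \<sigma> a \<ge> 0 > \<sigma> x the mean value theorem gives a point of the
    segment whose gradient has a negative product with x - a. Replacing that gradient by the one at
    \<open>a\<close> costs at most L |x - a|^2, as the gradient is differentiable at
    \<open>a\<close>.\<close>
  have key: "f a \<bullet> (x - a) < L * ((x - a) \<bullet> (x - a))" if x: "x \<in> \<Omega>" "norm (x - a) < \<delta>" for x
  proof -
    define h where "h = x - a"
    have inb: "a + \<tau> *\<^sub>R h \<in> ball a r" "norm (a + \<tau> *\<^sub>R h - a) < \<eta>" "norm (a + \<tau> *\<^sub>R h - a) \<le> norm h"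
      if "0 \<le> \<tau>" "\<tau> \<le> 1" for \<tau>
    proof -
      have *: "\<tau> * norm h \<le> 1 * norm h" using that by (intro mult_right_mono) auto
      show "norm (a + \<tau> *\<^sub>R h - a) \<le> norm h" using * that by simp
      then show "a + \<tau> *\<^sub>R h \<in> ball a r" "norm (a + \<tau> *\<^sub>R h - a) < \<eta>"
        using x(2) by (auto simp: h_def \<delta>_def dist_norm norm_minus_commute)
    qed
    have der: "((\<lambda>\<tau>. \<sigma> (a + \<tau> *\<^sub>R h)) has_real_derivative f (a + \<tau> *\<^sub>R h) \<bullet> h) (at \<tau>)"
      if "0 \<le> \<tau>" "\<tau> \<le> 1" for \<tau>
    proof -
      have "((\<lambda>\<tau>. a + \<tau> *\<^sub>R h) has_derivative (\<lambda>k. k *\<^sub>R h)) (at \<tau>)"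
        by (auto intro!: derivative_eq_intros)
      from has_derivative_compose[OF this f[OF inb(1)[OF that]]]
      show ?thesis by (simp add: has_field_derivative_def mult.commute[of _ "f (a + \<tau> *\<^sub>R h) \<bullet> h"])
    qed
    obtain \<tau> where \<tau>: "0 < \<tau>" "\<tau> < 1"
      "\<sigma> (a + 1 *\<^sub>R h) - \<sigma> (a + 0 *\<^sub>R h) = (1 - 0) * (f (a + \<tau> *\<^sub>R h) \<bullet> h)"
      using MVT2[of 0 1 "\<lambda>\<tau>. \<sigma> (a + \<tau> *\<^sub>R h)" "\<lambda>\<tau>. f (a + \<tau> *\<^sub>R h) \<bullet> h"] der by auto
    have "\<sigma> x < 0"
    proof -
      have "x \<in> \<Omega> \<inter> ball a r" using x by (auto simp: \<delta>_def dist_norm norm_minus_commute)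
      then show ?thesis using \<Omega> by blast
    qed
    then have neg: "f (a + \<tau> *\<^sub>R h) \<bullet> h < 0" using \<tau>(3) \<sigma>a by (simp add: h_def)
    have "\<bar>(f (a + \<tau> *\<^sub>R h) - f a) \<bullet> h\<bar> \<le> norm (f (a + \<tau> *\<^sub>R h) - f a) * norm h"
      by (rule Cauchy_Schwarz_ineq2)
    also have "\<dots> \<le> (L * norm h) * norm h"
    proof (rule mult_right_mono)
      have "norm (f (a + \<tau> *\<^sub>R h) - f a) \<le> L * norm (a + \<tau> *\<^sub>R h - a)"
        by (rule L(3)[OF inb(2)]) (use \<tau> in auto)
      also have "\<dots> \<le> L * norm h" using inb(3)[of \<tau>] \<tau> L(1) by (intro mult_left_mono) auto
      finally show "norm (f (a + \<tau> *\<^sub>R h) - f a) \<le> L * norm h" .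
    qed simp
    also have "\<dots> = L * (h \<bullet> h)" by (simp add: power2_norm_eq_inner[symmetric] power2_eq_square)
    finally have "\<bar>(f (a + \<tau> *\<^sub>R h) - f a) \<bullet> h\<bar> \<le> L * (h \<bullet> h)" .
    then show ?thesis using neg by (simp add: h_def inner_diff_left)
  qed
  show ?thesis
  \<comment> \<open>The inner unit normal at \<open>a\<close>: \<sigma> is negative in \<Omega>, so
    its gradient points outwards.\<close>
  proof (rule exI[of _ "(- 1 / norm (f a)) *\<^sub>R f a"], rule exI[of _ "L / norm (f a)"], rule exI[of _ \<delta>],
      intro conjI ballI impI)
    show "norm ((- 1 / norm (f a)) *\<^sub>R f a) = 1" using fa by simp
    show "0 \<le> L / norm (f a)" using L by simp
    show "\<delta> > 0" using r L by (simp add: \<delta>_def)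
    fix x assume "x \<in> \<Omega>" "norm (x - a) < \<delta>"
    from key[OF this] show "- (L / norm (f a)) * ((x - a) \<bullet> (x - a)) < (- 1 / norm (f a)) *\<^sub>R f a \<bullet> (x - a)"
      using fa by (simp add: divide_strict_right_mono)
  qed
qed

lemma norm_inversion_diff: "norm (inversion a t x - t) = 1 / norm (x - a)"
proof -
  have "(norm (inversion a t x - t))\<^sup>2 = (1 / norm (x - a))\<^sup>2"
    by (simp add: power2_norm_eq_inner inversion_inner power_divide)
  then show ?thesis by (rule power2_eq_imp_eq) auto
qed

text \<open>In the original picture the superlevel set is taken in the closure of \<Omega>, over the
  inverse image of an annulus; there \<open>u\<close> is continuous, so the set is compact. By
  \<open>bd\<close> it misses the frontier, hence lies in \<Omega>, and inversion carries it to the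
  set in question.\<close>

lemma (in inverted_solution) compact_superlevel:
  assumes u_cont: "continuous_on (closure \<Omega> - {a}) u" and R: "norm t < R"
    and bd: "\<And>x. x \<in> frontier \<Omega> \<Longrightarrow> x \<noteq> a \<Longrightarrow> R \<le> norm (inversion a t x) \<Longrightarrow> u x < M"
  shows "compact {z \<in> U. R \<le> norm z \<and> norm z \<le> T \<and> M \<le> v z}"
proof -
  define C where "C = {z::real^'n. R \<le> norm z \<and> norm z \<le> T}"
  have tC: "t \<notin> C" using R by (auto simp: C_def)
  have "closed {z::real^'n. R \<le> norm z}" by (intro closed_Collect_le continuous_intros)
  then have "compact (cball 0 T \<inter> {z::real^'n. R \<le> norm z})"
    by (intro compact_Int_closed compact_cball)
  moreover have "cball 0 T \<inter> {z::real^'n. R \<le> norm z} = C" by (auto simp: C_def)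
  ultimately have "compact C" by simp
  then have JC: "compact (inversion t a ` C)"
    by (intro compact_continuous_image continuous_on_inversion tC)
  have aJC: "a \<notin> inversion t a ` C"
  proof
    assume "a \<in> inversion t a ` C"
    then obtain z where "z \<in> C" "inversion t a z = a" by auto
    then show False using tC inversion_neq[of z t a] by metis
  qed
  define E where "E = {x \<in> closure \<Omega> \<inter> inversion t a ` C. M \<le> u x}"
  have cJ: "compact (closure \<Omega> \<inter> inversion t a ` C)" using compact_Int_closed[OF JC closed_closure[of \<Omega>]] by (simp add: Int_commute)
  have "continuous_on (closure \<Omega> \<inter> inversion t a ` C) u"
    by (rule continuous_on_subset[OF u_cont]) (use aJC in blast)
  then have "closed E" unfolding E_def
    by (intro continuous_on_closed_Collect_le continuous_on_const compact_imp_closed[OF cJ])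
  then have "compact ((closure \<Omega> \<inter> inversion t a ` C) \<inter> E)" by (rule compact_Int_closed[OF cJ])
  moreover have "(closure \<Omega> \<inter> inversion t a ` C) \<inter> E = E" by (auto simp: E_def)
  ultimately have Ec: "compact E" by simp
  have aE: "a \<notin> E" using aJC by (auto simp: E_def)
  have IJ: "inversion a t (inversion t a z) = z" if "z \<in> C" for z
    using that tC by (intro inversion_inverse) auto
  have E\<Omega>: "E \<subseteq> \<Omega>"
  proof
    fix x assume x: "x \<in> E"
    then obtain z where z: "z \<in> C" "x = inversion t a z" by (auto simp: E_def)
    then have "R \<le> norm (inversion a t x)" using IJ[of z] by (simp add: C_def)
    moreover have "x \<noteq> a" "M \<le> u x" "x \<in> closure \<Omega>" using x aE unfolding E_def by blast+
    ultimately have "x \<notin> frontier \<Omega>" using bd[of x] by linarith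
    then show "x \<in> \<Omega>" using \<open>x \<in> closure \<Omega>\<close> open_\<Omega> by (simp add: frontier_def interior_open)
  qed
  have "inversion a t ` E = {z \<in> U. R \<le> norm z \<and> norm z \<le> T \<and> M \<le> v z}"
  proof (intro equalityI subsetI)
    fix z assume "z \<in> inversion a t ` E"
    then obtain x where x: "x \<in> E" "z = inversion a t x" by auto
    then obtain z' where z': "z' \<in> C" "x = inversion t a z'" by (auto simp: E_def)
    have zz: "z = z'" using x z' IJ by simp
    have "z \<in> U" "M \<le> u x" using x E\<Omega> unfolding U_def E_def by blast+
    then show "z \<in> {z \<in> U. R \<le> norm z \<and> norm z \<le> T \<and> M \<le> v z}"
      using z' zz by (simp add: C_def v_def)
  next
    fix z assume z: "z \<in> {z \<in> U. R \<le> norm z \<and> norm z \<le> T \<and> M \<le> v z}"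
    then have zC: "z \<in> C" and zU: "z \<in> U" by (auto simp: C_def)
    have "inversion t a z \<in> E"
      using z zC inversion_U[OF zU] closure_subset by (auto simp: E_def v_def)
    then show "z \<in> inversion a t ` E" using IJ[OF zC] by force
  qed
  moreover have "compact (inversion a t ` E)"
    by (intro compact_continuous_image continuous_on_inversion aE Ec)
  ultimately show ?thesis by simp
qed

lemma upper_limit_at_boundary_point:
  fixes \<Omega> :: "(real^'n) set"
  assumes N: "CARD('n) \<ge> 2" and "open \<Omega>" and a: "a \<notin> \<Omega>" and fr: "compact (frontier \<Omega>)"
    and e: "norm e = 1" and s: "s \<ge> 0" and \<delta>: "\<delta> > 0"
    and ball: "\<And>x. x \<in> \<Omega> \<Longrightarrow> norm (x - a) < \<delta> \<Longrightarrow> - s * ((x - a) \<bullet> (x - a)) < e \<bullet> (x - a)"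
    and g: "continuous_on UNIV g" and k: "k > 0"
    and growth: "\<And>r. r \<ge> r0 \<Longrightarrow> g r \<ge> k * r ^ (2 * CARD('n) - 1)"
    and u_diff: "\<And>x. x \<in> \<Omega> \<Longrightarrow> (u has_derivative (\<lambda>h. Du x \<bullet> h)) (at x)"
    and u_cont: "continuous_on (closure \<Omega> - {a}) u" and Du: "continuous_on \<Omega> Du"
    and sol: "weak_solution \<Omega> g u Du"
    and \<Phi>: "continuous_on UNIV \<Phi>" and bc: "\<And>x. x \<in> frontier \<Omega> - {a} \<Longrightarrow> u x = \<Phi> x"
    and \<epsilon>: "\<epsilon> > 0"
  shows "\<exists>\<eta>>0. \<forall>x\<in>\<Omega>. norm (x - a) < \<eta> \<longrightarrow> u x < \<Phi> a + \<epsilon>"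
proof -
  \<comment> \<open>Since e \<bullet> z equals e \<bullet> (x - a) / |x - a|^2 + s, this shift turns
    the exterior ball condition into e \<bullet> z > 0.\<close>
  define t where "t = s *\<^sub>R e"
  have nt: "norm t = s" using s e by (simp add: t_def)
  interpret inverted_solution \<Omega> a t g u Du
    by unfold_locales (use assms in auto)
  have near: "norm (x - a) < d" if "x \<noteq> a" "d > 0" "s + 1 / d < norm (inversion a t x)" for x d
  proof -
    have "norm (inversion a t x) \<le> norm (inversion a t x - t) + s"
      using norm_triangle_ineq[of "inversion a t x - t" t] nt by simp
    then have "1 / d < 1 / norm (x - a)" using that by (simp add: norm_inversion_diff)
    moreover have "norm (x - a) > 0" using that by simp
    ultimately show ?thesis using that by (simp add: field_simps)
  qed
  \<comment> \<open>Chosen so that |z| \<ge> R1 forces |x - a| < \<delta>.\<close>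
  define R1 where "R1 = s + 1 / \<delta> + 1"
  have R1: "R1 > 0" "norm t < R1" proof -
    have "1 / \<delta> > 0" using \<delta> by simp
    then show "R1 > 0" "norm t < R1" using s nt unfolding R1_def by linarith+
  qed
  have half1: "0 < e \<bullet> z" if z: "z \<in> U" "R1 \<le> norm z" for z
  proof -
    obtain x where x: "x \<in> \<Omega>" "z = inversion a t x" using z by (auto simp: U_def)
    have xa: "x \<noteq> a" using x a by auto
    have "norm (x - a) < \<delta>" using near[OF xa \<delta>] z x by (simp add: R1_def)
    then have "- s * ((x - a) \<bullet> (x - a)) < e \<bullet> (x - a)" using ball x by simp
    moreover have "(x - a) \<bullet> (x - a) > 0" using xa by simp
    moreover have "e \<bullet> z = (e \<bullet> (x - a)) / ((x - a) \<bullet> (x - a)) + s"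
      using e by (simp add: x inversion_def inner_add_right t_def norm_eq_1)
    ultimately have "e \<bullet> z * ((x - a) \<bullet> (x - a)) > 0" "(x - a) \<bullet> (x - a) > 0"
      by (simp_all add: distrib_right)
    then show ?thesis by (rule zero_less_mult_pos2)
  qed
  obtain b1 where b1: "\<And>x. x \<in> frontier \<Omega> \<Longrightarrow> \<bar>\<Phi> x\<bar> \<le> b1"
  proof -
    have "bounded (\<Phi> ` frontier \<Omega>)"
      by (rule compact_imp_bounded[OF compact_continuous_image[OF continuous_on_subset[OF \<Phi> subset_UNIV] fr]])
    then show ?thesis using that by (auto simp: bounded_iff)
  qed
  obtain b2 where b2: "\<And>z. z \<in> U \<Longrightarrow> norm z = R1 \<Longrightarrow> \<bar>v z\<bar> \<le> b2"
  proof -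
    \<comment> \<open>The part of the sphere in \<open>U\<close> may fail to be closed, so the bound
      is taken on a compact set in the closure of \<Omega>; it avoids \<open>a\<close>, where
      \<open>u\<close> is not controlled.\<close>
    define Z where "Z = closure \<Omega> \<inter> inversion t a ` sphere 0 R1"
    have tS: "t \<notin> sphere 0 R1" using R1 by auto
    have "compact (inversion t a ` sphere 0 R1)"
      by (intro compact_continuous_image continuous_on_inversion tS compact_sphere)
    from compact_Int_closed[OF this closed_closure[of \<Omega>]] have Zc: "compact Z"
      unfolding Z_def by (simp add: Int_commute)
    have "a \<notin> Z"
    proof
      assume "a \<in> Z"
      then obtain z where "z \<in> sphere 0 R1" "inversion t a z = a" by (auto simp: Z_def)
      then show False using tS inversion_neq[of z t a] by metis
    qed
    then have "Z \<subseteq> closure \<Omega> - {a}" unfolding Z_def by blast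
    then have "continuous_on Z u" by (rule continuous_on_subset[OF u_cont])
    from compact_imp_bounded[OF compact_continuous_image[OF this Zc]]
    obtain b where b: "\<And>x. x \<in> Z \<Longrightarrow> \<bar>u x\<bar> \<le> b" by (auto simp: bounded_iff)
    have "\<bar>v z\<bar> \<le> b" if "z \<in> U" "norm z = R1" for z
    proof -
      have "inversion t a z \<in> Z" using that inversion_U[OF that(1)] closure_subset by (auto simp: Z_def)
      then show ?thesis using b by (simp add: v_def)
    qed
    then show ?thesis using that by blast
  qed
  \<comment> \<open>Above the boundary data, above \<open>v\<close> on the inner sphere, and in the
    range where the growth of \<open>g\<close> holds.\<close>
  define M where "M = max (max 0 r0) (max (b1 + 1) (b2 + 1))"
  have M: "M \<ge> 0" "M \<ge> r0" "b1 < M" "b2 < M" by (auto simp: M_def)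
  interpret A: absorbed_solution \<Omega> a t g u Du e R1 M k
  proof unfold_locales
    show "compact {z \<in> U. R1 \<le> norm z \<and> norm z \<le> T \<and> M \<le> v z}" for T
    proof (rule compact_superlevel[OF u_cont R1(2)])
      show "u x < M" if "x \<in> frontier \<Omega>" "x \<noteq> a" "R1 \<le> norm (inversion a t x)" for x
        using bc[of x] b1[of x] M that by auto
    qed
    show "v z < M" if "z \<in> U" "norm z = R1" for z using b2[OF that] M by auto
    show "k * r ^ (2 * CARD('n) - 1) \<le> g r" if "M \<le> r" for r using growth M that by simp
  qed (use e R1 half1 M k in auto)
  have bound: "v z \<le> M" if "z \<in> U" "R1 \<le> norm z" for z by (rule A.absorbed_bound[OF that])
  define M' where "M' = \<Phi> a + \<epsilon> / 2"
  obtain d where d: "d > 0" "\<And>x. norm (x - a) < d \<Longrightarrow> \<Phi> x < M'"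
  proof -
    have "isCont \<Phi> a" using \<Phi> by (simp add: continuous_on_eq_continuous_at)
    then obtain d where d: "d > 0" "\<And>x. dist x a < d \<Longrightarrow> dist (\<Phi> x) (\<Phi> a) < \<epsilon> / 2"
      unfolding continuous_at_eps_delta using \<epsilon> by (meson half_gt_zero)
    have "\<Phi> x < M'" if "norm (x - a) < d" for x
      using d(2)[of x] that unfolding dist_norm M'_def real_norm_def by linarith
    then show ?thesis using that[of d] d(1) by blast
  qed
  obtain Q where Q: "Q \<ge> 0" "\<And>r. M' \<le> r \<Longrightarrow> r \<le> M \<Longrightarrow> g r \<ge> - Q"
  proof -
    have "bounded (g ` {M'..M})"
      by (rule compact_imp_bounded[OF compact_continuous_image[OF continuous_on_subset[OF g subset_UNIV] compact_Icc]])
    then obtain b where b: "\<forall>y\<in>g ` {M'..M}. norm y \<le> b" by (auto simp: bounded_iff)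
    have "g r \<ge> - max 0 b" if "M' \<le> r" "r \<le> M" for r
    proof -
      have "\<bar>g r\<bar> \<le> b" using b that by simp
      then show ?thesis by linarith
    qed
    then show ?thesis using that[of "max 0 b"] by auto
  qed
  \<comment> \<open>Beyond this radius |x - a| < d, so the boundary data lie below \<open>M'\<close>
    and superlevel sets of the lower level are compact as well.\<close>
  define R2 where "R2 = R1 + 1 / d"
  have R2: "R1 \<le> R2" "norm t < R2" using d R1 by (auto simp: R2_def intro: less_le_trans)
  interpret B: bounded_solution \<Omega> a t g u Du e R2 M' Q M
  proof unfold_locales
    show "compact {z \<in> U. R2 \<le> norm z \<and> norm z \<le> T \<and> M' \<le> v z}" for T
    proof (rule compact_superlevel[OF u_cont R2(2)])
      show "u x < M'" if x: "x \<in> frontier \<Omega>" "x \<noteq> a" "R2 \<le> norm (inversion a t x)" for x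
      proof -
        have "1 / \<delta> > 0" using \<delta> by simp
        then have "s + 1 / d < norm (inversion a t x)" using x(3) unfolding R2_def R1_def by linarith
        then have "norm (x - a) < d" by (rule near[OF x(2) d(1)])
        then show ?thesis using bc[of x] d(2) x by simp
      qed
    qed
  qed (use e R1 R2 half1 bound Q in auto)
  obtain T where T: "\<And>z. z \<in> U \<Longrightarrow> T \<le> norm z \<Longrightarrow> v z \<le> M' + \<epsilon> / 4"
    using B.eventual_bound[of "\<epsilon> / 4"] \<epsilon> by auto
  define T' where "T' = \<bar>T\<bar> + s + 1"
  have T'0: "T' > 0" using s by (simp add: T'_def)
  have "u x < \<Phi> a + \<epsilon>" if x: "x \<in> \<Omega>" "norm (x - a) < 1 / T'" for x
  proof -
    have xa: "norm (x - a) > 0" using x a by auto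
    have "T' < 1 / norm (x - a)" using x(2) xa T'0 by (simp add: field_simps)
    also have "1 / norm (x - a) \<le> norm (inversion a t x) + s"
      using norm_triangle_ineq4[of "inversion a t x" t] nt by (simp add: norm_inversion_diff)
    finally have "T \<le> norm (inversion a t x)" by (simp add: T'_def)
    moreover have "inversion a t x \<in> U" using x by (simp add: U_def)
    ultimately have "v (inversion a t x) \<le> M' + \<epsilon> / 4" using T by blast
    then show ?thesis using xa \<epsilon> by (simp add: v_def inversion_inverse M'_def)
  qed
  then show ?thesis using T'0 by (intro exI[of _ "1 / T'"]) auto
qed

section \<open>Symmetry under a change of sign, growth conditions and the conclusion\<close>

lemma weak_solution_uminus:
  fixes \<Omega> :: "(real^'n) set"
  assumes "weak_solution \<Omega> g u Du"
  shows "weak_solution \<Omega> (\<lambda>r. - g (- r)) (\<lambda>x. - u x) (\<lambda>x. - Du x)"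
  unfolding weak_solution_def
proof (intro allI impI)
  fix \<zeta> :: "real^'n \<Rightarrow> real" and D\<zeta> assume "test_fun \<Omega> \<zeta> D\<zeta>"
  then have "(LINT x:\<Omega>|lborel. norm (Du x) ^ (CARD('n) - 2) * (Du x \<bullet> D\<zeta> x) + g (u x) * \<zeta> x) = 0"
    using assms unfolding weak_solution_def by blast
  then have "(LINT x:\<Omega>|lborel. - (norm (Du x) ^ (CARD('n) - 2) * (Du x \<bullet> D\<zeta> x) + g (u x) * \<zeta> x)) = 0"
    unfolding set_lebesgue_integral_def scaleR_minus_right Bochner_Integration.integral_minus by simp
  then show "(LINT x:\<Omega>|lborel. norm (- Du x) ^ (CARD('n) - 2) * (- Du x \<bullet> D\<zeta> x) + - g (- (- u x)) * \<zeta> x) = 0"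
    by (simp add: algebra_simps)
qed

lemma Liminf_growth:
  assumes "Liminf at_top (\<lambda>r. ereal (g r / r ^ m)) > 0"
  shows "\<exists>k>0. \<exists>r0. \<forall>r\<ge>r0. g r \<ge> k * r ^ m"
proof -
  obtain k where k: "0 < ereal k" "ereal k < Liminf at_top (\<lambda>r. ereal (g r / r ^ m))"
    using ereal_dense2[OF assms] by blast
  from less_LiminfD[OF k(2)] obtain r1 where r1: "\<And>r. r \<ge> r1 \<Longrightarrow> k < g r / r ^ m"
    by (auto simp: eventually_at_top_linorder)
  have "g r \<ge> k * r ^ m" if "r \<ge> max r1 1" for r
  proof -
    have "r ^ m > 0" using that by simp
    then show ?thesis using r1[of r] that by (simp add: pos_less_divide_eq less_imp_le)
  qed
  then have "\<exists>r0. \<forall>r\<ge>r0. g r \<ge> k * r ^ m" by blast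
  then show ?thesis using k(1) by auto
qed

lemma Limsup_growth:
  assumes "Limsup at_bot (\<lambda>r. ereal (g r / \<bar>r\<bar> ^ m)) < 0"
  shows "\<exists>k>0. \<exists>r0. \<forall>r\<ge>r0. - g (- r) \<ge> k * r ^ m"
proof -
  obtain k where k: "ereal k < 0" "Limsup at_bot (\<lambda>r. ereal (g r / \<bar>r\<bar> ^ m)) < ereal k"
    using ereal_dense2[OF assms] by blast
  from Limsup_lessD[OF k(2)] obtain r1 where r1: "\<And>r. r \<le> r1 \<Longrightarrow> g r / \<bar>r\<bar> ^ m < k"
    by (auto simp: eventually_at_bot_linorder)
  have "- g (- r) \<ge> - k * r ^ m" if "r \<ge> max (- r1) 1" for r
  proof -
    have "r ^ m > 0" "\<bar>- r\<bar> = r" using that by simp_all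
    then show ?thesis using r1[of "- r"] that by (simp add: pos_divide_less_eq less_imp_le)
  qed
  then have "\<exists>r0. \<forall>r\<ge>r0. - g (- r) \<ge> - k * r ^ m" by blast
  moreover have "- k > 0" using k(1) by simp
  ultimately show ?thesis by blast
qed

theorem theorem3p1:
  fixes \<Omega> :: "(real^'n) set" and a :: "real^'n" and g :: "real \<Rightarrow> real"
    and u :: "real^'n \<Rightarrow> real" and Du :: "real^'n \<Rightarrow> real^'n"
    and \<Phi> :: "real^'n \<Rightarrow> real"
  assumes N: "CARD('n) \<ge> 2"
    and dom: "open \<Omega>" "connected \<Omega>" "\<Omega> \<noteq> {}"
    and bdry: "compact_C2_boundary \<Omega>"
    and a: "a \<in> frontier \<Omega>"
    and g_cont: "continuous_on UNIV g"
    and g_pos: "Liminf at_top (\<lambda>r. ereal (g r / r ^ (2 * CARD('n) - 1))) > 0"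
    and g_neg: "Limsup at_bot (\<lambda>r. ereal (g r / \<bar>r\<bar> ^ (2 * CARD('n) - 1))) < 0"
    and u_diff: "\<forall>x\<in>\<Omega>. (u has_derivative (\<lambda>h. Du x \<bullet> h)) (at x)"
    and u_C1: "continuous_on (closure \<Omega> - {a}) u" "continuous_on (closure \<Omega> - {a}) Du"
    and sol: "weak_solution \<Omega> g u Du"
    and phi: "C1_on \<Phi> UNIV"
    and bc: "\<forall>x\<in>frontier \<Omega> - {a}. u x = \<Phi> x"
  shows "\<exists>v. continuous_on (closure \<Omega>) v \<and> (\<forall>x\<in>closure \<Omega> - {a}. v x = u x)"
proof -
  have a\<Omega>: "a \<notin> \<Omega>" using a dom(1) by (simp add: frontier_def interior_open)
  have fr: "compact (frontier \<Omega>)" using bdry by (simp add: compact_C2_boundary_def)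
  have Du\<Omega>: "continuous_on \<Omega> Du"
    by (rule continuous_on_subset[OF u_C1(2)]) (use closure_subset a\<Omega> in auto)
  have \<Phi>c: "continuous_on UNIV \<Phi>"
  proof -
    obtain D where "\<And>x. (\<Phi> has_derivative (\<lambda>h. D x \<bullet> h)) (at x)"
      using phi by (auto simp: C1_on_def)
    then show ?thesis by (intro continuous_at_imp_continuous_on ballI has_derivative_continuous)
  qed
  obtain e s \<delta> where ex: "norm e = 1" "s \<ge> 0" "\<delta> > 0"
    "\<And>x. x \<in> \<Omega> \<Longrightarrow> norm (x - a) < \<delta> \<Longrightarrow> - s * ((x - a) \<bullet> (x - a)) < e \<bullet> (x - a)"
    using exterior_ball[OF bdry dom(1) a] by blast
  obtain k1 r1 where k1: "k1 > 0" "\<And>r. r \<ge> r1 \<Longrightarrow> g r \<ge> k1 * r ^ (2 * CARD('n) - 1)"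
    using Liminf_growth[OF g_pos] by blast
  obtain k2 r2 where k2: "k2 > 0" "\<And>r. r \<ge> r2 \<Longrightarrow> - g (- r) \<ge> k2 * r ^ (2 * CARD('n) - 1)"
    using Limsup_growth[OF g_neg] by blast
  have up: "\<exists>\<eta>>0. \<forall>x\<in>\<Omega>. norm (x - a) < \<eta> \<longrightarrow> u x < \<Phi> a + \<epsilon>" if "\<epsilon> > 0" for \<epsilon>
    by (rule upper_limit_at_boundary_point[OF N dom(1) a\<Omega> fr ex g_cont k1 _ u_C1(1) Du\<Omega> sol \<Phi>c _ that])
       (use u_diff bc in auto)
  have dn: "\<exists>\<eta>>0. \<forall>x\<in>\<Omega>. norm (x - a) < \<eta> \<longrightarrow> - u x < - \<Phi> a + \<epsilon>" if "\<epsilon> > 0" for \<epsilon>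
  proof (rule upper_limit_at_boundary_point[OF N dom(1) a\<Omega> fr ex _ k2 _ _ _ weak_solution_uminus[OF sol] _ _ that])
    show "continuous_on UNIV (\<lambda>r. - g (- r))"
      by (intro continuous_intros continuous_on_compose2[OF g_cont]) auto
    show "((\<lambda>x. - u x) has_derivative (\<lambda>h. - Du x \<bullet> h)) (at x)" if "x \<in> \<Omega>" for x
      using u_diff that by (auto intro!: derivative_eq_intros)
    show "continuous_on (closure \<Omega> - {a}) (\<lambda>x. - u x)" "continuous_on \<Omega> (\<lambda>x. - Du x)"
      "continuous_on UNIV (\<lambda>x. - \<Phi> x)"
      by (intro continuous_intros u_C1 Du\<Omega> \<Phi>c)+
  qed (use bc in auto)
  define w where "w x = (if x = a then \<Phi> a else u x)" for x
  have "continuous_on (closure \<Omega>) w"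
    unfolding continuous_on_eq_continuous_within
  proof
    fix x assume x: "x \<in> closure \<Omega>"
    show "continuous (at x within closure \<Omega>) w"
    proof (cases "x = a")
      case False
      then have "continuous (at x within closure \<Omega> - {a}) u"
        using u_C1(1) x by (simp add: continuous_on_eq_continuous_within)
      moreover have "at x within closure \<Omega> - {a} = at x within closure \<Omega>"
        using False by (intro at_within_nhd[of x "- {a}"]) auto
      ultimately have "continuous (at x within closure \<Omega>) u" by simp
      then show ?thesis
        by (rule continuous_transform_within[where \<delta>="dist x a"]) (use x False in \<open>auto simp: w_def dist_commute\<close>)
    next
      case True
      show ?thesis unfolding continuous_within_eps_delta
      proof (intro allI impI)
        fix \<epsilon> :: real assume \<epsilon>: "\<epsilon> > 0"
        obtain \<eta>1 where \<eta>1: "\<eta>1 > 0" "\<And>x. x \<in> \<Omega> \<Longrightarrow> norm (x - a) < \<eta>1 \<Longrightarrow> u x < \<Phi> a + \<epsilon>"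
          using up[OF \<epsilon>] by blast
        obtain \<eta>2 where \<eta>2: "\<eta>2 > 0" "\<And>x. x \<in> \<Omega> \<Longrightarrow> norm (x - a) < \<eta>2 \<Longrightarrow> - u x < - \<Phi> a + \<epsilon>"
          using dn[OF \<epsilon>] by blast
        obtain \<eta>3 where \<eta>3: "\<eta>3 > 0" "\<And>x. dist x a < \<eta>3 \<Longrightarrow> dist (\<Phi> x) (\<Phi> a) < \<epsilon>"
        proof -
          have "isCont \<Phi> a" using \<Phi>c by (simp add: continuous_on_eq_continuous_at)
          then show ?thesis using that \<epsilon> unfolding continuous_at_eps_delta by blast
        qed
        have "dist (w y) (w x) < \<epsilon>" if y: "y \<in> closure \<Omega>" "dist y x < min \<eta>1 (min \<eta>2 \<eta>3)" for y
        proof (cases "y = a")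
          case ya: False
          show ?thesis
          proof (cases "y \<in> \<Omega>")
            case yO: True
            have "u y < \<Phi> a + \<epsilon>" "- u y < - \<Phi> a + \<epsilon>"
              using \<eta>1(2)[OF yO] \<eta>2(2)[OF yO] y True by (auto simp: dist_norm)
            then show ?thesis using ya True by (auto simp: w_def dist_norm abs_less_iff)
          next
            case False
            then have "y \<in> frontier \<Omega> - {a}" using y ya dom(1) by (simp add: frontier_def interior_open)
            then show ?thesis using bc \<eta>3(2)[of y] y True ya by (simp add: w_def)
          qed
        qed (use True \<epsilon> in simp)
        then show "\<exists>d>0. \<forall>x'\<in>closure \<Omega>. dist x' x < d \<longrightarrow> dist (w x') (w x) < \<epsilon>"
          using \<eta>1 \<eta>2 \<eta>3 by (intro exI[of _ "min \<eta>1 (min \<eta>2 \<eta>3)"]) auto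
      qed
    qed
  qed
  then show ?thesis by (intro exI[of _ w]) (auto simp: w_def)
qed

end
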